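(* For each $k\ge0$, $\mathrm I_{sp}[k,\cdot]$ is a semigroup congruence relation (on $\mathbf K_+\mathrm{RV}[k,\cdot]$), and $\mathrm I_{sp}[*,\cdot]$ is a semiring congruence relation (on $\mathbf K_+\mathrm{RV}[*,\cdot]$).
   Context: **Setting.** Algebraically closed nontrivially valued fields of residue characteristic $0$ are viewed in the two-sorted language $\mathcal L_{\mathrm{RV}}$: the sort $\mathrm{VF}$ (the field, ring language); the sort $\mathrm{RV}=\mathrm{VF}^\times/(1+\mathfrak m)\cup\{\infty\}$ ($\mathfrak m$ the maximal ideal of the valuation ring) with its multiplication, the subgroup $\overline{\mathrm K}^\times\subseteq\mathrm{RV}$ (nonzero residue field) and addition on the residue field; and the quotient map $\mathrm{rv}:\mathrm{VF}\to\mathrm{RV}$, $\mathrm{rv}(0)=\infty$. $\mathrm{vrv}:\mathrm{RV}\to\Gamma\cup\{\infty\}$ is the map to the value group $\Gamma=(\mathrm{RV}\setminus\{\infty\})/\overline{\mathrm K}^\times$; $\mathrm{RV}^{>1}=\{x\in\mathrm{RV}:\mathrm{vrv}(x)>0\}\ni\infty$. We work in a sufficiently saturated model of the theory with constants for a small substructure $S$ with $\Gamma(S)$ nontrivial. "Definable" means definable with parameters from $S$; $\mathrm{acl}$ is model-theoretic algebraic closure (over $S$). **$\mathrm{RV}[k,\cdot]$.** Objects are pairs $(U,f)$ with $U\subseteq\mathrm{RV}^m$ and $f=(f_1,\dots,f_k):U\to\mathrm{RV}^k$ definable; an isomorphism $(U,f)\to(V,g)$ is a definable bijection $F:U\to V$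 such that for every $u$ the tuples $f(u)$, $g(F(u))$ have the same number of coordinates different from $\infty$, $g(F(u))\in\mathrm{acl}(f(u))$ and $f(u)\in\mathrm{acl}(g(F(u)))$. $\mathbf K_+\mathrm{RV}[k,\cdot]$ is the semigroup of isomorphism classes under disjoint union; $\mathbf K_+\mathrm{RV}[*,\cdot]=\bigoplus_k\mathbf K_+\mathrm{RV}[k,\cdot]$ is a graded semiring with product induced by $(U,f)\times(V,g)=(U\times V,(f,g))$. **Blowups.** Let $(U,f)\in\mathrm{RV}[k,\cdot]$ be such that, for some coordinate, say the $k$-th, $f_k(t)\ne\infty$ and $f_k(t)\in\mathrm{acl}(f_1(t),\dots,f_{k-1}(t))$ for all $t\in U$. Its elementary blowup is $(U^\sharp,f^\sharp)$ with $U^\sharp=U\times\mathrm{RV}^{>1}$, $f_i^\sharp(t,s)=f_i(t)$ for $i<k$, $f_k^\sharp(t,s)=sf_k(t)$. A blowup of $(V,g)$ is obtained by choosing a definable $C\subseteq V$, an isomorphism onto $(C,g|_C)$ from some $(U,f)\in\mathrm{RV}[k,\cdot]$ such that, for some coordinate $j$, $f_j(t)\ne\infty$ and $f_j(t)\in\mathrm{acl}(f_i(t):i\ne j)$ for all $t\in U$, and forming the disjoint union of $(U^\sharp,f^\sharp)$ and $(V\setminus C,g|_{V\setminus C})$. An iterated blowup is a composition of finitely many (possibly zero) blowups. **$\mathrm I_{sp}$.** $\mathrm I_{sp}[k,\cdot]$ is the class of pairs $(\mathbf U,\mathbf V)$ of objects of $\mathrm{RV}[k,\cdot]$ such that there exist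 isomorphic iterated blowups of $\mathbf U$ and $\mathbf V$; this depends only on isomorphism classes, so it is regarded as a binary relation on isomorphism classes. $\mathrm I_{sp}[*,\cdot]=\coprod_{i\ge0}\mathrm I_{sp}[i,\cdot]$ (componentwise relation). *)

theory Defs
  imports "HOL-Computational_Algebra.Polynomial"
begin

unbundle cardinal_syntax

section \<open>Algebraically closed valued fields of residue characteristic 0\<close>

text \<open>
  The valuation is given by its valuation ring; the last assumption says that it is nontrivial.
\<close>

class acvf = alg_closed_field +
  fixes val_ring :: "'a set"
  assumes val_ring_one: "1 \<in> val_ring"
    and val_ring_diff: "x \<in> val_ring \<Longrightarrow> y \<in> val_ring \<Longrightarrow> x - y \<in> val_ring"
    and val_ring_mult: "x \<in> val_ring \<Longrightarrow> y \<in> val_ring \<Longrightarrow> x * y \<in> val_ring"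
    and val_ring_total: "x \<in> val_ring \<or> inverse x \<in> val_ring"
    and val_ring_proper: "val_ring \<noteq> UNIV"

definition (in acvf) val_units :: "'a set" where
  "val_units = {x \<in> val_ring. x \<noteq> 0 \<and> inverse x \<in> val_ring}"

definition (in acvf) max_ideal :: "'a set" where
  "max_ideal = val_ring - val_units"

class acvf0 = acvf +
  assumes residue_char_0: "n > 0 \<Longrightarrow> of_nat n \<notin> max_ideal"

lemma val_ring_zero: "0 \<in> (val_ring :: 'a::acvf set)"
  using val_ring_diff[OF val_ring_one val_ring_one] by simp

lemma val_ring_uminus: "x \<in> val_ring \<Longrightarrow> - x \<in> (val_ring :: 'a::acvf set)"
  using val_ring_diff[OF val_ring_zero, of x] by simp

lemma val_ring_add: "x \<in> val_ring \<Longrightarrow> y \<in> val_ring \<Longrightarrow> x + y \<in> (val_ring :: 'a::acvf set)"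
  using val_ring_diff[of x "- y"] val_ring_uminus[of y] by simp

lemma val_units_one: "1 \<in> (val_units :: 'a::acvf set)"
  by (simp add: val_units_def val_ring_one)

lemma val_units_nonzero: "x \<in> val_units \<Longrightarrow> x \<noteq> (0 :: 'a::acvf)"
  by (simp add: val_units_def)

lemma val_units_mult: "x \<in> val_units \<Longrightarrow> y \<in> val_units \<Longrightarrow> x * y \<in> (val_units :: 'a::acvf set)"
  by (auto simp: val_units_def val_ring_mult)

lemma val_units_inverse: "x \<in> val_units \<Longrightarrow> inverse x \<in> (val_units :: 'a::acvf set)"
  by (auto simp: val_units_def)

lemma val_units_mult_iff:
  "y \<in> val_units \<Longrightarrow> x * y \<in> val_units \<longleftrightarrow> x \<in> (val_units :: 'a::acvf set)"
  using val_units_mult[of x y] val_units_mult[of "x * y" "inverse y"] val_units_inverse[of y]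
    val_units_nonzero[of y] by (auto simp: field_simps)

lemma max_ideal_zero: "0 \<in> (max_ideal :: 'a::acvf set)"
  by (simp add: max_ideal_def val_units_def val_ring_zero)

lemma max_ideal_mult:
  assumes "x \<in> max_ideal" "y \<in> val_ring" shows "x * y \<in> (max_ideal :: 'a::acvf set)"
proof (cases "x * y \<in> val_units")
  case True
  then have nz: "x \<noteq> 0" "y \<noteq> 0" and inv: "inverse (x * y) \<in> val_ring"
    by (auto simp: val_units_def)
  have "y * inverse (x * y) = inverse x"
    using nz by (simp add: field_simps)
  then have "inverse x \<in> val_ring"
    using val_ring_mult[OF assms(2) inv] by metis
  then have "x \<in> val_units"
    using assms(1) nz by (simp add: val_units_def max_ideal_def)
  then show ?thesis using assms(1) by (simp add: max_ideal_def)
next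
  case False
  then show ?thesis using assms by (auto simp: max_ideal_def val_ring_mult)
qed

lemma max_ideal_uminus: "x \<in> max_ideal \<Longrightarrow> - x \<in> (max_ideal :: 'a::acvf set)"
  using max_ideal_mult[of x "- 1"] val_ring_uminus[OF val_ring_one] by simp

lemma max_ideal_add:
  assumes "x \<in> max_ideal" "y \<in> max_ideal" shows "x + y \<in> (max_ideal :: 'a::acvf set)"
proof -
  have *: "a + b \<in> max_ideal"
    if "a \<in> max_ideal" "b \<in> max_ideal" "b / a \<in> val_ring" for a b :: 'a
  proof (cases "a = 0")
    case False
    then have "a + b = a * (1 + b / a)" by (simp add: field_simps)
    then show ?thesis using that max_ideal_mult val_ring_add val_ring_one by metis
  qed (use that in simp)
  have "y / x \<in> val_ring \<or> x / y \<in> val_ring"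
    using val_ring_total[of "y / x"] by simp
  then show ?thesis
    using *[of x y] *[of y x] assms by (auto simp: add.commute)
qed

lemma one_plus_max_ideal: "x - 1 \<in> max_ideal \<Longrightarrow> x \<in> (val_units :: 'a::acvf set)"
proof (rule ccontr)
  assume *: "x - 1 \<in> max_ideal" "x \<notin> val_units"
  then have "x \<in> val_ring"
    using val_ring_add[of "x - 1" 1] val_ring_one by (simp add: max_ideal_def)
  then have "x \<in> max_ideal" using * by (simp add: max_ideal_def)
  then have "x + - (x - 1) \<in> max_ideal"
    using * max_ideal_add max_ideal_uminus by blast
  then show False by (simp add: max_ideal_def val_units_one)
qed

section \<open>The sort RV\<close>

text \<open>The class of \<open>0\<close> is the point \<open>\<infinity>\<close>; all other classes are cosets of \<open>1 + max_ideal\<close>.\<close>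

definition rv_rel :: "'a::acvf \<Rightarrow> 'a \<Rightarrow> bool" where
  "rv_rel x y \<longleftrightarrow> (x = 0 \<and> y = 0) \<or> (x \<noteq> 0 \<and> y \<noteq> 0 \<and> y / x - 1 \<in> max_ideal)"

lemma rv_rel_cong:
  assumes "rv_rel x y" obtains u where "u - 1 \<in> max_ideal" "u \<in> val_units" "y = x * u"
proof (cases "x = 0")
  case True
  then show ?thesis
    using that[of 1] assms val_units_one max_ideal_zero by (auto simp: rv_rel_def)
next
  case False
  then show ?thesis
    using that[of "y / x"] assms one_plus_max_ideal by (auto simp: rv_rel_def)
qed

lemma rv_relI: "u - 1 \<in> max_ideal \<Longrightarrow> rv_rel x (x * u)"
  using one_plus_max_ideal[of u] by (cases "x = 0") (auto simp: rv_rel_def val_units_def)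

lemma one_plus_max_ideal_mult:
  assumes "u - 1 \<in> max_ideal" "w - 1 \<in> max_ideal"
  shows "u * w - 1 \<in> (max_ideal :: 'a::acvf set)"
proof -
  have "w \<in> val_ring" using one_plus_max_ideal[OF assms(2)] by (simp add: val_units_def)
  then have "(u - 1) * w + (w - 1) \<in> max_ideal"
    using assms max_ideal_mult max_ideal_add by blast
  then show ?thesis by (simp add: algebra_simps)
qed

lemma one_plus_max_ideal_inverse:
  assumes "u - 1 \<in> max_ideal" shows "inverse u - 1 \<in> (max_ideal :: 'a::acvf set)"
proof -
  have u: "u \<noteq> 0" "inverse u \<in> val_ring"
    using one_plus_max_ideal[OF assms] by (auto simp: val_units_def)
  have "- ((u - 1) * inverse u) \<in> max_ideal"
    using assms u max_ideal_mult max_ideal_uminus by blast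
  then show ?thesis using u by (simp add: algebra_simps)
qed

lemma equivp_rv_rel: "equivp (rv_rel :: 'a::acvf \<Rightarrow> 'a \<Rightarrow> bool)"
proof (rule equivpI)
  show "reflp (rv_rel :: 'a \<Rightarrow> 'a \<Rightarrow> bool)"
    using rv_relI[of 1] by (auto intro!: reflpI simp: max_ideal_zero)
  show "symp (rv_rel :: 'a \<Rightarrow> 'a \<Rightarrow> bool)"
  proof (rule sympI)
    fix x y :: 'a assume "rv_rel x y"
    then obtain u where u: "u - 1 \<in> max_ideal" "u \<in> val_units" "y = x * u"
      by (rule rv_rel_cong)
    then have "x = y * inverse u" by (simp add: val_units_def)
    then show "rv_rel y x" using rv_relI[OF one_plus_max_ideal_inverse[OF u(1)], of y] by simp
  qed
  show "transp (rv_rel :: 'a \<Rightarrow> 'a \<Rightarrow> bool)"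
  proof (rule transpI)
    fix x y z :: 'a assume "rv_rel x y" "rv_rel y z"
    then obtain u w where "u - 1 \<in> max_ideal" "w - 1 \<in> max_ideal" "y = x * u" "z = y * w"
      by (metis rv_rel_cong)
    then show "rv_rel x z"
      using rv_relI[OF one_plus_max_ideal_mult, of u w x] by (simp add: mult.assoc)
  qed
qed

quotient_type (overloaded) 'a RV = "'a::acvf" / rv_rel
  by (rule equivp_rv_rel)

lift_definition rv :: "'a::acvf \<Rightarrow> 'a RV" is "\<lambda>x. x" .

abbreviation rv_inf :: "'a::acvf RV" (\<open>\<infinity>\<^sub>r\<^sub>v\<close>) where
  "\<infinity>\<^sub>r\<^sub>v \<equiv> rv 0"

instantiation RV :: (acvf) comm_monoid_mult
begin

lift_definition one_RV :: "'a RV" is 1 .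

lift_definition times_RV :: "'a RV \<Rightarrow> 'a RV \<Rightarrow> 'a RV" is "(*)"
proof -
  fix x x' y y' :: 'a assume "rv_rel x x'" "rv_rel y y'"
  then obtain u w where "u - 1 \<in> max_ideal" "w - 1 \<in> max_ideal" "x' = x * u" "y' = y * w"
    by (metis rv_rel_cong)
  then show "rv_rel (x * y) (x' * y')"
    using rv_relI[OF one_plus_max_ideal_mult, of u w "x * y"] by (simp add: mult_ac)
qed

instance
  by standard (transfer, simp add: mult_ac equivp_reflp[OF equivp_rv_rel])+

end

text \<open>The multiplicative group of the residue field, as a subgroup of RV.\<close>

definition res_units :: "'a::acvf RV set" where
  "res_units = rv ` val_units"

text \<open>
  Addition of the residue field, whose underlying set is \<open>res_units \<union> {\<infinity>\<^sub>r\<^sub>v}\<close>: the point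
  \<open>\<infinity>\<^sub>r\<^sub>v\<close>, which is outside the group \<open>res_units\<close>, plays the role of the zero of the residue
  field. The operation is made total by the value \<open>\<infinity>\<^sub>r\<^sub>v\<close> outside the residue field.
\<close>

lift_definition res_add :: "'a::acvf RV \<Rightarrow> 'a RV \<Rightarrow> 'a RV" is
  "\<lambda>x y. if x \<in> insert 0 val_units \<and> y \<in> insert 0 val_units \<and> x + y \<in> val_units
         then x + y else 0"
proof -
  fix x x' y y' :: 'a
  assume "rv_rel x x'" "rv_rel y y'"
  then obtain u w where u: "u - 1 \<in> max_ideal" "u \<in> val_units" "x' = x * u"
    and w: "w - 1 \<in> max_ideal" "w \<in> val_units" "y' = y * w"
    by (metis rv_rel_cong)
  have x: "x' \<in> insert 0 val_units \<longleftrightarrow> x \<in> insert 0 val_units"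
    and y: "y' \<in> insert 0 val_units \<longleftrightarrow> y \<in> insert 0 val_units"
    using u w val_units_mult_iff[of u x] val_units_mult_iff[of w y] val_units_nonzero
    by auto
  have refl0: "rv_rel 0 (0 :: 'a)" by (simp add: rv_rel_def)
  show "rv_rel (if x \<in> insert 0 val_units \<and> y \<in> insert 0 val_units \<and> x + y \<in> val_units
                then x + y else 0)
         (if x' \<in> insert 0 val_units \<and> y' \<in> insert 0 val_units \<and> x' + y' \<in> val_units
          then x' + y' else 0)"
  proof (cases "x \<in> insert 0 val_units \<and> y \<in> insert 0 val_units")
    case False
    then show ?thesis using x y refl0 by auto
  next
    case True
    then have O: "x \<in> val_ring" "y \<in> val_ring"
      by (auto simp: val_units_def val_ring_zero)
    define d where "d = x * (u - 1) + y * (w - 1)"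
    have d: "d \<in> max_ideal"
      unfolding d_def using O u w max_ideal_mult max_ideal_add by (metis mult.commute)
    have sum: "x' + y' = (x + y) + d" by (simp add: d_def u w algebra_simps)
    have scale: "rv_rel a (a + e) \<and> a + e \<in> val_units"
      if "a \<in> val_units" "e \<in> max_ideal" for a e :: 'a
    proof -
      have a: "a \<noteq> 0" "inverse a \<in> val_ring" using that by (auto simp: val_units_def)
      have "(1 + e * inverse a) - 1 \<in> max_ideal" using that a max_ideal_mult by simp
      moreover have "a * (1 + e * inverse a) = a + e" using a by (simp add: field_simps)
      ultimately show ?thesis
        using rv_relI[of "1 + e * inverse a" a] one_plus_max_ideal[of "1 + e * inverse a"]
          val_units_mult[OF that(1), of "1 + e * inverse a"] by simp
    qed
    have "x + y \<in> val_units" if "x' + y' \<in> val_units"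
      using scale[OF that max_ideal_uminus[OF d]] sum by simp
    then show ?thesis
      using True x y sum scale[of "x + y" d] d refl0 by auto
  qed
qed

text \<open>The value group together with \<open>vrv \<infinity>\<^sub>r\<^sub>v = {\<infinity>\<^sub>r\<^sub>v}\<close>, as cosets of \<open>res_units\<close> in RV.\<close>

definition vrv :: "'a::acvf RV \<Rightarrow> 'a RV set" where
  "vrv x = {x * u |u. u \<in> res_units}"

definition val_less :: "'a::acvf RV set \<Rightarrow> 'a RV set \<Rightarrow> bool" where
  "val_less \<gamma> \<delta> \<longleftrightarrow>
     (\<exists>a b. a \<noteq> 0 \<and> \<gamma> = vrv (rv a) \<and> \<delta> = vrv (rv b) \<and> b / a \<in> max_ideal)"

text \<open>The value group is written additively: its neutral element is \<open>vrv 1\<close>.\<close>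

definition RV_gt1 :: "'a::acvf RV set" where
  "RV_gt1 = {x. val_less (vrv 1) (vrv x)}"

lemma rv_eq_iff: "rv x = rv y \<longleftrightarrow> rv_rel x y"
  by transfer simp

lemma rv_one: "rv 1 = 1"
  by transfer (simp add: equivp_reflp[OF equivp_rv_rel])

lemma rv_mult: "rv (x * y) = rv x * rv y"
  by transfer (simp add: equivp_reflp[OF equivp_rv_rel])

lemma vrv_rv_eqD:
  assumes "vrv (rv x) = vrv (rv y)"
  obtains u where "u \<in> val_units" "y = x * u"
proof -
  have "rv y \<in> vrv (rv y)"
    unfolding vrv_def res_units_def using val_units_one by (force simp: rv_one)
  then obtain u where u: "u \<in> val_units" "rv y = rv (x * u)"
    using assms unfolding vrv_def res_units_def by (auto simp: rv_mult)
  then obtain w where "w \<in> val_units" "y = x * u * w"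
    by (metis rv_eq_iff rv_rel_cong)
  then show ?thesis
    using that[of "u * w"] val_units_mult[OF u(1), of w] by (simp add: mult.assoc)
qed

lemma rv_mem_RV_gt1:
  fixes x :: "'a::acvf"
  shows "rv x \<in> RV_gt1 \<longleftrightarrow> x \<in> max_ideal"
proof
  assume "rv x \<in> RV_gt1"
  then obtain a b where ab: "a \<noteq> 0" "vrv (rv a) = vrv (rv 1)" "vrv (rv b) = vrv (rv x)"
    "b / a \<in> max_ideal"
    by (auto simp: RV_gt1_def val_less_def rv_one)
  from ab(2) obtain u where u: "u \<in> val_units" "1 = a * u" by (rule vrv_rv_eqD)
  from ab(3) obtain w where w: "w \<in> val_units" "x = b * w" by (rule vrv_rv_eqD)
  have "x = b / a * (w * inverse u)" using u w ab(1) val_units_nonzero[of u]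
    by (auto simp: field_simps)
  moreover have "w * inverse u \<in> val_ring"
    using u w by (auto simp: val_units_def val_ring_mult)
  ultimately show "x \<in> max_ideal" using ab(4) max_ideal_mult by metis
next
  assume "x \<in> max_ideal"
  then have "(1 :: 'a) \<noteq> 0 \<and> vrv 1 = vrv (rv (1 :: 'a)) \<and> vrv (rv x) = vrv (rv x) \<and>
      x / 1 \<in> max_ideal"
    by (simp add: rv_one)
  then show "rv x \<in> RV_gt1"
    unfolding RV_gt1_def val_less_def by blast
qed


section \<open>The two-sorted language and its models\<close>

text \<open>
  Variables of either sort are indexed by natural numbers; \<open>VPar\<close> and \<open>RPar\<close> are names for
  elements (parameters) of the model.
\<close>

datatype (vf_pars_t: 'v) vf_term =
    VVar nat
  | VPar 'v
  | VZero
  | VOne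
  | VAdd "'v vf_term" "'v vf_term"
  | VNeg "'v vf_term"
  | VMul "'v vf_term" "'v vf_term"

datatype (rv_vf_pars_t: 'v, rv_pars_t: 'r) rv_term =
    RVar nat
  | RPar 'r
  | Rv "'v vf_term"
  | RMul "('v, 'r) rv_term" "('v, 'r) rv_term"
  | RAdd "('v, 'r) rv_term" "('v, 'r) rv_term"

datatype (vf_pars: 'v, rv_pars: 'r) form =
    EqVF "'v vf_term" "'v vf_term"
  | EqRV "('v, 'r) rv_term" "('v, 'r) rv_term"
  | InRes "('v, 'r) rv_term"
  | Neg "('v, 'r) form"
  | Conj "('v, 'r) form" "('v, 'r) form"
  | ExVF nat "('v, 'r) form"
  | ExRV nat "('v, 'r) form"

primrec vf_val :: "(nat \<Rightarrow> 'a) \<Rightarrow> 'a vf_term \<Rightarrow> 'a::acvf" where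
  "vf_val e (VVar i) = e i"
| "vf_val e (VPar a) = a"
| "vf_val e VZero = 0"
| "vf_val e VOne = 1"
| "vf_val e (VAdd t t') = vf_val e t + vf_val e t'"
| "vf_val e (VNeg t) = - vf_val e t"
| "vf_val e (VMul t t') = vf_val e t * vf_val e t'"

primrec rv_val :: "(nat \<Rightarrow> 'a) \<Rightarrow> (nat \<Rightarrow> 'a RV) \<Rightarrow> ('a, 'a RV) rv_term \<Rightarrow> 'a::acvf RV" where
  "rv_val e s (RVar i) = s i"
| "rv_val e s (RPar x) = x"
| "rv_val e s (Rv t) = rv (vf_val e t)"
| "rv_val e s (RMul t t') = rv_val e s t * rv_val e s t'"
| "rv_val e s (RAdd t t') = res_add (rv_val e s t) (rv_val e s t')"

primrec sat :: "('a::acvf, 'a RV) form \<Rightarrow> (nat \<Rightarrow> 'a) \<Rightarrow> (nat \<Rightarrow> 'a RV) \<Rightarrow> bool" where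
  "sat (EqVF t t') e s \<longleftrightarrow> vf_val e t = vf_val e t'"
| "sat (EqRV t t') e s \<longleftrightarrow> rv_val e s t = rv_val e s t'"
| "sat (InRes t) e s \<longleftrightarrow> rv_val e s t \<in> res_units"
| "sat (Neg \<phi>) e s \<longleftrightarrow> \<not> sat \<phi> e s"
| "sat (Conj \<phi> \<psi>) e s \<longleftrightarrow> sat \<phi> e s \<and> sat \<psi> e s"
| "sat (ExVF i \<phi>) e s \<longleftrightarrow> (\<exists>a. sat \<phi> (e(i := a)) s)"
| "sat (ExRV i \<phi>) e s \<longleftrightarrow> (\<exists>x. sat \<phi> e (s(i := x)))"

primrec vf_vars_t :: "'v vf_term \<Rightarrow> nat set" where
  "vf_vars_t (VVar i) = {i}"
| "vf_vars_t (VPar a) = {}"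
| "vf_vars_t VZero = {}"
| "vf_vars_t VOne = {}"
| "vf_vars_t (VAdd t t') = vf_vars_t t \<union> vf_vars_t t'"
| "vf_vars_t (VNeg t) = vf_vars_t t"
| "vf_vars_t (VMul t t') = vf_vars_t t \<union> vf_vars_t t'"

primrec rv_vf_vars_t :: "('v, 'r) rv_term \<Rightarrow> nat set" where
  "rv_vf_vars_t (RVar i) = {}"
| "rv_vf_vars_t (RPar x) = {}"
| "rv_vf_vars_t (Rv t) = vf_vars_t t"
| "rv_vf_vars_t (RMul t t') = rv_vf_vars_t t \<union> rv_vf_vars_t t'"
| "rv_vf_vars_t (RAdd t t') = rv_vf_vars_t t \<union> rv_vf_vars_t t'"

primrec rv_vars_t :: "('v, 'r) rv_term \<Rightarrow> nat set" where
  "rv_vars_t (RVar i) = {i}"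
| "rv_vars_t (RPar x) = {}"
| "rv_vars_t (Rv t) = {}"
| "rv_vars_t (RMul t t') = rv_vars_t t \<union> rv_vars_t t'"
| "rv_vars_t (RAdd t t') = rv_vars_t t \<union> rv_vars_t t'"

primrec vf_free :: "('v, 'r) form \<Rightarrow> nat set" where
  "vf_free (EqVF t t') = vf_vars_t t \<union> vf_vars_t t'"
| "vf_free (EqRV t t') = rv_vf_vars_t t \<union> rv_vf_vars_t t'"
| "vf_free (InRes t) = rv_vf_vars_t t"
| "vf_free (Neg \<phi>) = vf_free \<phi>"
| "vf_free (Conj \<phi> \<psi>) = vf_free \<phi> \<union> vf_free \<psi>"
| "vf_free (ExVF i \<phi>) = vf_free \<phi> - {i}"
| "vf_free (ExRV i \<phi>) = vf_free \<phi>"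

primrec rv_free :: "('v, 'r) form \<Rightarrow> nat set" where
  "rv_free (EqVF t t') = {}"
| "rv_free (EqRV t t') = rv_vars_t t \<union> rv_vars_t t'"
| "rv_free (InRes t) = rv_vars_t t"
| "rv_free (Neg \<phi>) = rv_free \<phi>"
| "rv_free (Conj \<phi> \<psi>) = rv_free \<phi> \<union> rv_free \<psi>"
| "rv_free (ExVF i \<phi>) = rv_free \<phi>"
| "rv_free (ExRV i \<phi>) = rv_free \<phi> - {i}"

text \<open>
  Sets of elements of the two sorts are subsets of the disjoint sum of VF (left summand) and RV
  (right summand).
\<close>

definition over :: "('a + 'a RV) set \<Rightarrow> ('a::acvf, 'a RV) form \<Rightarrow> bool" where
  "over A \<phi> \<longleftrightarrow> Inl ` vf_pars \<phi> \<union> Inr ` rv_pars \<phi> \<subseteq> A"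

text \<open>The constants \<open>1\<close> and \<open>\<infinity>\<^sub>r\<^sub>v\<close> of RV belong to \<open>S\<close>, being \<open>rv 1\<close> and \<open>rv 0\<close>.\<close>

definition substructure :: "('a::acvf + 'a RV) set \<Rightarrow> bool" where
  "substructure S \<longleftrightarrow>
     Inl 0 \<in> S \<and> Inl 1 \<in> S \<and>
     (\<forall>a b. Inl a \<in> S \<and> Inl b \<in> S \<longrightarrow> Inl (a + b) \<in> S \<and> Inl (- a) \<in> S \<and> Inl (a * b) \<in> S) \<and>
     (\<forall>a. Inl a \<in> S \<longrightarrow> Inr (rv a) \<in> S) \<and>
     (\<forall>x y. Inr x \<in> S \<and> Inr y \<in> S \<longrightarrow> Inr (x * y) \<in> S \<and> Inr (res_add x y) \<in> S)"

definition nontrivial_value_group :: "('a::acvf + 'a RV) set \<Rightarrow> bool" where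
  "nontrivial_value_group S \<longleftrightarrow> (\<exists>x. Inr x \<in> S \<and> x \<noteq> \<infinity>\<^sub>r\<^sub>v \<and> vrv x \<noteq> vrv 1)"

text \<open>
  \<open>\<kappa>\<close>-saturation of the model (VF, RV) over the field \<open>'a\<close>: every set of formulas in finitely many
  variables, with fewer than \<open>\<kappa>\<close> parameters, is realized if it is finitely satisfiable.
\<close>

definition saturated :: "'a::acvf itself \<Rightarrow> 'c rel \<Rightarrow> bool" where
  "saturated _ \<kappa> \<longleftrightarrow>
     (\<forall>(A :: ('a + 'a RV) set) n \<Phi>.
        |A| <o \<kappa> \<and>
        (\<forall>\<phi>\<in>\<Phi>. over A \<phi> \<and> vf_free \<phi> \<subseteq> {..<n} \<and> rv_free \<phi> \<subseteq> {..<n}) \<and>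
        (\<forall>\<Psi>. finite \<Psi> \<and> \<Psi> \<subseteq> \<Phi> \<longrightarrow> (\<exists>e s. \<forall>\<phi>\<in>\<Psi>. sat \<phi> e s)) \<longrightarrow>
        (\<exists>e s. \<forall>\<phi>\<in>\<Phi>. sat \<phi> e s))"


section \<open>Definable sets in RV and algebraic closure\<close>

text \<open>
  Points of \<open>RV\<^sup>m\<close> are lists of length \<open>m\<close>. The formulas below have no free VF-variables, so the
  assignment \<open>\<lambda>_. 0\<close> of VF-variables is immaterial.
\<close>

definition definable :: "('a + 'a RV) set \<Rightarrow> nat \<Rightarrow> 'a::acvf RV list set \<Rightarrow> bool" where
  "definable S m U \<longleftrightarrow>
     (\<exists>\<phi>. over S \<phi> \<and> vf_free \<phi> = {} \<and> rv_free \<phi> \<subseteq> {..<m} \<and>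
          U = {w. length w = m \<and> sat \<phi> (\<lambda>_. 0) (\<lambda>i. w ! i)})"

text \<open>Only the restriction of \<open>f\<close> to \<open>U\<close> matters; its graph lives in \<open>RV\<^sup>m\<^sup>+\<^sup>n\<close>.\<close>

definition definable_fun ::
    "('a + 'a RV) set \<Rightarrow> nat \<Rightarrow> nat \<Rightarrow> 'a::acvf RV list set \<Rightarrow> ('a RV list \<Rightarrow> 'a RV list) \<Rightarrow> bool" where
  "definable_fun S m n U f \<longleftrightarrow>
     definable S m U \<and> (\<forall>u\<in>U. length (f u) = n) \<and> definable S (m + n) {u @ f u |u. u \<in> U}"

text \<open>
  The RV-part of the algebraic closure of \<open>S \<union> B\<close>: \<open>0\<close> is the only free variable, so that the
  assignment may be constant.
\<close>

definition acl :: "('a + 'a RV) set \<Rightarrow> 'a::acvf RV set \<Rightarrow> 'a RV set" where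
  "acl S B = {x. \<exists>\<phi>. over (S \<union> Inr ` B) \<phi> \<and> vf_free \<phi> = {} \<and> rv_free \<phi> \<subseteq> {0} \<and>
                     finite {y. sat \<phi> (\<lambda>_. 0) (\<lambda>_. y)} \<and> sat \<phi> (\<lambda>_. 0) (\<lambda>_. x)}"


section \<open>The categories \<open>RV[k,\<cdot>]\<close>\<close>

text \<open>
  The pair \<open>(U, f)\<close> with \<open>U \<subseteq> RV\<^sup>m\<close>: here \<open>m = amb X\<close>, \<open>U = pts X\<close>, \<open>f = lab X\<close>.
\<close>

record (overloaded) 'a rv_obj =
  amb :: nat
  pts :: "'a RV list set"
  lab :: "'a RV list \<Rightarrow> 'a RV list"

definition RV_obj :: "('a + 'a RV) set \<Rightarrow> nat \<Rightarrow> 'a::acvf rv_obj set" where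
  "RV_obj S k = {X. definable_fun S (amb X) k (pts X) (lab X)}"

definition rv_iso ::
    "('a + 'a RV) set \<Rightarrow> 'a::acvf rv_obj \<Rightarrow> 'a rv_obj \<Rightarrow> ('a RV list \<Rightarrow> 'a RV list) \<Rightarrow> bool" where
  "rv_iso S X Y F \<longleftrightarrow>
     definable_fun S (amb X) (amb Y) (pts X) F \<and> bij_betw F (pts X) (pts Y) \<and>
     (\<forall>u\<in>pts X.
        length (filter (\<lambda>x. x \<noteq> \<infinity>\<^sub>r\<^sub>v) (lab X u)) = length (filter (\<lambda>x. x \<noteq> \<infinity>\<^sub>r\<^sub>v) (lab Y (F u))) \<and>
        set (lab Y (F u)) \<subseteq> acl S (set (lab X u)) \<and>
        set (lab X u) \<subseteq> acl S (set (lab Y (F u))))"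

definition iso_rel :: "('a + 'a RV) set \<Rightarrow> nat \<Rightarrow> 'a::acvf rv_obj rel" where
  "iso_rel S k = {(X, Y). X \<in> RV_obj S k \<and> Y \<in> RV_obj S k \<and> (\<exists>F. rv_iso S X Y F)}"

text \<open>
  A concrete disjoint union inside \<open>RV\<^sup>1\<^sup>+\<^sup>m\<^sup>+\<^sup>n\<close>: the first coordinate (\<open>1\<close> or \<open>\<infinity>\<^sub>r\<^sub>v\<close>) tells the
  two parts apart and unused coordinates are filled up with \<open>1\<close>.
\<close>

definition disj_union :: "'a::acvf rv_obj \<Rightarrow> 'a rv_obj \<Rightarrow> 'a rv_obj" where
  "disj_union X Y = \<lparr>
     amb = 1 + amb X + amb Y,
     pts = {1 # u @ replicate (amb Y) 1 |u. u \<in> pts X} \<union>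
           {\<infinity>\<^sub>r\<^sub>v # replicate (amb X) 1 @ v |v. v \<in> pts Y},
     lab = (\<lambda>w. if hd w = 1 then lab X (take (amb X) (tl w)) else lab Y (drop (amb X) (tl w))) \<rparr>"

definition obj_prod :: "'a::acvf rv_obj \<Rightarrow> 'a rv_obj \<Rightarrow> 'a rv_obj" where
  "obj_prod X Y = \<lparr>
     amb = amb X + amb Y,
     pts = {u @ v |u v. u \<in> pts X \<and> v \<in> pts Y},
     lab = (\<lambda>w. lab X (take (amb X) w) @ lab Y (drop (amb X) w)) \<rparr>"

definition obj_empty :: "'a::acvf rv_obj" where
  "obj_empty = \<lparr> amb = 0, pts = {}, lab = (\<lambda>_. []) \<rparr>"


section \<open>Blowups\<close>

text \<open>Coordinates of labels are numbered from \<open>0\<close>.\<close>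

definition blowup_coord :: "('a + 'a RV) set \<Rightarrow> nat \<Rightarrow> nat \<Rightarrow> 'a::acvf rv_obj \<Rightarrow> bool" where
  "blowup_coord S k j X \<longleftrightarrow> j < k \<and>
     (\<forall>t\<in>pts X. lab X t ! j \<noteq> \<infinity>\<^sub>r\<^sub>v \<and> lab X t ! j \<in> acl S {lab X t ! i |i. i < k \<and> i \<noteq> j})"

definition elem_blowup :: "nat \<Rightarrow> 'a::acvf rv_obj \<Rightarrow> 'a rv_obj" where
  "elem_blowup j X = \<lparr>
     amb = amb X + 1,
     pts = {t @ [s] |t s. t \<in> pts X \<and> s \<in> RV_gt1},
     lab = (\<lambda>w. let t = take (amb X) w; s = w ! amb X in (lab X t)[j := s * lab X t ! j]) \<rparr>"

definition blowup :: "('a + 'a RV) set \<Rightarrow> nat \<Rightarrow> 'a::acvf rv_obj \<Rightarrow> 'a rv_obj \<Rightarrow> bool" where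
  "blowup S k Y Z \<longleftrightarrow>
     (\<exists>C X j. C \<subseteq> pts Y \<and> definable S (amb Y) C \<and>
        blowup_coord S k j X \<and> (X, Y\<lparr>pts := C\<rparr>) \<in> iso_rel S k \<and>
        Z = disj_union (elem_blowup j X) (Y\<lparr>pts := pts Y - C\<rparr>))"

definition isp_obj :: "('a + 'a RV) set \<Rightarrow> nat \<Rightarrow> 'a::acvf rv_obj rel" where
  "isp_obj S k = {(X, Y). X \<in> RV_obj S k \<and> Y \<in> RV_obj S k \<and>
     (\<exists>X' Y'. (blowup S k)\<^sup>*\<^sup>* X X' \<and> (blowup S k)\<^sup>*\<^sup>* Y Y' \<and> (X', Y') \<in> iso_rel S k)}"


section \<open>Grothendieck semigroups, and congruences\<close>

definition iso_class :: "('a + 'a RV) set \<Rightarrow> nat \<Rightarrow> 'a::acvf rv_obj \<Rightarrow> 'a rv_obj set" where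
  "iso_class S k X = iso_rel S k `` {X}"

definition KRV :: "('a + 'a RV) set \<Rightarrow> nat \<Rightarrow> 'a::acvf rv_obj set set" where
  "KRV S k = RV_obj S k // iso_rel S k"

text \<open>
  Operations on classes, in the style of quotient constructions of \<open>HOL.Equiv_Relations\<close>: all sets
  in these unions are equal when the arguments are isomorphism classes.
\<close>

definition KRV_zero :: "('a + 'a RV) set \<Rightarrow> nat \<Rightarrow> 'a::acvf rv_obj set" where
  "KRV_zero S k = iso_class S k obj_empty"

definition KRV_add ::
    "('a + 'a RV) set \<Rightarrow> nat \<Rightarrow> 'a::acvf rv_obj set \<Rightarrow> 'a rv_obj set \<Rightarrow> 'a rv_obj set" where
  "KRV_add S k a b = (\<Union>X\<in>a. \<Union>Y\<in>b. iso_class S k (disj_union X Y))"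

definition KRV_mult ::
    "('a + 'a RV) set \<Rightarrow> nat \<Rightarrow> nat \<Rightarrow> 'a::acvf rv_obj set \<Rightarrow> 'a rv_obj set \<Rightarrow> 'a rv_obj set" where
  "KRV_mult S i j a b = (\<Union>X\<in>a. \<Union>Y\<in>b. iso_class S (i + j) (obj_prod X Y))"

text \<open>
  The direct sum over all \<open>k\<close>: families of finite support, with the product
  \<open>(a b)\<^sub>k = a\<^sub>0 b\<^sub>k + \<dots> + a\<^sub>k b\<^sub>0\<close>.
\<close>

definition KRVs :: "('a + 'a RV) set \<Rightarrow> (nat \<Rightarrow> 'a::acvf rv_obj set) set" where
  "KRVs S = {a. (\<forall>k. a k \<in> KRV S k) \<and> finite {k. a k \<noteq> KRV_zero S k}}"

definition KRVs_add ::
    "('a + 'a RV) set \<Rightarrow> (nat \<Rightarrow> 'a::acvf rv_obj set) \<Rightarrow> (nat \<Rightarrow> 'a rv_obj set) \<Rightarrow>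
     nat \<Rightarrow> 'a rv_obj set" where
  "KRVs_add S a b = (\<lambda>k. KRV_add S k (a k) (b k))"

definition KRVs_mult ::
    "('a + 'a RV) set \<Rightarrow> (nat \<Rightarrow> 'a::acvf rv_obj set) \<Rightarrow> (nat \<Rightarrow> 'a rv_obj set) \<Rightarrow>
     nat \<Rightarrow> 'a rv_obj set" where
  "KRVs_mult S a b = (\<lambda>k. foldr (KRV_add S k)
     (map (\<lambda>i. KRV_mult S i (k - i) (a i) (b (k - i))) [0..<Suc k]) (KRV_zero S k))"

definition Isp :: "('a + 'a RV) set \<Rightarrow> nat \<Rightarrow> 'a::acvf rv_obj set rel" where
  "Isp S k = {(iso_class S k X, iso_class S k Y) |X Y. (X, Y) \<in> isp_obj S k}"

definition Isps :: "('a + 'a RV) set \<Rightarrow> (nat \<Rightarrow> 'a::acvf rv_obj set) rel" where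
  "Isps S = {(a, b). a \<in> KRVs S \<and> b \<in> KRVs S \<and> (\<forall>k. (a k, b k) \<in> Isp S k)}"

definition semigroup_congruence :: "'c set \<Rightarrow> ('c \<Rightarrow> 'c \<Rightarrow> 'c) \<Rightarrow> 'c rel \<Rightarrow> bool" where
  "semigroup_congruence A pls R \<longleftrightarrow> equiv A R \<and>
     (\<forall>a a' b b'. (a, a') \<in> R \<and> (b, b') \<in> R \<longrightarrow> (pls a b, pls a' b') \<in> R)"

definition semiring_congruence ::
    "'c set \<Rightarrow> ('c \<Rightarrow> 'c \<Rightarrow> 'c) \<Rightarrow> ('c \<Rightarrow> 'c \<Rightarrow> 'c) \<Rightarrow> 'c rel \<Rightarrow> bool" where
  "semiring_congruence A pls tms R \<longleftrightarrow>
     semigroup_congruence A pls R \<and> semigroup_congruence A tms R"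

end

theory Submission
  imports Defs
begin

text \<open>
  The only difficult point is that \<^const>\<open>Isp\<close> is transitive: two iterated blowups of the same
  object must have isomorphic iterated blowups. This is confluence of the blowup relation on
  isomorphism classes, and it follows from three facts.

  \<^item> The elementary blowup of an object depends only on its isomorphism class, not on the chosen
  coordinate (\<open>iso_rel_elem_blowup\<close>). A label of the blowup at \<open>(t, s)\<close> is interalgebraic with \<open>s\<close>
  together with the label at \<open>t\<close>, since the scaled coordinate was algebraic over the others and is
  not \<open>\<infinity>\<^sub>r\<^sub>v\<close> (\<open>acl_scaled\<close>). For this, algebraic closure has to be idempotent (\<open>acl_trans\<close>).

  \<^item> The elementary blowup of a disjoint union is the disjoint union of the elementary blowups
  (\<open>eb_class_add\<close>).

  \<^item> Isomorphism classes form a commutative semigroup with the refinement property: two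
  decompositions of an object into definable pieces have a common refinement (\<open>KRV_refinement\<close>).

  A blowup writes a class as \<open>c + d\<close> and replaces \<open>c\<close> by its elementary blowup. Given two
  such decompositions, one blowup can be followed by the blowup of the part that only the other one
  has treated, and both orders give the same class. So the relation has the diamond property
  (\<open>step_diamond\<close>), hence is confluent, and being joinable by iterated blowups is an equivalence
  relation. It is compatible with sums, because a blowup of a summand is a blowup of the sum, and
  with products, because products distribute over disjoint unions and commute with elementary
  blowups (\<open>eb_class_mult\<close>). The graded statement follows componentwise.

  The remaining work is to show that the sets and maps that occur are definable. This is reduced to
  closure properties of definable conditions, which in turn rest on capture-avoiding substitution.
\<close>

section \<open>Confluence in commutative semigroups with refinement\<close>

text \<open>
  This is what the diamond property of blowups uses about isomorphism classes.
  In \<open>eb a e\<close>, the element \<open>e\<close> is the elementary blowup of \<open>a\<close>. Not every element need have one,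
  but every summand of an element that has one does.
\<close>
locale blowup_monoid =
  fixes M :: "'b set" and add :: "'b \<Rightarrow> 'b \<Rightarrow> 'b" (infixl \<open>\<oplus>\<close> 65) and eb :: "'b \<Rightarrow> 'b \<Rightarrow> bool"
  assumes add_closed: "a \<in> M \<Longrightarrow> b \<in> M \<Longrightarrow> a \<oplus> b \<in> M"
    and add_assoc: "a \<in> M \<Longrightarrow> b \<in> M \<Longrightarrow> c \<in> M \<Longrightarrow> (a \<oplus> b) \<oplus> c = a \<oplus> (b \<oplus> c)"
    and add_commute: "a \<in> M \<Longrightarrow> b \<in> M \<Longrightarrow> a \<oplus> b = b \<oplus> a"
    and refinement: "a \<in> M \<Longrightarrow> b \<in> M \<Longrightarrow> c \<in> M \<Longrightarrow> d \<in> M \<Longrightarrow> a \<oplus> b = c \<oplus> d \<Longrightarrow>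
      \<exists>p\<in>M. \<exists>q\<in>M. \<exists>r\<in>M. \<exists>t\<in>M. a = p \<oplus> q \<and> b = r \<oplus> t \<and> c = p \<oplus> r \<and> d = q \<oplus> t"
    and eb_closed: "eb a e \<Longrightarrow> a \<in> M \<and> e \<in> M"
    and eb_unique: "eb a e \<Longrightarrow> eb a e' \<Longrightarrow> e = e'"
    and eb_add: "a \<in> M \<Longrightarrow> b \<in> M \<Longrightarrow> eb (a \<oplus> b) e \<Longrightarrow> \<exists>a' b'. eb a a' \<and> eb b b' \<and> e = a' \<oplus> b'"
begin

lemma add_left_commute: "a \<in> M \<Longrightarrow> b \<in> M \<Longrightarrow> c \<in> M \<Longrightarrow> a \<oplus> (b \<oplus> c) = b \<oplus> (a \<oplus> c)"
  by (simp add: add_commute[of a b] flip: add_assoc)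

lemmas add_ac = add_closed add_assoc add_commute add_left_commute

definition step :: "'b \<Rightarrow> 'b \<Rightarrow> bool" where
  "step y z \<longleftrightarrow> (\<exists>c d e. d \<in> M \<and> eb c e \<and> y = c \<oplus> d \<and> z = e \<oplus> d)"

text \<open>
  Two blowups of the same element come from decompositions \<open>c \<oplus> d = c' \<oplus> d'\<close>. In a common
  refinement with parts \<open>p, q, r, t\<close> the first blows up \<open>p\<close> and \<open>q\<close>, the second \<open>p\<close> and \<open>r\<close>.
  Blowing up \<open>r\<close>, respectively \<open>q\<close>, afterwards leads to the same result, because the blowup of a
  sum is the sum of the blowups and the blowup of \<open>p\<close> is unique.
\<close>
lemma step_diamond:
  assumes "step y z" "step y z'" shows "\<exists>w. step z w \<and> step z' w"
proof -
  from assms obtain c d e c' d' e' where 1: "d \<in> M" "eb c e" "y = c \<oplus> d" "z = e \<oplus> d"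
    and 2: "d' \<in> M" "eb c' e'" "y = c' \<oplus> d'" "z' = e' \<oplus> d'"
    unfolding step_def by blast
  have M: "c \<in> M" "c' \<in> M" using 1 2 eb_closed by auto
  obtain p q r t where pqrt: "p \<in> M" "q \<in> M" "r \<in> M" "t \<in> M"
    "c = p \<oplus> q" "d = r \<oplus> t" "c' = p \<oplus> r" "d' = q \<oplus> t"
    using refinement[OF M(1) 1(1) M(2) 2(1)] 1(3) 2(3) by metis
  obtain p' q' where e: "eb p p'" "eb q q'" "e = p' \<oplus> q'"
    using eb_add 1(2) pqrt by metis
  obtain r' where r: "eb r r'" "e' = p' \<oplus> r'"
    using eb_add[of p r e'] 2(2) pqrt eb_unique[OF e(1)] by metis
  have N: "p' \<in> M" "q' \<in> M" "r' \<in> M" using e r eb_closed by auto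
  have "step z (r' \<oplus> (p' \<oplus> q' \<oplus> t))"
    unfolding step_def using pqrt N e r 1(4)
    by (intro exI[of _ r] exI[of _ "p' \<oplus> q' \<oplus> t"] exI[of _ r']) (simp add: add_ac)
  moreover have "step z' (r' \<oplus> (p' \<oplus> q' \<oplus> t))"
    unfolding step_def using pqrt N e r 2(4)
    by (intro exI[of _ q] exI[of _ "p' \<oplus> r' \<oplus> t"] exI[of _ q']) (simp add: add_ac)
  ultimately show ?thesis by blast
qed

lemma step_strip: "step\<^sup>*\<^sup>* y v \<Longrightarrow> step y u \<Longrightarrow> \<exists>w. step\<^sup>*\<^sup>* u w \<and> step v w"
proof (induction rule: rtranclp_induct)
  case (step v v')
  then obtain w where w: "step\<^sup>*\<^sup>* u w" "step v w" by blast
  from step_diamond[OF \<open>step v v'\<close> w(2)] obtain w' where "step v' w'" "step w w'" by blast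
  then show ?case using w(1) by (meson rtranclp.rtrancl_into_rtrancl)
qed auto

lemma steps_confluent:
  assumes "step\<^sup>*\<^sup>* y z" "step\<^sup>*\<^sup>* y z'" shows "\<exists>w. step\<^sup>*\<^sup>* z w \<and> step\<^sup>*\<^sup>* z' w"
proof -
  show ?thesis
    using assms(2)
  proof (induction rule: rtranclp_induct)
    case base
    then show ?case using assms(1) by blast
  next
    case (step v v')
    then obtain w where w: "step\<^sup>*\<^sup>* z w" "step\<^sup>*\<^sup>* v w" by blast
    from step_strip[OF w(2) \<open>step v v'\<close>] obtain w' where "step\<^sup>*\<^sup>* v' w'" "step w w'" by blast
    then show ?case using w(1) by (meson rtranclp.rtrancl_into_rtrancl)
  qed
qed

lemma step_add: "step y z \<Longrightarrow> w \<in> M \<Longrightarrow> step (y \<oplus> w) (z \<oplus> w)"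
proof -
  assume w: "w \<in> M" and "step y z"
  then obtain c d e where "d \<in> M" "eb c e" "y = c \<oplus> d" "z = e \<oplus> d" unfolding step_def by blast
  then show ?thesis
    unfolding step_def using w eb_closed[of c e]
    by (intro exI[of _ c] exI[of _ "d \<oplus> w"] exI[of _ e]) (simp add: add_ac)
qed

lemma steps_add: "step\<^sup>*\<^sup>* y z \<Longrightarrow> w \<in> M \<Longrightarrow> step\<^sup>*\<^sup>* (y \<oplus> w) (z \<oplus> w)"
  by (induction rule: rtranclp_induct) (auto dest: step_add intro: rtranclp.rtrancl_into_rtrancl)

definition joinable :: "'b rel" where
  "joinable = {(a, b). a \<in> M \<and> b \<in> M \<and> (\<exists>w. step\<^sup>*\<^sup>* a w \<and> step\<^sup>*\<^sup>* b w)}"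

lemma joinableI: "a \<in> M \<Longrightarrow> b \<in> M \<Longrightarrow> step\<^sup>*\<^sup>* a w \<Longrightarrow> step\<^sup>*\<^sup>* b w \<Longrightarrow> (a, b) \<in> joinable"
  by (auto simp: joinable_def)

lemma joinable_sym: "(a, b) \<in> joinable \<Longrightarrow> (b, a) \<in> joinable"
  by (auto simp: joinable_def)

lemma joinable_trans:
  assumes "(a, b) \<in> joinable" "(b, c) \<in> joinable" shows "(a, c) \<in> joinable"
proof -
  from assms obtain u v where M: "a \<in> M" "c \<in> M"
    and u: "step\<^sup>*\<^sup>* a u" "step\<^sup>*\<^sup>* b u" and v: "step\<^sup>*\<^sup>* b v" "step\<^sup>*\<^sup>* c v"
    by (auto simp: joinable_def)
  obtain w where w: "step\<^sup>*\<^sup>* u w" "step\<^sup>*\<^sup>* v w" using steps_confluent u(2) v(1) by blast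
  show ?thesis by (rule joinableI[OF M rtranclp_trans[OF u(1) w(1)] rtranclp_trans[OF v(2) w(2)]])
qed

lemma equiv_joinable: "equiv M joinable"
proof (rule equivI)
  show "refl_on M joinable" by (auto simp: refl_on_def intro: joinableI)
  show "joinable \<subseteq> M \<times> M" by (auto simp: joinable_def)
  show "sym joinable" by (auto intro: symI joinable_sym)
  show "trans joinable" by (auto intro: transI joinable_trans)
qed

lemma joinable_add_right:
  assumes "(a, a') \<in> joinable" "b \<in> M" shows "(a \<oplus> b, a' \<oplus> b) \<in> joinable"
proof -
  from assms(1) obtain w where "a \<in> M" "a' \<in> M" "step\<^sup>*\<^sup>* a w" "step\<^sup>*\<^sup>* a' w" by (auto simp: joinable_def)
  then show ?thesis using assms(2) by (intro joinableI[of _ _ "w \<oplus> b"] add_closed steps_add)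
qed

lemma joinable_add:
  assumes "(a, a') \<in> joinable" "(b, b') \<in> joinable" shows "(a \<oplus> b, a' \<oplus> b') \<in> joinable"
proof -
  have M: "a \<in> M" "a' \<in> M" "b \<in> M" "b' \<in> M" using assms by (auto simp: joinable_def)
  have "(a \<oplus> b, a' \<oplus> b) \<in> joinable" using assms(1) M(3) by (rule joinable_add_right)
  moreover have "(a' \<oplus> b, a' \<oplus> b') \<in> joinable"
    using joinable_add_right[OF assms(2) M(2)] M by (simp add: add_commute)
  ultimately show ?thesis by (rule joinable_trans)
qed

lemma semigroup_congruence_joinable: "semigroup_congruence M (\<oplus>) joinable"
  using equiv_joinable joinable_add by (auto simp: semigroup_congruence_def)

end

section \<open>Substitution into formulas\<close>

lemma vf_val_cong: "(\<And>i. i \<in> vf_vars_t t \<Longrightarrow> e i = e' i) \<Longrightarrow> vf_val e t = vf_val e' t"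
  by (induction t) auto

lemma rv_val_cong:
  "(\<And>i. i \<in> rv_vf_vars_t t \<Longrightarrow> e i = e' i) \<Longrightarrow> (\<And>i. i \<in> rv_vars_t t \<Longrightarrow> s i = s' i) \<Longrightarrow>
   rv_val e s t = rv_val e' s' t"
proof (induction t)
  case (Rv t)
  then show ?case using vf_val_cong[of t e e'] by simp
qed auto

lemma sat_cong:
  "(\<And>i. i \<in> vf_free \<phi> \<Longrightarrow> e i = e' i) \<Longrightarrow> (\<And>i. i \<in> rv_free \<phi> \<Longrightarrow> s i = s' i) \<Longrightarrow>
   sat \<phi> e s = sat \<phi> e' s'"
proof (induction \<phi> arbitrary: e e' s s')
  case (EqVF t t')
  then show ?case using vf_val_cong[of t e e'] vf_val_cong[of t' e e'] by simp
next
  case (EqRV t t')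
  then show ?case using rv_val_cong[of t e e' s s'] rv_val_cong[of t' e e' s s'] by simp
next
  case (InRes t)
  then show ?case using rv_val_cong[of t e e' s s'] by simp
next
  case (Neg \<phi>)
  from Neg.IH[of e e' s s'] Neg.prems show ?case by simp
next
  case (Conj \<phi> \<psi>)
  from Conj.IH(1)[of e e' s s'] Conj.IH(2)[of e e' s s'] Conj.prems show ?case by simp
next
  case (ExVF i \<phi>)
  have "sat \<phi> (e(i := a)) s = sat \<phi> (e'(i := a)) s'" for a
    using ExVF.prems by (intro ExVF.IH) auto
  then show ?case by simp
next
  case (ExRV i \<phi>)
  have "sat \<phi> e (s(i := a)) = sat \<phi> e' (s'(i := a))" for a
    using ExRV.prems by (intro ExRV.IH) auto
  then show ?case by simp
qed

lemma finite_rv_vars_t: "finite (rv_vars_t t)"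
  by (induction t) auto

lemma finite_rv_free: "finite (rv_free \<phi>)"
  by (induction \<phi>) (auto simp: finite_rv_vars_t)

lemma finite_rv_pars_t: "finite (rv_pars_t t)"
  by (induction t) auto

lemma finite_rv_pars: "finite (rv_pars \<phi>)"
  by (induction \<phi>) (auto simp: finite_rv_pars_t)

definition fresh :: "nat set \<Rightarrow> nat" where
  "fresh A = (SOME n. n \<notin> A)"

lemma fresh: "finite A \<Longrightarrow> fresh A \<notin> A"
  unfolding fresh_def by (rule someI_ex) (rule ex_new_if_finite[OF infinite_UNIV_nat])

primrec term_subst ::
    "(nat \<Rightarrow> ('v, 'r) rv_term) \<Rightarrow> ('r \<Rightarrow> ('v, 'r) rv_term) \<Rightarrow> ('v, 'r) rv_term \<Rightarrow> ('v, 'r) rv_term" where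
  "term_subst \<sigma> \<pi> (RVar i) = \<sigma> i"
| "term_subst \<sigma> \<pi> (RPar x) = \<pi> x"
| "term_subst \<sigma> \<pi> (Rv t) = Rv t"
| "term_subst \<sigma> \<pi> (RMul t t') = RMul (term_subst \<sigma> \<pi> t) (term_subst \<sigma> \<pi> t')"
| "term_subst \<sigma> \<pi> (RAdd t t') = RAdd (term_subst \<sigma> \<pi> t) (term_subst \<sigma> \<pi> t')"

text \<open>
  Simultaneous substitution of terms for RV-variables (\<open>\<sigma>\<close>) and for RV-parameters (\<open>\<pi>\<close>).
  Bound variables are renamed to avoid capture. Replacing parameters is what allows a parameter
  to be turned into a variable.
\<close>
primrec form_subst ::
    "('r \<Rightarrow> ('v, 'r) rv_term) \<Rightarrow> ('v, 'r) form \<Rightarrow> (nat \<Rightarrow> ('v, 'r) rv_term) \<Rightarrow> ('v, 'r) form" where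
  "form_subst \<pi> (EqVF t t') \<sigma> = EqVF t t'"
| "form_subst \<pi> (EqRV t t') \<sigma> = EqRV (term_subst \<sigma> \<pi> t) (term_subst \<sigma> \<pi> t')"
| "form_subst \<pi> (InRes t) \<sigma> = InRes (term_subst \<sigma> \<pi> t)"
| "form_subst \<pi> (Neg \<phi>) \<sigma> = Neg (form_subst \<pi> \<phi> \<sigma>)"
| "form_subst \<pi> (Conj \<phi> \<psi>) \<sigma> = Conj (form_subst \<pi> \<phi> \<sigma>) (form_subst \<pi> \<psi> \<sigma>)"
| "form_subst \<pi> (ExVF i \<phi>) \<sigma> = ExVF i (form_subst \<pi> \<phi> \<sigma>)"
| "form_subst \<pi> (ExRV i \<phi>) \<sigma> =
     (let n = fresh ((\<Union>j\<in>rv_free \<phi>. rv_vars_t (\<sigma> j)) \<union> (\<Union>x\<in>rv_pars \<phi>. rv_vars_t (\<pi> x)))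
      in ExRV n (form_subst \<pi> \<phi> (\<sigma>(i := RVar n))))"

lemma rv_val_subst:
  "(\<And>x. x \<in> rv_pars_t t \<Longrightarrow> rv_val e s (\<pi> x) = x) \<Longrightarrow>
   rv_val e s (term_subst \<sigma> \<pi> t) = rv_val e (\<lambda>i. rv_val e s (\<sigma> i)) t"
  by (induction t) auto

text \<open>
  A parameter may be replaced by any term that currently has the value of this parameter, in
  particular by a variable; the conclusion is then restricted to assignments that give the
  variable this value.
\<close>
lemma sat_subst:
  assumes "\<And>x. rv_vf_vars_t (\<pi> x) = {}"
  shows "(\<And>i. rv_vf_vars_t (\<sigma> i) = {}) \<Longrightarrow> (\<And>x. x \<in> rv_pars \<phi> \<Longrightarrow> rv_val e s (\<pi> x) = x) \<Longrightarrow>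
    sat (form_subst \<pi> \<phi> \<sigma>) e s = sat \<phi> e (\<lambda>i. rv_val e s (\<sigma> i))"
proof (induction \<phi> arbitrary: e s \<sigma>)
  case (EqVF t t')
  then show ?case by simp
next
  case (EqRV t t')
  then show ?case by (simp add: rv_val_subst)
next
  case (InRes t)
  then show ?case by (simp add: rv_val_subst)
next
  case (Neg \<phi>)
  from Neg.IH[of \<sigma> e s] Neg.prems show ?case by simp
next
  case (Conj \<phi> \<psi>)
  from Conj.IH(1)[of \<sigma> e s] Conj.IH(2)[of \<sigma> e s] Conj.prems show ?case by simp
next
  case (ExVF i \<phi>)
  have eq: "rv_val (e(i := a)) s (\<pi> x) = rv_val e s (\<pi> x)" for a x
    using assms by (intro rv_val_cong) auto
  have eq': "rv_val (e(i := a)) s (\<sigma> x) = rv_val e s (\<sigma> x)" for a x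
    using ExVF.prems(1) by (intro rv_val_cong) auto
  have "sat (form_subst \<pi> \<phi> \<sigma>) (e(i := a)) s = sat \<phi> (e(i := a)) (\<lambda>i. rv_val e s (\<sigma> i))" for a
  proof -
    have "sat (form_subst \<pi> \<phi> \<sigma>) (e(i := a)) s =
        sat \<phi> (e(i := a)) (\<lambda>j. rv_val (e(i := a)) s (\<sigma> j))"
    proof (rule ExVF.IH)
      show "rv_val (e(i := a)) s (\<pi> x) = x" if "x \<in> rv_pars \<phi>" for x
        unfolding eq using ExVF.prems(2) that by simp
    qed (rule ExVF.prems(1))
    then show ?thesis by (simp only: eq')
  qed
  then show ?case by simp
next
  case (ExRV i \<phi>)
  define V where "V = (\<Union>j\<in>rv_free \<phi>. rv_vars_t (\<sigma> j)) \<union> (\<Union>x\<in>rv_pars \<phi>. rv_vars_t (\<pi> x))"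
  have "finite V"
    unfolding V_def using finite_rv_free finite_rv_pars finite_rv_vars_t by (intro finite_UnI finite_UN_I) auto
  then have n: "fresh V \<notin> V" by (rule fresh)
  have eq: "rv_val e (s(fresh V := a)) (\<pi> x) = rv_val e s (\<pi> x)" if "x \<in> rv_pars \<phi>" for a x
    using n that by (intro rv_val_cong) (auto simp: V_def)
  have eq': "rv_val e (s(fresh V := a)) (\<sigma> j) = rv_val e s (\<sigma> j)" if "j \<in> rv_free \<phi>" for a j
    using n that by (intro rv_val_cong) (auto simp: V_def)
  have "sat (form_subst \<pi> \<phi> (\<sigma>(i := RVar (fresh V)))) e (s(fresh V := a)) =
        sat \<phi> e ((\<lambda>i. rv_val e s (\<sigma> i))(i := a))" for a
  proof -
    have "sat (form_subst \<pi> \<phi> (\<sigma>(i := RVar (fresh V)))) e (s(fresh V := a)) =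
       sat \<phi> e (\<lambda>j. rv_val e (s(fresh V := a)) ((\<sigma>(i := RVar (fresh V))) j))"
    proof (rule ExRV.IH)
      show "rv_val e (s(fresh V := a)) (\<pi> x) = x" if "x \<in> rv_pars \<phi>" for x
        using eq[OF that, of a] ExRV.prems(2)[of x] that by simp
      show "rv_vf_vars_t ((\<sigma>(i := RVar (fresh V))) j) = {}" for j
        using ExRV.prems(1) by simp
    qed
    also have "\<dots> = sat \<phi> e ((\<lambda>i. rv_val e s (\<sigma> i))(i := a))"
      using eq' by (intro sat_cong) auto
    finally show ?thesis .
  qed
  then show ?case by (simp add: Let_def flip: V_def)
qed

definition term_over :: "('a + 'a RV) set \<Rightarrow> ('a::acvf, 'a RV) rv_term \<Rightarrow> bool" where
  "term_over A t \<longleftrightarrow> Inl ` rv_vf_pars_t t \<union> Inr ` rv_pars_t t \<subseteq> A"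

lemma pars_term_subst:
  "(\<And>i. term_over A (\<sigma> i)) \<Longrightarrow> (\<And>x. x \<in> rv_pars_t t \<Longrightarrow> term_over A (\<pi> x)) \<Longrightarrow>
   Inl ` rv_vf_pars_t t \<subseteq> A \<Longrightarrow> term_over A (term_subst \<sigma> \<pi> t)"
  by (induction t) (auto simp: term_over_def image_Un)

lemma over_subst:
  "(\<And>i. term_over A (\<sigma> i)) \<Longrightarrow> (\<And>x. x \<in> rv_pars \<phi> \<Longrightarrow> term_over A (\<pi> x)) \<Longrightarrow>
   Inl ` vf_pars \<phi> \<subseteq> A \<Longrightarrow> over A (form_subst \<pi> \<phi> \<sigma>)"
proof (induction \<phi> arbitrary: \<sigma>)
  case (EqRV t t')
  then have "term_over A (term_subst \<sigma> \<pi> t)" "term_over A (term_subst \<sigma> \<pi> t')"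
    by (auto intro!: pars_term_subst)
  then show ?case by (auto simp: over_def term_over_def)
next
  case (InRes t)
  then have "term_over A (term_subst \<sigma> \<pi> t)"
    by (auto intro!: pars_term_subst)
  then show ?case by (auto simp: over_def term_over_def)
next
  case (ExRV i \<phi>)
  have "over A (form_subst \<pi> \<phi> (\<sigma>(i := RVar n)))" for n
    using ExRV.prems by (intro ExRV.IH) (auto simp: term_over_def)
  then show ?case by (auto simp: over_def Let_def)
next
  case (Conj \<phi> \<psi>)
  from Conj.IH[of \<sigma>] Conj.prems show ?case by (auto simp: over_def image_Un)
qed (auto simp: over_def)

lemma term_subst_vf_vars:
  "(\<And>x. rv_vf_vars_t (\<pi> x) = {}) \<Longrightarrow> (\<And>i. rv_vf_vars_t (\<sigma> i) = {}) \<Longrightarrow>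
   rv_vf_vars_t (term_subst \<sigma> \<pi> t) = rv_vf_vars_t t"
  by (induction t) auto

lemma vf_free_subst:
  assumes "\<And>x. rv_vf_vars_t (\<pi> x) = {}"
  shows "(\<And>i. rv_vf_vars_t (\<sigma> i) = {}) \<Longrightarrow> vf_free (form_subst \<pi> \<phi> \<sigma>) = vf_free \<phi>"
proof (induction \<phi> arbitrary: \<sigma>)
  case (ExRV i \<phi>)
  have "vf_free (form_subst \<pi> \<phi> (\<sigma>(i := RVar n))) = vf_free \<phi>" for n
    using ExRV.prems by (intro ExRV.IH) auto
  then show ?case by (simp add: Let_def)
qed (auto simp: term_subst_vf_vars assms)

section \<open>Definable conditions\<close>

text \<open>
  Definability is handled semantically: a condition on an assignment of the RV-variables is
  definable if some formula expresses it. A bound variable is treated in de Bruijn style: in the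
  rules for quantifiers below, the quantified value is variable \<open>0\<close> and the other variables
  are shifted. In this way closure under all constructions of the logic becomes a set of
  introduction rules that follow the shape of the condition.
\<close>
definition defpred :: "('a + 'a RV) set \<Rightarrow> ((nat \<Rightarrow> 'a::acvf RV) \<Rightarrow> bool) \<Rightarrow> bool" where
  "defpred S P \<longleftrightarrow> (\<exists>\<phi>. over S \<phi> \<and> vf_free \<phi> = {} \<and> (\<forall>e s. sat \<phi> e s \<longleftrightarrow> P s))"

definition defterm :: "('a + 'a RV) set \<Rightarrow> ((nat \<Rightarrow> 'a::acvf RV) \<Rightarrow> 'a RV) \<Rightarrow> bool" where
  "defterm S f \<longleftrightarrow> (\<exists>t. term_over S t \<and> rv_vf_vars_t t = {} \<and> (\<forall>e s. rv_val e s t = f s))"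

definition deflist :: "('a + 'a RV) set \<Rightarrow> ((nat \<Rightarrow> 'a::acvf RV) \<Rightarrow> 'a RV list) \<Rightarrow> bool" where
  "deflist S l \<longleftrightarrow> (\<exists>ts. (\<forall>t\<in>set ts. defterm S t) \<and> (\<forall>s. l s = map (\<lambda>t. t s) ts))"

lemma defterm_var: "defterm S (\<lambda>s. s i)"
  unfolding defterm_def by (rule exI[of _ "RVar i"]) (simp add: term_over_def)

lemma defterm_par: "Inr x \<in> S \<Longrightarrow> defterm S (\<lambda>s. x)"
  unfolding defterm_def by (rule exI[of _ "RPar x"]) (simp add: term_over_def)

lemma defterm_one: "defterm S (\<lambda>s. 1)"
  unfolding defterm_def by (rule exI[of _ "Rv VOne"]) (simp add: term_over_def rv_one)

lemma defterm_inf: "defterm S (\<lambda>s. \<infinity>\<^sub>r\<^sub>v)"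
  unfolding defterm_def by (rule exI[of _ "Rv VZero"]) (simp add: term_over_def)

lemma defterm_mult:
  assumes "defterm S f" "defterm S g" shows "defterm S (\<lambda>s. f s * g s)"
proof -
  from assms obtain t t' where "term_over S t \<and> rv_vf_vars_t t = {} \<and> (\<forall>e s. rv_val e s t = f s)"
    "term_over S t' \<and> rv_vf_vars_t t' = {} \<and> (\<forall>e s. rv_val e s t' = g s)"
    unfolding defterm_def by blast
  then show ?thesis
    unfolding defterm_def by (intro exI[of _ "RMul t t'"]) (auto simp: term_over_def)
qed

lemma defpred_eq:
  assumes "defterm S f" "defterm S g" shows "defpred S (\<lambda>s. f s = g s)"
proof -
  from assms obtain t t' where "term_over S t \<and> rv_vf_vars_t t = {} \<and> (\<forall>e s. rv_val e s t = f s)"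
    "term_over S t' \<and> rv_vf_vars_t t' = {} \<and> (\<forall>e s. rv_val e s t' = g s)"
    unfolding defterm_def by blast
  then show ?thesis
    unfolding defpred_def by (intro exI[of _ "EqRV t t'"]) (auto simp: term_over_def over_def)
qed

lemma defpred_not: "defpred S P \<Longrightarrow> defpred S (\<lambda>s. \<not> P s)"
proof -
  assume "defpred S P"
  then obtain \<phi> where "over S \<phi>" "vf_free \<phi> = {}" "\<forall>e s. sat \<phi> e s \<longleftrightarrow> P s"
    unfolding defpred_def by blast
  then show ?thesis
    unfolding defpred_def by (intro exI[of _ "Neg \<phi>"]) (auto simp: over_def)
qed

lemma defpred_conj:
  assumes "defpred S P" "defpred S Q" shows "defpred S (\<lambda>s. P s \<and> Q s)"
proof -
  from assms obtain \<phi> \<psi> where "over S \<phi>" "vf_free \<phi> = {}" "\<forall>e s. sat \<phi> e s \<longleftrightarrow> P s"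
    "over S \<psi>" "vf_free \<psi> = {}" "\<forall>e s. sat \<psi> e s \<longleftrightarrow> Q s"
    unfolding defpred_def by blast
  then show ?thesis
    unfolding defpred_def by (intro exI[of _ "Conj \<phi> \<psi>"]) (auto simp: over_def)
qed

lemma disj_conv_not_conj: "P \<or> Q \<longleftrightarrow> \<not> (\<not> P \<and> \<not> Q)"
  by blast

lemma defpred_disj: "defpred S P \<Longrightarrow> defpred S Q \<Longrightarrow> defpred S (\<lambda>s. P s \<or> Q s)"
  unfolding disj_conv_not_conj by (intro defpred_not defpred_conj)

lemma defpred_imp: "defpred S P \<Longrightarrow> defpred S Q \<Longrightarrow> defpred S (\<lambda>s. P s \<longrightarrow> Q s)"
  unfolding imp_conv_disj by (intro defpred_disj defpred_not)

lemma defpred_const: "defpred S (\<lambda>s. b)"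
proof -
  have "defpred S (\<lambda>s. s 0 = s 0)" by (intro defpred_eq defterm_var)
  then have t: "defpred S (\<lambda>s. True)" by simp
  then show ?thesis using defpred_not[OF t] by (cases b) auto
qed

lemma defpred_subst:
  assumes "defpred S P" "\<And>i. defterm S (t i)"
  shows "defpred S (\<lambda>s. P (\<lambda>i. t i s))"
proof -
  from assms(1) obtain \<phi> where \<phi>: "over S \<phi>" "vf_free \<phi> = {}" "\<And>e s. sat \<phi> e s \<longleftrightarrow> P s"
    unfolding defpred_def by blast
  from assms(2) obtain \<sigma> where \<sigma>: "\<And>i. term_over S (\<sigma> i)" "\<And>i. rv_vf_vars_t (\<sigma> i) = {}"
    "\<And>i e s. rv_val e s (\<sigma> i) = t i s"
    unfolding defterm_def by metis
  have "over S (form_subst RPar \<phi> \<sigma>)"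
    using \<phi>(1) \<sigma>(1) by (intro over_subst) (auto simp: over_def term_over_def)
  moreover have "vf_free (form_subst RPar \<phi> \<sigma>) = {}"
    using \<phi>(2) \<sigma>(2) by (simp add: vf_free_subst)
  moreover have "sat (form_subst RPar \<phi> \<sigma>) e s \<longleftrightarrow> P (\<lambda>i. t i s)" for e s
    using \<sigma>(2) by (simp add: sat_subst \<phi>(3) \<sigma>(3))
  ultimately show ?thesis unfolding defpred_def by blast
qed

lemma defpred_ex:
  assumes "defpred S (\<lambda>s. P (s 0) (\<lambda>i. s (Suc i)))"
  shows "defpred S (\<lambda>s. \<exists>x. P x s)"
proof -
  from assms obtain \<phi> where \<phi>: "over S \<phi>" "vf_free \<phi> = {}"
    "\<And>e s. sat \<phi> e s \<longleftrightarrow> P (s 0) (\<lambda>i. s (Suc i))"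
    unfolding defpred_def by blast
  obtain n where n: "\<And>j. j \<in> rv_free \<phi> \<Longrightarrow> j \<le> n"
    using finite_rv_free[of \<phi>] by (metis finite_nat_set_iff_bounded_le)
  (* Variable n is not among the variables that Suc j is sent to for a free Suc j, so quantifying over
     it binds exactly what was variable 0. *)
  define \<sigma> :: "nat \<Rightarrow> ('a, 'a RV) rv_term" where
    "\<sigma> = (\<lambda>i. case i of 0 \<Rightarrow> RVar n | Suc j \<Rightarrow> RVar j)"
  have \<sigma>: "term_over S (\<sigma> i)" "rv_vf_vars_t (\<sigma> i) = {}" for i
    by (auto simp: \<sigma>_def term_over_def split: nat.split)
  let ?\<psi> = "ExRV n (form_subst RPar \<phi> \<sigma>)"
  have "over S (form_subst RPar \<phi> \<sigma>)"
    using \<phi>(1) \<sigma>(1) by (intro over_subst) (auto simp: over_def term_over_def)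
  then have "over S ?\<psi>" by (simp add: over_def)
  moreover have "vf_free ?\<psi> = {}"
    using \<phi>(2) \<sigma>(2) by (simp add: vf_free_subst)
  moreover have "sat ?\<psi> e s \<longleftrightarrow> (\<exists>x. P x s)" for e s
  proof -
    have "sat (form_subst RPar \<phi> \<sigma>) e (s(n := x)) \<longleftrightarrow> P x s" for x
    proof -
      have "sat (form_subst RPar \<phi> \<sigma>) e (s(n := x)) = sat \<phi> e (\<lambda>i. rv_val e (s(n := x)) (\<sigma> i))"
        using \<sigma>(2) by (simp add: sat_subst)
      also have "\<dots> = sat \<phi> e (case_nat x s)"
      proof (rule sat_cong)
        fix i assume "i \<in> rv_free \<phi>"
        then show "rv_val e (s(n := x)) (\<sigma> i) = case_nat x s i"
          using n[of i] by (auto simp: \<sigma>_def split: nat.split)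
      qed simp
      also have "\<dots> = P x s" by (simp add: \<phi>(3))
      finally show ?thesis .
    qed
    then show ?thesis by simp
  qed
  ultimately show ?thesis unfolding defpred_def by blast
qed

lemma all_conv_not_ex_not: "(\<forall>x. P x) \<longleftrightarrow> \<not> (\<exists>x. \<not> P x)"
  by blast

lemma defpred_all:
  "defpred S (\<lambda>s. P (s 0) (\<lambda>i. s (Suc i))) \<Longrightarrow> defpred S (\<lambda>s. \<forall>x. P x s)"
  unfolding all_conv_not_ex_not by (intro defpred_not defpred_ex)

lemma map_upt_Suc_shift: "map s [0..<Suc m] = s 0 # map (\<lambda>i. s (Suc i)) [0..<m]"
  by (simp add: upt_conv_Cons map_Suc_upt[symmetric] del: upt_Suc)

text \<open>Quantification over tuples, with the components of the tuple as the first \<open>m\<close> variables.\<close>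
lemma defpred_exl:
  "defpred S (\<lambda>s. P (map s [0..<m]) (\<lambda>i. s (i + m))) \<Longrightarrow>
   defpred S (\<lambda>s. \<exists>v. length v = m \<and> P v s)"
proof (induction m arbitrary: P)
  case 0
  then show ?case by simp
next
  case (Suc m)
  have "defpred S (\<lambda>s. \<exists>v. length v = m \<and> (\<exists>x. P (x # v) s))"
  proof (intro Suc.IH defpred_ex)
    have *: "defpred S (\<lambda>s. P (s 0 # map (\<lambda>i. s (Suc i)) [0..<m]) (\<lambda>i. s (i + Suc m)))"
      using Suc.prems by (simp only: map_upt_Suc_shift)
    then show "defpred S (\<lambda>s. P (s 0 # map (\<lambda>i. s (Suc i)) [0..<m]) (\<lambda>i. s (Suc (i + m))))"
      by simp
  qed
  moreover have "(\<exists>v. length v = m \<and> (\<exists>x. P (x # v) s)) \<longleftrightarrow> (\<exists>v. length v = Suc m \<and> P v s)" for s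
    by (metis length_Suc_conv)
  ultimately show ?case by simp
qed

lemma deflist_Nil: "deflist S (\<lambda>s. [])"
  unfolding deflist_def by (intro exI[of _ "[]"]) simp

lemma deflist_Cons: "defterm S t \<Longrightarrow> deflist S l \<Longrightarrow> deflist S (\<lambda>s. t s # l s)"
  unfolding deflist_def
proof (elim exE conjE)
  fix ts assume "defterm S t" "\<forall>t\<in>set ts. defterm S t" "\<forall>s. l s = map (\<lambda>t. t s) ts"
  then show "\<exists>ts. (\<forall>t\<in>set ts. defterm S t) \<and> (\<forall>s. t s # l s = map (\<lambda>t. t s) ts)"
    by (intro exI[of _ "t # ts"]) simp
qed

lemma deflist_append: "deflist S l \<Longrightarrow> deflist S l' \<Longrightarrow> deflist S (\<lambda>s. l s @ l' s)"
  unfolding deflist_def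
proof (elim exE conjE)
  fix ts ts' assume "\<forall>t\<in>set ts. defterm S t" "\<forall>s. l s = map (\<lambda>t. t s) ts"
    "\<forall>t\<in>set ts'. defterm S t" "\<forall>s. l' s = map (\<lambda>t. t s) ts'"
  then show "\<exists>ts. (\<forall>t\<in>set ts. defterm S t) \<and> (\<forall>s. l s @ l' s = map (\<lambda>t. t s) ts)"
    by (intro exI[of _ "ts @ ts'"]) auto
qed

lemma deflist_take: "deflist S l \<Longrightarrow> deflist S (\<lambda>s. take n (l s))"
  unfolding deflist_def
proof (elim exE conjE)
  fix ts assume "\<forall>t\<in>set ts. defterm S t" "\<forall>s. l s = map (\<lambda>t. t s) ts"
  then show "\<exists>ts. (\<forall>t\<in>set ts. defterm S t) \<and> (\<forall>s. take n (l s) = map (\<lambda>t. t s) ts)"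
    by (intro exI[of _ "take n ts"]) (auto simp: take_map dest: in_set_takeD)
qed

lemma deflist_drop: "deflist S l \<Longrightarrow> deflist S (\<lambda>s. drop n (l s))"
  unfolding deflist_def
proof (elim exE conjE)
  fix ts assume "\<forall>t\<in>set ts. defterm S t" "\<forall>s. l s = map (\<lambda>t. t s) ts"
  then show "\<exists>ts. (\<forall>t\<in>set ts. defterm S t) \<and> (\<forall>s. drop n (l s) = map (\<lambda>t. t s) ts)"
    by (intro exI[of _ "drop n ts"]) (auto simp: drop_map dest: in_set_dropD)
qed

lemma deflist_map: "(\<And>i. i \<in> set ns \<Longrightarrow> defterm S (t i)) \<Longrightarrow> deflist S (\<lambda>s. map (\<lambda>i. t i s) ns)"
  unfolding deflist_def by (intro exI[of _ "map t ns"]) auto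

lemma deflist_vars: "deflist S (\<lambda>s. map s ns)"
  by (intro deflist_map defterm_var)

lemma deflist_replicate: "defterm S t \<Longrightarrow> deflist S (\<lambda>s. replicate n (t s))"
  unfolding deflist_def by (intro exI[of _ "replicate n t"]) auto

lemma defterm_nth:
  assumes "deflist S l" "\<And>s. n < length (l s)" shows "defterm S (\<lambda>s. l s ! n)"
proof -
  from assms(1) obtain ts where ts: "\<forall>t\<in>set ts. defterm S t" "\<And>s. l s = map (\<lambda>t. t s) ts"
    unfolding deflist_def by blast
  have "n < length ts" using assms(2) by (simp add: ts(2))
  then show ?thesis using ts(1) by (simp add: ts(2))
qed

lemma deflist_update: "deflist S l \<Longrightarrow> defterm S t \<Longrightarrow> deflist S (\<lambda>s. (l s)[n := t s])"
  unfolding deflist_def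
proof (elim exE conjE)
  fix ts assume "defterm S t" "\<forall>t\<in>set ts. defterm S t" "\<forall>s. l s = map (\<lambda>t. t s) ts"
  then show "\<exists>ts. (\<forall>t\<in>set ts. defterm S t) \<and> (\<forall>s. (l s)[n := t s] = map (\<lambda>t. t s) ts)"
    using set_update_subset_insert[of ts n t] by (intro exI[of _ "ts[n := t]"]) (auto simp: map_update)
qed

lemma defpred_ball:
  "finite A \<Longrightarrow> (\<And>i. i \<in> A \<Longrightarrow> defpred S (P i)) \<Longrightarrow> defpred S (\<lambda>s. \<forall>i\<in>A. P i s)"
proof (induction A rule: finite_induct)
  case empty
  then show ?case by (simp add: defpred_const)
next
  case (insert i A)
  then show ?case using defpred_conj[of S "P i" "\<lambda>s. \<forall>i\<in>A. P i s"] by simp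
qed

lemma defpred_list_eq:
  assumes "deflist S l" "deflist S l'" shows "defpred S (\<lambda>s. l s = l' s)"
proof -
  from assms obtain ts ts' where ts: "\<forall>t\<in>set ts. defterm S t" "\<And>s. l s = map (\<lambda>t. t s) ts"
    "\<forall>t\<in>set ts'. defterm S t" "\<And>s. l' s = map (\<lambda>t. t s) ts'"
    unfolding deflist_def by blast
  have "(l s = l' s) = (length ts = length ts' \<and> (\<forall>i\<in>{..<min (length ts) (length ts')}. (ts ! i) s = (ts' ! i) s))" for s
    by (auto simp: ts list_eq_iff_nth_eq)
  moreover have "defpred S (\<lambda>s. length ts = length ts' \<and>
      (\<forall>i\<in>{..<min (length ts) (length ts')}. (ts ! i) s = (ts' ! i) s))"
    using ts by (intro defpred_conj defpred_const defpred_ball defpred_eq) auto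
  ultimately show ?thesis by simp
qed

lemma defpred_in_set:
  assumes "defterm S t" "deflist S l" shows "defpred S (\<lambda>s. t s \<in> set (l s))"
proof -
  from assms obtain ts where ts: "\<forall>t\<in>set ts. defterm S t" "\<And>s. l s = map (\<lambda>t. t s) ts"
    unfolding deflist_def by blast
  have "defpred S (\<lambda>s. \<forall>t'\<in>set ts. t s \<noteq> t' s)"
    using ts(1) assms(1) by (intro defpred_ball defpred_not defpred_eq) auto
  from defpred_not[OF this] show ?thesis
    by (rule back_subst[of "defpred S"]) (auto simp: ts(2))
qed

text \<open>
  A formula may have free variables that do not influence its truth; quantifying them away puts it
  into the shape that the definitions of \<^const>\<open>definable\<close> and \<^const>\<open>acl\<close> prescribe.
\<close>
lemma defpred_project:
  assumes "over S \<phi>" "vf_free \<phi> = {}" "\<And>s s'. (\<And>i. i < m \<Longrightarrow> s i = s' i) \<Longrightarrow> sat \<phi> e s = sat \<phi> e s'"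
  shows "\<exists>\<psi>. over S \<psi> \<and> vf_free \<psi> = {} \<and> rv_free \<psi> \<subseteq> {..<m} \<and> (\<forall>s. sat \<psi> e s = sat \<phi> e s)"
proof -
  have "\<exists>\<psi>. over S \<psi> \<and> vf_free \<psi> = {} \<and> rv_free \<psi> = rv_free \<phi> - A \<and> (\<forall>s. sat \<psi> e s = sat \<phi> e s)"
    if "finite A" "A \<inter> {..<m} = {}" for A
    using that
  proof (induction A rule: finite_induct)
    case empty
    show ?case using assms(1,2) by (intro exI[of _ \<phi>]) simp
  next
    case (insert i A)
    then obtain \<psi> where \<psi>: "over S \<psi>" "vf_free \<psi> = {}" "rv_free \<psi> = rv_free \<phi> - A"
      "\<And>s. sat \<psi> e s = sat \<phi> e s" by auto
    have "sat \<phi> e (s(i := x)) = sat \<phi> e s" for x s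
      using insert.prems by (intro assms(3)) auto
    then show ?case
      using \<psi> by (intro exI[of _ "ExRV i \<psi>"]) (auto simp: over_def)
  qed
  from this[of "rv_free \<phi> - {..<m}"] show ?thesis
    using finite_rv_free[of \<phi>] by (metis Diff_Diff_Int Diff_disjoint finite_Diff inf.commute inf_le2)
qed

lemma definable_iff:
  "definable S m U \<longleftrightarrow> (\<forall>w\<in>U. length w = m) \<and> defpred S (\<lambda>s. map s [0..<m] \<in> U)"
proof
  assume "definable S m U"
  then obtain \<phi> where \<phi>: "over S \<phi>" "vf_free \<phi> = {}" "rv_free \<phi> \<subseteq> {..<m}"
    "U = {w. length w = m \<and> sat \<phi> (\<lambda>_. 0) (\<lambda>i. w ! i)}"
    unfolding definable_def by blast
  have "sat \<phi> e s \<longleftrightarrow> map s [0..<m] \<in> U" for e s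
  proof -
    have "sat \<phi> e s = sat \<phi> (\<lambda>_. 0) (\<lambda>i. map s [0..<m] ! i)"
      using \<phi>(2,3) by (intro sat_cong) auto
    then show ?thesis by (simp add: \<phi>(4))
  qed
  then show "(\<forall>w\<in>U. length w = m) \<and> defpred S (\<lambda>s. map s [0..<m] \<in> U)"
    using \<phi> unfolding defpred_def by blast
next
  assume *: "(\<forall>w\<in>U. length w = m) \<and> defpred S (\<lambda>s. map s [0..<m] \<in> U)"
  then obtain \<phi> where \<phi>: "over S \<phi>" "vf_free \<phi> = {}" "\<And>e s. sat \<phi> e s \<longleftrightarrow> map s [0..<m] \<in> U"
    unfolding defpred_def by blast
  have "sat \<phi> (\<lambda>_. 0) s = sat \<phi> (\<lambda>_. 0) s'" if "\<And>i. i < m \<Longrightarrow> s i = s' i" for s s'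
  proof -
    have "map s [0..<m] = map s' [0..<m]" using that by simp
    then show ?thesis by (simp only: \<phi>(3))
  qed
  from defpred_project[OF \<phi>(1,2) this] obtain \<psi> where \<psi>: "over S \<psi>" "vf_free \<psi> = {}"
    "rv_free \<psi> \<subseteq> {..<m}" "\<And>s. sat \<psi> (\<lambda>_. 0) s = sat \<phi> (\<lambda>_. 0) s"
    by blast
  have mem: "sat \<psi> (\<lambda>_. 0) (\<lambda>i. w ! i) \<longleftrightarrow> w \<in> U" if "length w = m" for w
  proof -
    have "map (\<lambda>i. w ! i) [0..<m] = w" using that map_nth by blast
    then show ?thesis by (simp only: \<psi>(4) \<phi>(3))
  qed
  have "U = {w. length w = m \<and> sat \<psi> (\<lambda>_. 0) (\<lambda>i. w ! i)}"
    using * mem by blast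
  then show "definable S m U" using \<psi> unfolding definable_def by blast
qed

lemma defpred_mem:
  assumes "definable S m U" "deflist S l" shows "defpred S (\<lambda>s. l s \<in> U)"
proof -
  from assms(2) obtain ts where ts: "\<forall>t\<in>set ts. defterm S t" "\<And>s. l s = map (\<lambda>t. t s) ts"
    unfolding deflist_def by blast
  show ?thesis
  proof (cases "length ts = m")
    case True
    (* substitution needs a term for every variable, also for those that are never looked at *)
    define t where "t i = (if i < m then ts ! i else (\<lambda>_. 1))" for i
    have "defterm S (t i)" for i
      using ts(1) True by (auto simp: t_def defterm_one)
    then have "defpred S (\<lambda>s. map (\<lambda>i. t i s) [0..<m] \<in> U)"
      using assms(1) defpred_subst[of S "\<lambda>s. map s [0..<m] \<in> U" t] by (simp add: definable_iff)
    moreover have "map (\<lambda>i. t i s) [0..<m] = l s" for s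
      using True by (intro nth_equalityI) (auto simp: ts t_def)
    ultimately show ?thesis by simp
  next
    case False
    then have "l s \<notin> U" for s
      using assms(1) by (auto simp: ts definable_iff)
    then show ?thesis by (simp add: defpred_const)
  qed
qed

text \<open>
  The graph as a binary condition, so that statements about values of a definable function can be
  rewritten with quantifiers over its graph.
\<close>
definition graph_of :: "'b set \<Rightarrow> ('b \<Rightarrow> 'c) \<Rightarrow> 'b \<Rightarrow> 'c \<Rightarrow> bool" where
  "graph_of U f u v \<longleftrightarrow> u \<in> U \<and> v = f u"

lemma defpred_graph:
  assumes "definable_fun S m n U f" "deflist S l" "deflist S l'"
  shows "defpred S (\<lambda>s. graph_of U f (l s) (l' s))"
proof -
  have U: "\<forall>w\<in>U. length w = m" using assms(1) by (simp add: definable_fun_def definable_iff)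
  have "defpred S (\<lambda>s. l s \<in> U \<and> l s @ l' s \<in> {u @ f u |u. u \<in> U})"
    using assms by (intro defpred_conj defpred_mem deflist_append) (auto simp: definable_fun_def)
  moreover have "graph_of U f (l s) (l' s) \<longleftrightarrow> l s \<in> U \<and> l s @ l' s \<in> {u @ f u |u. u \<in> U}" for s
    using U by (auto simp: graph_of_def)
  ultimately show ?thesis by simp
qed

lemmas definability = defpred_eq defpred_not defpred_conj defpred_disj defpred_imp
  defpred_exl defpred_ex defpred_all defpred_list_eq defpred_in_set
  deflist_Nil deflist_Cons deflist_append deflist_take deflist_drop deflist_map deflist_vars deflist_replicate deflist_update
  defterm_var defterm_one defterm_inf defterm_mult

lemma definableI:
  assumes "\<And>w. w \<in> U \<Longrightarrow> length w = m" "\<And>w. length w = m \<Longrightarrow> w \<in> U \<longleftrightarrow> P w"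
    "defpred S (\<lambda>s. P (map s [0..<m]))"
  shows "definable S m U"
  using assms by (simp add: definable_iff)

lemma definable_funI:
  assumes U: "definable S m U" and f: "\<And>u. u \<in> U \<Longrightarrow> length (f u) = n"
    and P: "\<And>u v. length u = m \<Longrightarrow> length v = n \<Longrightarrow> graph_of U f u v \<longleftrightarrow> P u v"
    and d: "defpred S (\<lambda>s. P (map s [0..<m]) (map (\<lambda>i. s (i + m)) [0..<n]))"
  shows "definable_fun S m n U f"
  unfolding definable_fun_def
proof (intro conjI ballI U f)
  have Um: "\<forall>w\<in>U. length w = m" using U by (simp add: definable_iff)
  show "definable S (m + n) {u @ f u |u. u \<in> U}"
    unfolding definable_iff
  proof
    show "\<forall>w\<in>{u @ f u |u. u \<in> U}. length w = m + n" using Um f by auto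
    have "map s [0..<m + n] \<in> {u @ f u |u. u \<in> U} \<longleftrightarrow>
      P (map s [0..<m]) (map (\<lambda>i. s (i + m)) [0..<n])" for s
    proof -
      have split: "map s [0..<m + n] = map s [0..<m] @ map (\<lambda>i. s (i + m)) [0..<n]"
        by (intro nth_equalityI) (auto simp: nth_append add.commute)
      have "map s [0..<m + n] \<in> {u @ f u |u. u \<in> U} \<longleftrightarrow>
         graph_of U f (map s [0..<m]) (map (\<lambda>i. s (i + m)) [0..<n])"
        unfolding split using Um by (auto simp: graph_of_def)
      then show ?thesis using P by simp
    qed
    then show "defpred S (\<lambda>s. map s [0..<m + n] \<in> {u @ f u |u. u \<in> U})"
      using d by simp
  qed
qed

text \<open>
  The maximal ideal is visible through \<^const>\<open>rv\<close>: it consists of the \<open>a\<close> with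
  \<open>1 + a\<close> in the class of \<open>1\<close>. This makes \<^const>\<open>RV_gt1\<close> definable with one VF-quantifier.
\<close>
lemma RV_gt1_iff: "rv a \<in> RV_gt1 \<longleftrightarrow> rv 1 = rv (1 + a)"
  using one_plus_max_ideal[of "1 + a"] val_units_nonzero[of "1 + a"]
  by (auto simp: rv_mem_RV_gt1 rv_eq_iff rv_rel_def)

lemma rv_surj: obtains a where "x = rv a"
proof -
  have "\<exists>a. x = rv a" by transfer (blast intro: equivp_reflp[OF equivp_rv_rel])
  then show ?thesis using that by blast
qed

lemma defpred_RV_gt1:
  assumes "defterm S t" shows "defpred S (\<lambda>s. t s \<in> RV_gt1)"
proof -
  from assms obtain \<tau> where \<tau>: "term_over S \<tau>" "rv_vf_vars_t \<tau> = {}" "\<And>e s. rv_val e s \<tau> = t s"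
    unfolding defterm_def by blast
  let ?\<phi> = "ExVF 0 (Conj (EqRV \<tau> (Rv (VVar 0))) (EqRV (Rv VOne) (Rv (VAdd VOne (VVar 0)))))"
  have "over S ?\<phi>" "vf_free ?\<phi> = {}" using \<tau> by (auto simp: over_def term_over_def)
  moreover have "sat ?\<phi> e s \<longleftrightarrow> t s \<in> RV_gt1" for e s
  proof -
    obtain b where b: "t s = rv b" by (rule rv_surj)
    have "rv b \<in> RV_gt1 \<longleftrightarrow> (\<exists>a. rv b = rv a \<and> rv a \<in> RV_gt1)" by auto
    then show ?thesis by (auto simp: \<tau>(3) b RV_gt1_iff)
  qed
  ultimately show ?thesis unfolding defpred_def by blast
qed

section \<open>Algebraic closure\<close>

lemma acl_iff:
  "x \<in> acl S B \<longleftrightarrow> (\<exists>P. defpred (S \<union> Inr ` B) (\<lambda>s. P (s 0)) \<and> finite {y. P y} \<and> P x)"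
proof
  assume "x \<in> acl S B"
  then obtain \<phi> where \<phi>: "over (S \<union> Inr ` B) \<phi>" "vf_free \<phi> = {}" "rv_free \<phi> \<subseteq> {0}"
    "finite {y. sat \<phi> (\<lambda>_. 0) (\<lambda>_. y)}" "sat \<phi> (\<lambda>_. 0) (\<lambda>_. x)"
    unfolding acl_def by blast
  have "sat \<phi> e s \<longleftrightarrow> sat \<phi> (\<lambda>_. 0) (\<lambda>_. s 0)" for e s
    using \<phi>(2,3) by (intro sat_cong) auto
  then have "defpred (S \<union> Inr ` B) (\<lambda>s. sat \<phi> (\<lambda>_. 0) (\<lambda>_. s 0))"
    using \<phi>(1,2) unfolding defpred_def by blast
  then show "\<exists>P. defpred (S \<union> Inr ` B) (\<lambda>s. P (s 0)) \<and> finite {y. P y} \<and> P x"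
    using \<phi>(4,5) by (intro exI[of _ "\<lambda>y. sat \<phi> (\<lambda>_. 0) (\<lambda>_. y)"]) simp
next
  assume "\<exists>P. defpred (S \<union> Inr ` B) (\<lambda>s. P (s 0)) \<and> finite {y. P y} \<and> P x"
  then obtain P \<phi> where P: "finite {y. P y}" "P x" and \<phi>: "over (S \<union> Inr ` B) \<phi>" "vf_free \<phi> = {}"
    "\<And>e s. sat \<phi> e s \<longleftrightarrow> P (s 0)"
    unfolding defpred_def by blast
  have "sat \<phi> (\<lambda>_. 0) s = sat \<phi> (\<lambda>_. 0) s'" if "\<And>i. i < 1 \<Longrightarrow> s i = s' i" for s s'
    using that[of 0] by (simp add: \<phi>(3))
  from defpred_project[OF \<phi>(1,2) this] obtain \<psi> where \<psi>: "over (S \<union> Inr ` B) \<psi>" "vf_free \<psi> = {}"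
    "rv_free \<psi> \<subseteq> {..<1}" "\<And>s. sat \<psi> (\<lambda>_. 0) s = sat \<phi> (\<lambda>_. 0) s"
    by blast
  have "rv_free \<psi> \<subseteq> {0}" using \<psi>(3) by auto
  moreover have "finite {y. sat \<psi> (\<lambda>_. 0) (\<lambda>_. y)}" "sat \<psi> (\<lambda>_. 0) (\<lambda>_. x)"
    using P by (simp_all add: \<psi>(4) \<phi>(3))
  ultimately show "x \<in> acl S B"
    using \<psi>(1,2) unfolding acl_def by blast
qed

lemma defpred_mono: "defpred S P \<Longrightarrow> S \<subseteq> T \<Longrightarrow> defpred T P"
  unfolding defpred_def over_def by (meson subset_trans)

lemma acl_mono: "B \<subseteq> C \<Longrightarrow> acl S B \<subseteq> acl S C"
proof
  fix x assume "B \<subseteq> C" "x \<in> acl S B"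
  moreover from \<open>B \<subseteq> C\<close> have "S \<union> Inr ` B \<subseteq> S \<union> Inr ` C" by auto
  ultimately show "x \<in> acl S C" unfolding acl_iff by (meson defpred_mono)
qed

lemma acl_refl: "B \<subseteq> acl S B"
proof
  fix x assume "x \<in> B"
  then have "defpred (S \<union> Inr ` B) (\<lambda>s. s 0 = x)"
    by (intro defpred_eq defterm_var defterm_par) auto
  moreover have "finite {y. y = x}" by simp
  ultimately show "x \<in> acl S B"
    unfolding acl_iff by (intro exI[of _ "\<lambda>y. y = x"]) simp
qed

text \<open>
  Every condition with parameter \<open>b\<close> is the instance at \<open>b\<close> of a condition in which \<open>b\<close> has
  become a variable.
\<close>
lemma defpred_abstract:
  assumes "defpred (insert (Inr b) D) P"
  obtains Q where "defpred D (\<lambda>s. Q (s 0) (\<lambda>i. s (Suc i)))" "\<And>s. Q b s \<longleftrightarrow> P s"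
proof -
  from assms obtain \<phi> where \<phi>: "over (insert (Inr b) D) \<phi>" "vf_free \<phi> = {}" "\<And>e s. sat \<phi> e s \<longleftrightarrow> P s"
    unfolding defpred_def by blast
  define \<pi> :: "'a RV \<Rightarrow> ('a, 'a RV) rv_term" where
    "\<pi> x = (if Inr x \<in> D then RPar x else RVar 0)" for x
  have \<pi>: "rv_vf_vars_t (\<pi> x) = {}" "term_over D (\<pi> x)" for x
    by (auto simp: \<pi>_def term_over_def)
  define \<psi> where "\<psi> = form_subst \<pi> \<phi> (\<lambda>i. RVar (Suc i))"
  have "over D \<psi>"
    unfolding \<psi>_def using \<pi> \<phi>(1) by (intro over_subst) (auto simp: over_def term_over_def)
  moreover have \<psi>: "vf_free \<psi> = {}"
    unfolding \<psi>_def using \<pi>(1) \<phi>(2) by (simp add: vf_free_subst)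
  moreover have "sat \<psi> e s = sat \<psi> (\<lambda>_. 0) (case_nat (s 0) (\<lambda>i. s (Suc i)))" for e s
    using \<psi> by (intro sat_cong) (auto split: nat.split)
  ultimately have "defpred D (\<lambda>s. sat \<psi> (\<lambda>_. 0) (case_nat (s 0) (\<lambda>i. s (Suc i))))"
    unfolding defpred_def by blast
  moreover have "sat \<psi> (\<lambda>_. 0) (case_nat b s) \<longleftrightarrow> P s" for s
  proof -
    have "rv_val (\<lambda>_. 0) (case_nat b s) (\<pi> x) = x" if "x \<in> rv_pars \<phi>" for x
      using that \<phi>(1) by (auto simp: \<pi>_def over_def)
    then have "sat \<psi> (\<lambda>_. 0) (case_nat b s) = sat \<phi> (\<lambda>_. 0) s"
      unfolding \<psi>_def by (subst sat_subst) (auto simp: \<pi>)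
    then show ?thesis by (simp add: \<phi>(3))
  qed
  ultimately show thesis by (rule that)
qed

text \<open>
  Let \<open>R\<close> isolate \<open>b\<close> within a finite set, and let \<open>Q b\<close> isolate \<open>x\<close> within a set of \<open>N\<close>
  elements. For other values \<open>y\<close> in the finite set \<open>R\<close> the set \<open>Q y\<close> may be infinite. Therefore
  \<open>y\<close> is restricted to those values for which \<open>Q y\<close> is covered by a tuple of length \<open>N\<close>, which is
  a definable condition. The union of the \<open>Q y\<close> over these \<open>y\<close> is finite and contains \<open>x\<close>.
\<close>
lemma acl_insert:
  assumes b: "b \<in> acl S B" and x: "x \<in> acl S (insert b B)"
  shows "x \<in> acl S B"
proof -
  let ?D = "S \<union> Inr ` B"
  from b obtain R where R: "defpred ?D (\<lambda>s. R (s 0))" "finite {y. R y}" "R b"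
    unfolding acl_iff by blast
  from x obtain P where P: "defpred (insert (Inr b) ?D) (\<lambda>s. P (s 0))" "finite {y. P y}" "P x"
    unfolding acl_iff by auto
  from P(1) obtain Q where Q: "defpred ?D (\<lambda>s. Q (s 0) (\<lambda>i. s (Suc i)))" "\<And>s. Q b s \<longleftrightarrow> P (s 0)"
    by (rule defpred_abstract) (rule that)
  have Q': "defpred ?D (\<lambda>s. Q (s i) (\<lambda>_. s j))" for i j
  proof -
    have "defpred ?D (\<lambda>s. (\<lambda>s. Q (s 0) (\<lambda>i. s (Suc i))) (\<lambda>n. s (case n of 0 \<Rightarrow> i | Suc _ \<Rightarrow> j)))"
      by (rule defpred_subst[OF Q(1)]) (rule defterm_var)
    then show ?thesis by simp
  qed
  have R': "defpred ?D (\<lambda>s. R (s i))" for i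
  proof -
    have "defpred ?D (\<lambda>s. (\<lambda>s. R (s 0)) (\<lambda>n. s i))"
      by (rule defpred_subst[OF R(1)]) (rule defterm_var)
    then show ?thesis by simp
  qed
  (* length N suffices to cover Q b, and it is a fixed number, so covering is expressible *)
  obtain xs where xs: "set xs = {y. P y}" using P(2) finite_list by blast
  define N where "N = length xs"
  define small where "small y \<longleftrightarrow> (\<exists>v. length v = N \<and> (\<forall>z. Q y (\<lambda>_. z) \<longrightarrow> z \<in> set v))" for y
  have fin: "finite {z. Q y (\<lambda>_. z)}" if "small y" for y
    using that finite_subset[of _ "set v" for v] unfolding small_def by (metis List.finite_set mem_Collect_eq subsetI)
  have "small b"
    unfolding small_def N_def using xs by (auto simp: Q(2))
  define T where "T z \<longleftrightarrow> (\<exists>y. R y \<and> Q y (\<lambda>_. z) \<and> small y)" for z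
  have "defpred ?D (\<lambda>s. T (s 0))"
    unfolding T_def small_def by (intro definability R' Q')
  moreover have "finite {z. T z}"
  proof (rule finite_subset)
    show "{z. T z} \<subseteq> (\<Union>y\<in>{y. R y \<and> small y}. {z. Q y (\<lambda>_. z)})" by (auto simp: T_def)
    show "finite (\<Union>y\<in>{y. R y \<and> small y}. {z. Q y (\<lambda>_. z)})" using R(2) fin by auto
  qed
  moreover have "T x" unfolding T_def using R(3) \<open>small b\<close> P(3) by (auto simp: Q(2))
  ultimately show ?thesis unfolding acl_iff by blast
qed

lemma acl_finite_parameters:
  assumes "x \<in> acl S B" obtains C where "finite C" "C \<subseteq> B" "x \<in> acl S C"
proof -
  from assms obtain \<phi> where \<phi>: "over (S \<union> Inr ` B) \<phi>" "vf_free \<phi> = {}" "rv_free \<phi> \<subseteq> {0}"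
    "finite {y. sat \<phi> (\<lambda>_. 0) (\<lambda>_. y)}" "sat \<phi> (\<lambda>_. 0) (\<lambda>_. x)"
    unfolding acl_def by blast
  have "over (S \<union> Inr ` (rv_pars \<phi> \<inter> B)) \<phi>"
    using \<phi>(1) by (auto simp: over_def)
  then have "x \<in> acl S (rv_pars \<phi> \<inter> B)" using \<phi> unfolding acl_def by blast
  then show thesis using that finite_rv_pars[of \<phi>] by blast
qed

text \<open>A formula has finitely many parameters, and they can be removed one at a time.\<close>
lemma acl_trans:
  assumes "B \<subseteq> acl S A" shows "acl S B \<subseteq> acl S A"
proof
  fix x assume "x \<in> acl S B"
  then obtain C where C: "finite C" "C \<subseteq> B" "x \<in> acl S C" by (rule acl_finite_parameters)
  have "C \<subseteq> acl S A \<Longrightarrow> x \<in> acl S (C \<union> A) \<Longrightarrow> x \<in> acl S A"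
    using C(1)
  proof (induction C rule: finite_induct)
    case (insert b C)
    have "b \<in> acl S (C \<union> A)" using insert.prems acl_mono[of A "C \<union> A" S] by auto
    then have "x \<in> acl S (C \<union> A)" using insert.prems acl_insert by simp
    then show ?case using insert by simp
  qed simp
  then show "x \<in> acl S A" using C assms acl_mono[of C "C \<union> A" S] by blast
qed

lemma rv_eq_inf_iff: "rv a = \<infinity>\<^sub>r\<^sub>v \<longleftrightarrow> a = 0"
  by (simp add: rv_eq_iff rv_rel_def)

lemma RV_mult_eq_inf_iff: "x * y = \<infinity>\<^sub>r\<^sub>v \<longleftrightarrow> x = \<infinity>\<^sub>r\<^sub>v \<or> y = \<infinity>\<^sub>r\<^sub>v"
proof -
  obtain a b where "x = rv a" "y = rv b" using rv_surj by metis
  then show ?thesis by (simp add: rv_eq_inf_iff flip: rv_mult)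
qed

lemma RV_mult_right_cancel:
  assumes "z \<noteq> \<infinity>\<^sub>r\<^sub>v" "x * z = y * z" shows "x = y"
proof -
  obtain a where a: "z = rv a" by (rule rv_surj)
  then have "z * rv (inverse a) = 1" using assms(1) by (simp add: rv_eq_inf_iff rv_one flip: rv_mult)
  then show ?thesis using assms(2) by (metis mult.assoc mult.right_neutral)
qed

lemma acl_mult:
  assumes "x \<in> acl S B" "y \<in> acl S B" shows "x * y \<in> acl S B"
proof -
  have "defpred (S \<union> Inr ` {x, y}) (\<lambda>s. s 0 = x * y)"
    by (intro defpred_eq defterm_var defterm_mult defterm_par) auto
  then have "x * y \<in> acl S {x, y}"
    unfolding acl_iff by (intro exI[of _ "\<lambda>z. z = x * y"]) simp
  then show ?thesis using acl_trans[of "{x, y}" S B] assms by auto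
qed

lemma acl_divide:
  assumes "x * y \<in> acl S B" "y \<in> acl S B" "y \<noteq> \<infinity>\<^sub>r\<^sub>v" shows "x \<in> acl S B"
proof -
  have "defpred (S \<union> Inr ` {x * y, y}) (\<lambda>s. s 0 * y = x * y)"
    by (intro defpred_eq defterm_var defterm_mult defterm_par[of "x * y"] defterm_par[of y]) auto
  moreover have "{z. z * y = x * y} \<subseteq> {x}" using RV_mult_right_cancel[OF assms(3)] by auto
  then have "finite {z. z * y = x * y}" by (rule finite_subset) simp
  ultimately have "x \<in> acl S {x * y, y}"
    unfolding acl_iff by (intro exI[of _ "\<lambda>z. z * y = x * y"]) simp
  then show ?thesis using acl_trans[of "{x * y, y}" S B] assms by auto
qed

section \<open>Interalgebraic labels\<close>

text \<open>The condition that isomorphisms impose on the labels of corresponding points.\<close>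
definition lab_equiv :: "('a + 'a RV) set \<Rightarrow> 'a::acvf RV list \<Rightarrow> 'a RV list \<Rightarrow> bool" where
  "lab_equiv S a b \<longleftrightarrow>
     length (filter (\<lambda>x. x \<noteq> \<infinity>\<^sub>r\<^sub>v) a) = length (filter (\<lambda>x. x \<noteq> \<infinity>\<^sub>r\<^sub>v) b) \<and>
     set b \<subseteq> acl S (set a) \<and> set a \<subseteq> acl S (set b)"

lemma lab_equiv_refl: "lab_equiv S a a"
  using acl_refl by (auto simp: lab_equiv_def)

lemma lab_equiv_sym: "lab_equiv S a b \<Longrightarrow> lab_equiv S b a"
  by (simp add: lab_equiv_def)

lemma lab_equiv_trans: "lab_equiv S a b \<Longrightarrow> lab_equiv S b c \<Longrightarrow> lab_equiv S a c"
  unfolding lab_equiv_def using acl_trans by (metis subset_trans)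

lemma lab_equiv_append:
  assumes "lab_equiv S a a'" "lab_equiv S b b'" shows "lab_equiv S (a @ b) (a' @ b')"
proof -
  have "acl S (set a) \<subseteq> acl S (set (a @ b))" "acl S (set b) \<subseteq> acl S (set (a @ b))"
    "acl S (set a') \<subseteq> acl S (set (a' @ b'))" "acl S (set b') \<subseteq> acl S (set (a' @ b'))"
    by (auto intro!: acl_mono)
  then show ?thesis using assms unfolding lab_equiv_def by auto
qed

lemma lab_equiv_append_commute: "lab_equiv S (a @ b) (b @ a)"
  using acl_refl[of "set a \<union> set b" S] by (simp add: lab_equiv_def Un_commute)

lemma length_filter_update:
  assumes "j < length a"
  shows "length (filter P (a[j := v])) + (if P (a ! j) then 1 else 0) =
         length (filter P a) + (if P v then 1 else 0)"
proof -
  have "filter P a = filter P (take j a @ a ! j # drop (Suc j) a)"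
    using assms id_take_nth_drop by metis
  then show ?thesis using assms by (simp add: upd_conv_take_nth_drop)
qed

text \<open>Pointwise form of \<^const>\<open>blowup_coord\<close>.\<close>
definition dep_coord :: "('a + 'a RV) set \<Rightarrow> nat \<Rightarrow> 'a::acvf RV list \<Rightarrow> bool" where
  "dep_coord S j a \<longleftrightarrow> j < length a \<and> a ! j \<noteq> \<infinity>\<^sub>r\<^sub>v \<and> a ! j \<in> acl S {a ! i |i. i < length a \<and> i \<noteq> j}"

text \<open>
  After the dependent coordinate has been multiplied by \<open>x\<close>, it can still be recovered up to
  finitely many choices from the untouched coordinates; as it is invertible, so can \<open>x\<close>. Hence a
  label of the elementary blowup carries the information of \<open>x\<close> together with the old label,
  whichever coordinate was used.
\<close>
lemma acl_scaled:
  assumes "dep_coord S j a"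
  shows "set (a[j := x * a ! j]) \<subseteq> acl S (insert x (set a))"
    "insert x (set a) \<subseteq> acl S (set (a[j := x * a ! j]))"
proof -
  let ?b = "a[j := x * a ! j]"
  let ?R = "{a ! i |i. i < length a \<and> i \<noteq> j}"
  have j: "j < length a" and inf: "a ! j \<noteq> \<infinity>\<^sub>r\<^sub>v" and dep: "a ! j \<in> acl S ?R"
    using assms by (auto simp: dep_coord_def)
  have *: "insert x (set a) \<subseteq> acl S (insert x (set a))" by (rule acl_refl)
  have "x * a ! j \<in> acl S (insert x (set a))"
    using * j by (intro acl_mult) auto
  then show "set ?b \<subseteq> acl S (insert x (set a))"
    using * set_update_subset_insert[of a j "x * a ! j"] by blast
  have R: "?R \<subseteq> set ?b"
    by (auto simp: in_set_conv_nth) (metis nth_list_update_neq)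
  then have aj: "a ! j \<in> acl S (set ?b)" using dep acl_mono by blast
  have "x * a ! j \<in> acl S (set ?b)" using acl_refl set_update_memI[OF j] by blast
  then have "x \<in> acl S (set ?b)" using aj inf by (rule acl_divide)
  moreover have "set a \<subseteq> insert (a ! j) ?R" by (auto simp: in_set_conv_nth)
  ultimately show "insert x (set a) \<subseteq> acl S (set ?b)"
    using aj R acl_refl[of "set ?b" S] by blast
qed

text \<open>
  The number of coordinates different from \<open>\<infinity>\<^sub>r\<^sub>v\<close> drops by one on both sides if \<open>x\<close> is
  \<open>\<infinity>\<^sub>r\<^sub>v\<close>, and is unchanged otherwise.
\<close>
lemma lab_equiv_scale:
  assumes a: "dep_coord S j a" and b: "dep_coord S l b" and ab: "lab_equiv S a b"
  shows "lab_equiv S (a[j := x * a ! j]) (b[l := x * b ! l])"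
proof -
  have *: "set (b[l := x * b ! l]) \<subseteq> acl S (set (a[j := x * a ! j]))"
    if a: "dep_coord S j a" and b: "dep_coord S l b" and ab: "set b \<subseteq> acl S (set a)" for j l a b
  proof -
    have "insert x (set b) \<subseteq> acl S (insert x (set a))"
      using ab acl_mono[of "set a" "insert x (set a)" S] acl_refl[of "insert x (set a)" S] by blast
    from acl_trans[OF this] have "set (b[l := x * b ! l]) \<subseteq> acl S (insert x (set a))"
      by (rule subset_trans[OF acl_scaled(1)[OF b]])
    also have "\<dots> \<subseteq> acl S (set (a[j := x * a ! j]))"
      by (rule acl_trans[OF acl_scaled(2)[OF a]])
    finally show ?thesis .
  qed
  have "length (filter (\<lambda>x. x \<noteq> \<infinity>\<^sub>r\<^sub>v) (a[j := x * a ! j])) = length (filter (\<lambda>x. x \<noteq> \<infinity>\<^sub>r\<^sub>v) (b[l := x * b ! l]))"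
    using a b ab length_filter_update[of j a "\<lambda>x. x \<noteq> \<infinity>\<^sub>r\<^sub>v" "x * a ! j"]
      length_filter_update[of l b "\<lambda>x. x \<noteq> \<infinity>\<^sub>r\<^sub>v" "x * b ! l"]
    by (auto simp: dep_coord_def lab_equiv_def RV_mult_eq_inf_iff split: if_splits)
  then show ?thesis using a b ab * by (auto simp: lab_equiv_def)
qed

lemma dep_coord_append: "dep_coord S j a \<Longrightarrow> dep_coord S j (a @ b)"
proof -
  assume a: "dep_coord S j a"
  have "{a ! i |i. i < length a \<and> i \<noteq> j} \<subseteq> {(a @ b) ! i |i. i < length (a @ b) \<and> i \<noteq> j}"
    by (auto simp: nth_append)
  then have "a ! j \<in> acl S {(a @ b) ! i |i. i < length (a @ b) \<and> i \<noteq> j}"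
    using a acl_mono[of _ _ S] unfolding dep_coord_def by blast
  moreover have "(a @ b) ! j = a ! j" "j < length (a @ b)" using a by (auto simp: dep_coord_def nth_append)
  ultimately show ?thesis using a unfolding dep_coord_def by simp
qed

section \<open>Definable functions\<close>

lemma definable_length: "definable S m U \<Longrightarrow> w \<in> U \<Longrightarrow> length w = m"
  by (simp add: definable_iff)

lemma definable_Int: "definable S m U \<Longrightarrow> definable S m V \<Longrightarrow> definable S m (U \<inter> V)"
  by (rule definableI[where P = "\<lambda>w. w \<in> U \<and> w \<in> V"])
    (auto dest: definable_length intro!: definability defpred_mem)

lemma definable_Diff: "definable S m U \<Longrightarrow> definable S m V \<Longrightarrow> definable S m (U - V)"
  by (rule definableI[where P = "\<lambda>w. w \<in> U \<and> \<not> w \<in> V"])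
    (auto dest: definable_length intro!: definability defpred_mem)

lemma definable_Un: "definable S m U \<Longrightarrow> definable S m V \<Longrightarrow> definable S m (U \<union> V)"
  by (rule definableI[where P = "\<lambda>w. w \<in> U \<or> w \<in> V"])
    (auto dest: definable_length intro!: definability defpred_mem)

lemma definable_empty: "definable S m {}"
  by (rule definableI[where P = "\<lambda>w. False"]) (auto intro: defpred_const)

lemma definable_fun_domain: "definable_fun S m n U f \<Longrightarrow> definable S m U"
  by (simp add: definable_fun_def)

lemma definable_fun_length:
  "definable_fun S m n U f \<Longrightarrow> u \<in> U \<Longrightarrow> length u = m"
  "definable_fun S m n U f \<Longrightarrow> u \<in> U \<Longrightarrow> length (f u) = n"
  by (auto simp: definable_fun_def dest: definable_length)

lemma definable_fun_cong:
  assumes "definable_fun S m n U f" "\<And>u. u \<in> U \<Longrightarrow> g u = f u"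
  shows "definable_fun S m n U g"
proof -
  have "{u @ g u |u. u \<in> U} = {u @ f u |u. u \<in> U}" using assms(2) by force
  then show ?thesis using assms by (simp add: definable_fun_def)
qed

lemma definable_fun_restrict:
  assumes "definable_fun S m n U f" "definable S m A" "A \<subseteq> U"
  shows "definable_fun S m n A f"
proof (rule definable_funI[where P = "\<lambda>u v. u \<in> A \<and> graph_of U f u v"])
  show "defpred S (\<lambda>s. map s [0..<m] \<in> A \<and> graph_of U f (map s [0..<m]) (map (\<lambda>i. s (i + m)) [0..<n]))"
    by (intro definability defpred_mem[OF assms(2)] defpred_graph[OF assms(1)])
qed (use assms in \<open>auto simp: graph_of_def dest: definable_fun_length\<close>)

lemma definable_fun_id: "definable S m U \<Longrightarrow> definable_fun S m m U (\<lambda>u. u)"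
proof (rule definable_funI[where P = "\<lambda>u v. u \<in> U \<and> v = u"])
  assume U: "definable S m U"
  show "defpred S (\<lambda>s. map s [0..<m] \<in> U \<and> map (\<lambda>i. s (i + m)) [0..<m] = map s [0..<m])"
    by (intro definability defpred_mem[OF U])
qed (auto simp: graph_of_def dest: definable_length)

lemma definable_fun_comp:
  assumes f: "definable_fun S m n U f" and g: "definable_fun S n p V g" and "f ` U \<subseteq> V"
  shows "definable_fun S m p U (\<lambda>u. g (f u))"
proof (rule definable_funI[where P = "\<lambda>u w. \<exists>v. length v = n \<and> graph_of U f u v \<and> graph_of V g v w"])
  show "defpred S (\<lambda>s. \<exists>v. length v = n \<and> graph_of U f (map s [0..<m]) v \<and>
      graph_of V g v (map (\<lambda>i. s (i + m)) [0..<p]))"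
    by (intro definability defpred_graph[OF f] defpred_graph[OF g])
qed (use assms in \<open>auto simp: graph_of_def definable_fun_domain dest: definable_fun_length\<close>)

lemma definable_image:
  assumes f: "definable_fun S m n U f" shows "definable S n (f ` U)"
proof (rule definableI[where P = "\<lambda>w. \<exists>v. length v = m \<and> graph_of U f v w"])
  show "defpred S (\<lambda>s. \<exists>v. length v = m \<and> graph_of U f v (map s [0..<n]))"
    by (intro definability defpred_graph[OF f])
qed (use assms in \<open>auto simp: graph_of_def definable_fun_domain dest: definable_fun_length\<close>)

lemma definable_fun_inverse:
  assumes f: "definable_fun S m n U f" and bij: "bij_betw f U V"
  shows "definable_fun S n m V (inv_into U f)"
proof (rule definable_funI[where P = "\<lambda>v u. graph_of U f u v"])
  show "definable S n V" using definable_image[OF f] bij by (simp add: bij_betw_def)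
  show "length (inv_into U f v) = m" if "v \<in> V" for v
    using that bij bij_betwE[OF bij_betw_inv_into[OF bij]] f definable_fun_length(1) by blast
  show "graph_of V (inv_into U f) v u \<longleftrightarrow> graph_of U f u v" for v u
    using bij by (auto simp: graph_of_def bij_betw_def f_inv_into_f inv_into_into)
  show "defpred S (\<lambda>s. graph_of U f (map (\<lambda>i. s (i + n)) [0..<m]) (map s [0..<n]))"
    by (intro definability defpred_graph[OF f])
qed

lemma definable_fun_cases:
  assumes f: "definable_fun S m n A f" and g: "definable_fun S m n B g" and "A \<inter> B = {}"
  shows "definable_fun S m n (A \<union> B) (\<lambda>u. if u \<in> A then f u else g u)"
proof (rule definable_funI[where P = "\<lambda>u v. graph_of A f u v \<or> graph_of B g u v"])
  show "defpred S (\<lambda>s. graph_of A f (map s [0..<m]) (map (\<lambda>i. s (i + m)) [0..<n]) \<or>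
      graph_of B g (map s [0..<m]) (map (\<lambda>i. s (i + m)) [0..<n]))"
    by (intro definability defpred_graph[OF f] defpred_graph[OF g])
qed (use assms in \<open>auto simp: graph_of_def definable_fun_domain intro!: definable_Un dest: definable_fun_length split: if_splits\<close>)

lemma definable_append:
  assumes U: "definable S m U" and V: "definable S n V"
  shows "definable S (m + n) {u @ v |u v. u \<in> U \<and> v \<in> V}"
proof (rule definableI[where P = "\<lambda>w. take m w \<in> U \<and> drop m w \<in> V"])
  show "w \<in> {u @ v |u v. u \<in> U \<and> v \<in> V} \<longleftrightarrow> take m w \<in> U \<and> drop m w \<in> V" for w
  proof
    assume "take m w \<in> U \<and> drop m w \<in> V"
    then show "w \<in> {u @ v |u v. u \<in> U \<and> v \<in> V}"
      by (intro CollectI exI[of _ "take m w"] exI[of _ "drop m w"]) simp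
  qed (use assms in \<open>auto dest: definable_length\<close>)
  show "defpred S (\<lambda>s. take m (map s [0..<m + n]) \<in> U \<and> drop m (map s [0..<m + n]) \<in> V)"
    by (intro definability defpred_mem[OF U] defpred_mem[OF V])
qed (auto simp: definable_length[OF U] definable_length[OF V])

lemma definable_fun_append:
  assumes f: "definable_fun S m m' U f" and g: "definable_fun S n n' V g"
  shows "definable_fun S (m + n) (m' + n') {u @ v |u v. u \<in> U \<and> v \<in> V}
           (\<lambda>w. f (take m w) @ g (drop m w))"
proof (rule definable_funI[where P = "\<lambda>w z. graph_of U f (take m w) (take m' z) \<and> graph_of V g (drop m w) (drop m' z)"])
  show "graph_of {u @ v |u v. u \<in> U \<and> v \<in> V} (\<lambda>w. f (take m w) @ g (drop m w)) w z \<longleftrightarrow>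
      graph_of U f (take m w) (take m' z) \<and> graph_of V g (drop m w) (drop m' z)" for w z
  proof
    assume *: "graph_of U f (take m w) (take m' z) \<and> graph_of V g (drop m w) (drop m' z)"
    then have "take m' z @ drop m' z = f (take m w) @ g (drop m w)" by (simp add: graph_of_def)
    moreover have "\<exists>u v. w = u @ v \<and> u \<in> U \<and> v \<in> V"
      using * by (intro exI[of _ "take m w"] exI[of _ "drop m w"]) (simp add: graph_of_def)
    ultimately show "graph_of {u @ v |u v. u \<in> U \<and> v \<in> V} (\<lambda>w. f (take m w) @ g (drop m w)) w z"
      by (simp add: graph_of_def)
  next
    assume "graph_of {u @ v |u v. u \<in> U \<and> v \<in> V} (\<lambda>w. f (take m w) @ g (drop m w)) w z"
    then show "graph_of U f (take m w) (take m' z) \<and> graph_of V g (drop m w) (drop m' z)"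
      using definable_fun_length[OF f] definable_fun_length[OF g] by (auto simp: graph_of_def)
  qed
  show "defpred S (\<lambda>s. graph_of U f (take m (map s [0..<m + n])) (take m' (map (\<lambda>i. s (i + (m + n))) [0..<m' + n'])) \<and>
     graph_of V g (drop m (map s [0..<m + n])) (drop m' (map (\<lambda>i. s (i + (m + n))) [0..<m' + n'])))"
    by (intro definability defpred_graph[OF f] defpred_graph[OF g])
  show "definable S (m + n) {u @ v |u v. u \<in> U \<and> v \<in> V}"
    using f g by (intro definable_append definable_fun_domain)
qed (auto simp: definable_fun_length[OF f] definable_fun_length[OF g])

lemma bij_betw_append:
  assumes F: "bij_betw F U U'" and G: "bij_betw G V V'"
    and len: "\<And>u. u \<in> U \<Longrightarrow> length u = m" "\<And>u. u \<in> U \<Longrightarrow> length (F u) = m'"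
  shows "bij_betw (\<lambda>w. F (take m w) @ G (drop m w))
    {u @ v |u v. u \<in> U \<and> v \<in> V} {u @ v |u v. u \<in> U' \<and> v \<in> V'}"
proof (rule bij_betw_imageI)
  let ?H = "\<lambda>w. F (take m w) @ G (drop m w)"
  have H: "?H (u @ v) = F u @ G v" if "u \<in> U" for u v
    using len(1)[OF that] by simp
  show "inj_on ?H {u @ v |u v. u \<in> U \<and> v \<in> V}"
  proof (rule inj_onI)
    fix w z assume "w \<in> {u @ v |u v. u \<in> U \<and> v \<in> V}" "z \<in> {u @ v |u v. u \<in> U \<and> v \<in> V}" "?H w = ?H z"
    then obtain u v u' v' where w: "w = u @ v" "u \<in> U" "v \<in> V" and z: "z = u' @ v'" "u' \<in> U" "v' \<in> V"
      and "F u @ G v = F u' @ G v'"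
      using H by auto
    then have "F u = F u'" "G v = G v'" using len(2) by auto
    then show "w = z" using w z F G by (auto simp: bij_betw_def inj_on_def)
  qed
  have FU: "F ` U = U'" "G ` V = V'" using F G by (auto simp: bij_betw_def)
  show "?H ` {u @ v |u v. u \<in> U \<and> v \<in> V} = {u @ v |u v. u \<in> U' \<and> v \<in> V'}"
  proof (intro equalityI subsetI)
    fix y assume "y \<in> ?H ` {u @ v |u v. u \<in> U \<and> v \<in> V}"
    then obtain u v where "y = ?H (u @ v)" "u \<in> U" "v \<in> V" by blast
    then show "y \<in> {u @ v |u v. u \<in> U' \<and> v \<in> V'}" using H FU by auto
  next
    fix y assume "y \<in> {u @ v |u v. u \<in> U' \<and> v \<in> V'}"
    then obtain u v where uv: "u \<in> U" "v \<in> V" "y = F u @ G v" using FU by auto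
    then have "y = ?H (u @ v)" using H by simp
    then show "y \<in> ?H ` {u @ v |u v. u \<in> U \<and> v \<in> V}" using uv by blast
  qed
qed

lemma bij_betw_identity: "bij_betw (\<lambda>v. v) V V"
  by (simp add: bij_betw_def)

section \<open>Isomorphisms of objects\<close>

abbreviation part :: "'a::acvf rv_obj \<Rightarrow> 'a RV list set \<Rightarrow> 'a rv_obj" where
  "part X A \<equiv> X\<lparr>pts := A\<rparr>"

lemma rv_iso_iff:
  "rv_iso S X Y F \<longleftrightarrow> definable_fun S (amb X) (amb Y) (pts X) F \<and> bij_betw F (pts X) (pts Y) \<and>
     (\<forall>u\<in>pts X. lab_equiv S (lab X u) (lab Y (F u)))"
  by (auto simp: rv_iso_def lab_equiv_def)

lemma iso_relI: "X \<in> RV_obj S k \<Longrightarrow> Y \<in> RV_obj S k \<Longrightarrow> rv_iso S X Y F \<Longrightarrow> (X, Y) \<in> iso_rel S k"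
  by (auto simp: iso_rel_def)

lemma RV_obj_part:
  assumes "X \<in> RV_obj S k" "definable S (amb X) A" "A \<subseteq> pts X" shows "part X A \<in> RV_obj S k"
  using assms definable_fun_restrict by (auto simp: RV_obj_def)

lemma RV_obj_pts: "X \<in> RV_obj S k \<Longrightarrow> definable S (amb X) (pts X)"
  by (auto simp: RV_obj_def definable_fun_domain)

lemma rv_iso_inverse:
  assumes "rv_iso S X Y F" shows "rv_iso S Y X (inv_into (pts X) F)"
  unfolding rv_iso_iff
proof (intro conjI ballI)
  have F: "definable_fun S (amb X) (amb Y) (pts X) F" "bij_betw F (pts X) (pts Y)"
    "\<forall>u\<in>pts X. lab_equiv S (lab X u) (lab Y (F u))"
    using assms by (auto simp: rv_iso_iff)
  show "definable_fun S (amb Y) (amb X) (pts Y) (inv_into (pts X) F)"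
    using F by (intro definable_fun_inverse)
  show "bij_betw (inv_into (pts X) F) (pts Y) (pts X)"
    using F(2) by (rule bij_betw_inv_into)
  fix v assume "v \<in> pts Y"
  then have "F (inv_into (pts X) F v) = v" "inv_into (pts X) F v \<in> pts X"
    using F(2) by (auto simp: bij_betw_def f_inv_into_f inv_into_into)
  then show "lab_equiv S (lab Y v) (lab X (inv_into (pts X) F v))"
    using F(3) lab_equiv_sym by metis
qed

lemma rv_iso_comp:
  assumes F: "rv_iso S X Y F" and G: "rv_iso S Y Z G" shows "rv_iso S X Z (\<lambda>u. G (F u))"
  unfolding rv_iso_iff
proof (intro conjI ballI)
  have FY: "F ` pts X = pts Y" using F by (auto simp: rv_iso_iff bij_betw_def)
  show "definable_fun S (amb X) (amb Z) (pts X) (\<lambda>u. G (F u))"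
    using F G FY by (intro definable_fun_comp[of S _ "amb Y" _ F _ "pts Y" G]) (auto simp: rv_iso_iff)
  show "bij_betw (\<lambda>u. G (F u)) (pts X) (pts Z)"
    using F G bij_betw_trans[of F _ _ G] by (auto simp: rv_iso_iff comp_def)
  show "lab_equiv S (lab X u) (lab Z (G (F u)))" if "u \<in> pts X" for u
    using F G FY that lab_equiv_trans[of S "lab X u" "lab Y (F u)"] by (auto simp: rv_iso_iff)
qed

lemma equiv_iso_rel: "equiv (RV_obj S k) (iso_rel S k)"
proof (rule equivI)
  have "rv_iso S X X (\<lambda>u. u)" if "X \<in> RV_obj S k" for X
    using that by (auto simp: rv_iso_iff lab_equiv_refl RV_obj_pts definable_fun_id bij_betw_def)
  then show "refl_on (RV_obj S k) (iso_rel S k)"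
    by (auto simp: refl_on_def iso_rel_def)
  show "iso_rel S k \<subseteq> RV_obj S k \<times> RV_obj S k" by (auto simp: iso_rel_def)
  show "sym (iso_rel S k)"
    unfolding sym_def iso_rel_def by (blast intro: rv_iso_inverse)
  show "trans (iso_rel S k)"
    unfolding trans_def iso_rel_def by (blast intro: rv_iso_comp)
qed

lemma iso_rel_obj: "(X, Y) \<in> iso_rel S k \<Longrightarrow> X \<in> RV_obj S k" "(X, Y) \<in> iso_rel S k \<Longrightarrow> Y \<in> RV_obj S k"
  by (auto simp: iso_rel_def)

lemma iso_class_eq_iff:
  "X \<in> RV_obj S k \<Longrightarrow> Y \<in> RV_obj S k \<Longrightarrow> iso_class S k X = iso_class S k Y \<longleftrightarrow> (X, Y) \<in> iso_rel S k"
  unfolding iso_class_def by (rule eq_equiv_class_iff[OF equiv_iso_rel])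

lemma rv_iso_restrict:
  assumes F: "rv_iso S X Y F" and A: "definable S (amb X) A" "A \<subseteq> pts X"
  shows "rv_iso S (part X A) (part Y (F ` A)) F"
  using assms by (auto simp: rv_iso_iff intro: definable_fun_restrict bij_betw_subset)

lemma iso_rel_glue:
  assumes Z: "Z \<in> RV_obj S k" "definable S (amb Z) A" "A \<subseteq> pts Z"
    and W: "W \<in> RV_obj S k" "definable S (amb W) B" "B \<subseteq> pts W"
    and 1: "(part Z A, part W B) \<in> iso_rel S k"
    and 2: "(part Z (pts Z - A), part W (pts W - B)) \<in> iso_rel S k"
  shows "(Z, W) \<in> iso_rel S k"
proof -
  from 1 2 obtain F G where F: "rv_iso S (part Z A) (part W B) F"
    and G: "rv_iso S (part Z (pts Z - A)) (part W (pts W - B)) G"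
    by (auto simp: iso_rel_def)
  let ?H = "\<lambda>u. if u \<in> A then F u else G u"
  have Z_Un: "pts Z = A \<union> (pts Z - A)" and W_Un: "pts W = B \<union> (pts W - B)"
    using Z(3) W(3) by auto
  have "definable_fun S (amb Z) (amb W) (A \<union> (pts Z - A)) ?H"
    using F G by (intro definable_fun_cases) (auto simp: rv_iso_iff)
  moreover have "bij_betw ?H (A \<union> (pts Z - A)) (B \<union> (pts W - B))"
  proof (rule bij_betw_combine)
    show "bij_betw ?H A B"
      using F by (subst bij_betw_cong[of _ _ F]) (auto simp: rv_iso_iff)
    show "bij_betw ?H (pts Z - A) (pts W - B)"
      using G by (subst bij_betw_cong[of _ _ G]) (auto simp: rv_iso_iff)
  qed auto
  moreover have "lab_equiv S (lab Z u) (lab W (?H u))" if "u \<in> pts Z" for u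
    using F G that by (auto simp: rv_iso_iff)
  ultimately have "rv_iso S Z W ?H"
    unfolding rv_iso_iff using Z_Un W_Un by simp
  then show ?thesis using Z W by (intro iso_relI)
qed

section \<open>Disjoint unions\<close>

definition inl :: "'a::acvf rv_obj \<Rightarrow> 'a rv_obj \<Rightarrow> 'a RV list \<Rightarrow> 'a RV list" where
  "inl X Y u = 1 # u @ replicate (amb Y) 1"

definition inr :: "'a::acvf rv_obj \<Rightarrow> 'a rv_obj \<Rightarrow> 'a RV list \<Rightarrow> 'a RV list" where
  "inr X Y v = \<infinity>\<^sub>r\<^sub>v # replicate (amb X) 1 @ v"

lemma one_neq_inf: "(1 :: 'a::acvf RV) \<noteq> \<infinity>\<^sub>r\<^sub>v"
  by (simp add: rv_eq_inf_iff flip: rv_one)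

lemma inl_neq_inr: "inl X Y u \<noteq> inr X Y v"
  by (simp add: inl_def inr_def one_neq_inf)

lemma inj_inl: "inj_on (inl X Y) A" and inj_inr: "inj_on (inr X Y) B"
  by (auto simp: inj_on_def inl_def inr_def)

lemma pts_disj_union: "pts (disj_union X Y) = inl X Y ` pts X \<union> inr X Y ` pts Y"
  by (auto simp: disj_union_def inl_def inr_def)

lemma amb_disj_union: "amb (disj_union X Y) = 1 + amb X + amb Y"
  by (simp add: disj_union_def)

lemma lab_inl: "length u = amb X \<Longrightarrow> lab (disj_union X Y) (inl X Y u) = lab X u"
  by (simp add: disj_union_def inl_def)

lemma lab_inr: "lab (disj_union X Y) (inr X Y v) = lab Y v"
  using one_neq_inf[where 'a = 'a] by (simp add: disj_union_def inr_def)

lemma definable_fun_inl: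
  assumes "definable S (amb X) U"
  shows "definable_fun S (amb X) (amb (disj_union X Y)) U (inl X Y)"
proof (rule definable_funI[where P = "\<lambda>u v. u \<in> U \<and> v = inl X Y u"])
  show "defpred S (\<lambda>s. map s [0..<amb X] \<in> U \<and>
      map (\<lambda>i. s (i + amb X)) [0..<amb (disj_union X Y)] = inl X Y (map s [0..<amb X]))"
    unfolding inl_def by (intro definability defpred_mem[OF assms])
qed (use assms in \<open>auto simp: graph_of_def inl_def amb_disj_union dest: definable_length\<close>)

lemma definable_fun_inr:
  assumes "definable S (amb Y) V"
  shows "definable_fun S (amb Y) (amb (disj_union X Y)) V (inr X Y)"
proof (rule definable_funI[where P = "\<lambda>u v. u \<in> V \<and> v = inr X Y u"])
  show "defpred S (\<lambda>s. map s [0..<amb Y] \<in> V \<and>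
      map (\<lambda>i. s (i + amb Y)) [0..<amb (disj_union X Y)] = inr X Y (map s [0..<amb Y]))"
    unfolding inr_def by (intro definability defpred_mem[OF assms])
qed (use assms in \<open>auto simp: graph_of_def inr_def amb_disj_union dest: definable_length\<close>)

lemma RV_obj_disj_union:
  assumes X: "X \<in> RV_obj S k" and Y: "Y \<in> RV_obj S k"
  shows "disj_union X Y \<in> RV_obj S k"
proof -
  let ?Z = "disj_union X Y"
  let ?U = "inl X Y ` pts X" and ?V = "inr X Y ` pts Y"
  have lX: "definable_fun S (amb X) k (pts X) (lab X)" and lY: "definable_fun S (amb Y) k (pts Y) (lab Y)"
    using X Y by (auto simp: RV_obj_def)
  note dl = definable_fun_inl[OF RV_obj_pts[OF X], of Y]
  note dr = definable_fun_inr[OF RV_obj_pts[OF Y], of X]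
  have "definable_fun S (amb ?Z) k (?U \<union> ?V)
      (\<lambda>w. if w \<in> ?U then lab X (inv_into (pts X) (inl X Y) w) else lab Y (inv_into (pts Y) (inr X Y) w))"
  proof (rule definable_fun_cases)
    show "definable_fun S (amb ?Z) k ?U (\<lambda>w. lab X (inv_into (pts X) (inl X Y) w))"
      by (rule definable_fun_comp[OF definable_fun_inverse[OF dl] lX])
        (auto simp: inj_inl intro: inj_on_imp_bij_betw)
    show "definable_fun S (amb ?Z) k ?V (\<lambda>w. lab Y (inv_into (pts Y) (inr X Y) w))"
      by (rule definable_fun_comp[OF definable_fun_inverse[OF dr] lY])
        (auto simp: inj_inr intro: inj_on_imp_bij_betw)
  qed (auto simp: inl_neq_inr)
  then have "definable_fun S (amb ?Z) k (?U \<union> ?V) (lab ?Z)"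
  proof (rule definable_fun_cong)
    fix w assume "w \<in> ?U \<union> ?V"
    then show "lab ?Z w = (if w \<in> ?U then lab X (inv_into (pts X) (inl X Y) w)
        else lab Y (inv_into (pts Y) (inr X Y) w))"
      using definable_fun_length(1)[OF lX]
      by (auto simp: lab_inl lab_inr inj_inl inj_inr inl_neq_inr[symmetric])
  qed
  then show ?thesis by (simp add: RV_obj_def pts_disj_union)
qed

lemma iso_inl:
  assumes X: "X \<in> RV_obj S k" and Y: "Y \<in> RV_obj S k"
  shows "(X, part (disj_union X Y) (inl X Y ` pts X)) \<in> iso_rel S k"
proof (rule iso_relI[OF X])
  have U: "definable S (amb (disj_union X Y)) (inl X Y ` pts X)"
    using definable_image definable_fun_inl RV_obj_pts[OF X] by blast
  show "part (disj_union X Y) (inl X Y ` pts X) \<in> RV_obj S k"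
    by (intro RV_obj_part RV_obj_disj_union X Y U) (simp add: pts_disj_union)
  show "rv_iso S X (part (disj_union X Y) (inl X Y ` pts X)) (inl X Y)"
    using RV_obj_pts[OF X]
    by (auto simp: rv_iso_iff lab_inl lab_equiv_refl inj_inl definable_length
      intro: definable_fun_inl inj_on_imp_bij_betw)
qed

lemma iso_inr:
  assumes X: "X \<in> RV_obj S k" and Y: "Y \<in> RV_obj S k"
  shows "(Y, part (disj_union X Y) (inr X Y ` pts Y)) \<in> iso_rel S k"
proof (rule iso_relI[OF Y])
  have U: "definable S (amb (disj_union X Y)) (inr X Y ` pts Y)"
    using definable_image definable_fun_inr RV_obj_pts[OF Y] by blast
  show "part (disj_union X Y) (inr X Y ` pts Y) \<in> RV_obj S k"
    by (intro RV_obj_part RV_obj_disj_union X Y U) (simp add: pts_disj_union)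
  show "rv_iso S Y (part (disj_union X Y) (inr X Y ` pts Y)) (inr X Y)"
    using RV_obj_pts[OF Y]
    by (auto simp: rv_iso_iff lab_inr lab_equiv_refl inj_inr
      intro: definable_fun_inr inj_on_imp_bij_betw)
qed

text \<open>
  This replaces the concrete coding of disjoint unions by definable decompositions, which are all
  that is used about them afterwards.
\<close>
lemma iso_disj_union_iff:
  assumes X: "X \<in> RV_obj S k" and Y: "Y \<in> RV_obj S k" and Z: "Z \<in> RV_obj S k"
  shows "(Z, disj_union X Y) \<in> iso_rel S k \<longleftrightarrow>
    (\<exists>A. definable S (amb Z) A \<and> A \<subseteq> pts Z \<and> (part Z A, X) \<in> iso_rel S k \<and>
         (part Z (pts Z - A), Y) \<in> iso_rel S k)"
proof -
  let ?W = "disj_union X Y"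
  let ?B = "inl X Y ` pts X"
  note W = RV_obj_disj_union[OF X Y]
  have B: "definable S (amb ?W) ?B" "?B \<subseteq> pts ?W"
    using definable_image definable_fun_inl RV_obj_pts[OF X] by (blast, simp add: pts_disj_union)
  have rest: "pts ?W - ?B = inr X Y ` pts Y"
    by (auto simp: pts_disj_union inl_neq_inr inl_neq_inr[symmetric])
  have iso: "(X, part ?W ?B) \<in> iso_rel S k" "(Y, part ?W (pts ?W - ?B)) \<in> iso_rel S k"
    unfolding rest by (rule iso_inl[OF X Y], rule iso_inr[OF X Y])
  have sym: "(b, a) \<in> iso_rel S k" if "(a, b) \<in> iso_rel S k" for a b
    using that equiv_iso_rel[of S k] by (metis equiv_def symD)
  have trans: "(a, c) \<in> iso_rel S k" if "(a, b) \<in> iso_rel S k" "(b, c) \<in> iso_rel S k" for a b c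
    using that equiv_iso_rel[of S k] by (metis equiv_def transD)
  show ?thesis
  proof
    assume "(Z, ?W) \<in> iso_rel S k"
    then obtain F where F: "rv_iso S ?W Z F" by (auto simp: iso_rel_def dest: rv_iso_inverse)
    then have Fd: "definable_fun S (amb ?W) (amb Z) (pts ?W) F" and Fb: "bij_betw F (pts ?W) (pts Z)"
      by (auto simp: rv_iso_iff)
    let ?A = "F ` ?B"
    have A: "definable S (amb Z) ?A" "?A \<subseteq> pts Z"
      using definable_image[OF definable_fun_restrict[OF Fd B]] Fb B by (auto simp: bij_betw_def)
    have rest: "pts Z - ?A = F ` (pts ?W - ?B)"
      using Fb B(2) inj_on_image_set_diff[of F "pts ?W" "pts ?W" ?B] by (simp add: bij_betw_def)
    have dB: "definable S (amb ?W) (pts ?W - ?B)"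
      by (intro definable_Diff RV_obj_pts[OF W] B)
    have "rv_iso S (part ?W ?B) (part Z ?A) F" using F B by (rule rv_iso_restrict)
    then have "(part ?W ?B, part Z ?A) \<in> iso_rel S k"
      using W Z A B by (intro iso_relI RV_obj_part)
    moreover have "rv_iso S (part ?W (pts ?W - ?B)) (part Z (pts Z - ?A)) F"
      unfolding rest using F dB by (rule rv_iso_restrict) auto
    then have "(part ?W (pts ?W - ?B), part Z (pts Z - ?A)) \<in> iso_rel S k"
      using W Z A B(1) dB by (intro iso_relI RV_obj_part definable_Diff RV_obj_pts) auto
    ultimately show "\<exists>A. definable S (amb Z) A \<and> A \<subseteq> pts Z \<and> (part Z A, X) \<in> iso_rel S k \<and>
         (part Z (pts Z - A), Y) \<in> iso_rel S k"
      using A trans[OF sym sym[OF iso(1)]] trans[OF sym sym[OF iso(2)]] by blast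
  next
    assume "\<exists>A. definable S (amb Z) A \<and> A \<subseteq> pts Z \<and> (part Z A, X) \<in> iso_rel S k \<and>
         (part Z (pts Z - A), Y) \<in> iso_rel S k"
    then obtain A where A: "definable S (amb Z) A" "A \<subseteq> pts Z"
      "(part Z A, X) \<in> iso_rel S k" "(part Z (pts Z - A), Y) \<in> iso_rel S k"
      by blast
    from Z A(1,2) W B trans[OF A(3) iso(1)] trans[OF A(4) iso(2)] show "(Z, ?W) \<in> iso_rel S k"
      by (rule iso_rel_glue)
  qed
qed

section \<open>Isomorphism classes form a refinement semigroup\<close>

lemma iso_rel_trans: "(X, Y) \<in> iso_rel S k \<Longrightarrow> (Y, Z) \<in> iso_rel S k \<Longrightarrow> (X, Z) \<in> iso_rel S k"
  using equiv_iso_rel[of S k] by (metis equiv_def transD)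

lemma iso_rel_refl: "X \<in> RV_obj S k \<Longrightarrow> (X, X) \<in> iso_rel S k"
  using equiv_iso_rel[of S k] by (metis equiv_def refl_onD)

lemma iso_class_in_KRV: "X \<in> RV_obj S k \<Longrightarrow> iso_class S k X \<in> KRV S k"
  by (simp add: iso_class_def KRV_def quotientI)

lemma KRV_cases:
  assumes "a \<in> KRV S k" obtains X where "X \<in> RV_obj S k" "a = iso_class S k X"
  using assms by (auto simp: KRV_def iso_class_def quotient_def)

lemma iso_rel_disj_union:
  assumes "(X, X') \<in> iso_rel S k" "(Y, Y') \<in> iso_rel S k"
  shows "(disj_union X Y, disj_union X' Y') \<in> iso_rel S k"
proof -
  note o = iso_rel_obj[OF assms(1)] iso_rel_obj[OF assms(2)]
  note U = RV_obj_disj_union[OF o(1,3)]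
  show ?thesis
    using iso_rel_refl[OF U] assms iso_rel_trans
    unfolding iso_disj_union_iff[OF o(1,3) U] iso_disj_union_iff[OF o(2,4) U] by blast
qed

text \<open>Operations on representatives that respect isomorphism have the expected values on classes.\<close>
lemma UN_iso_class:
  assumes "X \<in> RV_obj S i" "Y \<in> RV_obj S j"
    and "\<And>X' Y'. (X, X') \<in> iso_rel S i \<Longrightarrow> (Y, Y') \<in> iso_rel S j \<Longrightarrow> (f X Y, f X' Y') \<in> iso_rel S k"
  shows "(\<Union>X'\<in>iso_class S i X. \<Union>Y'\<in>iso_class S j Y. iso_class S k (f X' Y')) = iso_class S k (f X Y)"
proof -
  have "iso_class S k (f X' Y') = iso_class S k (f X Y)"
    if "X' \<in> iso_class S i X" "Y' \<in> iso_class S j Y" for X' Y'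
    using that assms(3)[of X' Y'] equiv_class_eq[OF equiv_iso_rel] unfolding iso_class_def
    by (metis Image_singleton_iff)
  moreover have "X \<in> iso_class S i X" "Y \<in> iso_class S j Y"
    using assms iso_rel_refl by (auto simp: iso_class_def)
  ultimately show ?thesis by blast
qed

lemma KRV_add_class:
  assumes "X \<in> RV_obj S k" "Y \<in> RV_obj S k"
  shows "KRV_add S k (iso_class S k X) (iso_class S k Y) = iso_class S k (disj_union X Y)"
  unfolding KRV_add_def using assms iso_rel_disj_union by (intro UN_iso_class)

lemma iso_class_split:
  assumes Z: "Z \<in> RV_obj S k" and A: "definable S (amb Z) A" "A \<subseteq> pts Z"
  shows "iso_class S k Z = KRV_add S k (iso_class S k (part Z A)) (iso_class S k (part Z (pts Z - A)))"
proof -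
  have o: "part Z A \<in> RV_obj S k" "part Z (pts Z - A) \<in> RV_obj S k"
    using Z A by (auto intro!: RV_obj_part definable_Diff RV_obj_pts)
  have "(Z, disj_union (part Z A) (part Z (pts Z - A))) \<in> iso_rel S k"
    unfolding iso_disj_union_iff[OF o Z] using A o by (blast intro: iso_rel_refl)
  then show ?thesis
    using o Z by (simp add: KRV_add_class iso_class_eq_iff RV_obj_disj_union)
qed

lemma iso_class_eq_addE:
  assumes Z: "Z \<in> RV_obj S k" and a: "a \<in> KRV S k" and b: "b \<in> KRV S k"
    and eq: "iso_class S k Z = KRV_add S k a b"
  obtains A where "definable S (amb Z) A" "A \<subseteq> pts Z"
    "iso_class S k (part Z A) = a" "iso_class S k (part Z (pts Z - A)) = b"
proof -
  obtain X Y where X: "X \<in> RV_obj S k" "a = iso_class S k X" and Y: "Y \<in> RV_obj S k" "b = iso_class S k Y"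
    using a b by (metis KRV_cases)
  have "(Z, disj_union X Y) \<in> iso_rel S k"
    using eq X Y Z by (simp add: KRV_add_class iso_class_eq_iff RV_obj_disj_union)
  then obtain A where "definable S (amb Z) A" "A \<subseteq> pts Z" "(part Z A, X) \<in> iso_rel S k"
    "(part Z (pts Z - A), Y) \<in> iso_rel S k"
    unfolding iso_disj_union_iff[OF X(1) Y(1) Z] by blast
  then show thesis using that X Y iso_rel_obj iso_class_eq_iff by metis
qed

lemma KRV_add_closed: "a \<in> KRV S k \<Longrightarrow> b \<in> KRV S k \<Longrightarrow> KRV_add S k a b \<in> KRV S k"
  by (metis KRV_cases KRV_add_class RV_obj_disj_union iso_class_in_KRV)

lemma KRV_addE:
  assumes "a \<in> KRV S k" "b \<in> KRV S k"
  obtains Z A where "Z \<in> RV_obj S k" "KRV_add S k a b = iso_class S k Z"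
    "definable S (amb Z) A" "A \<subseteq> pts Z"
    "iso_class S k (part Z A) = a" "iso_class S k (part Z (pts Z - A)) = b"
  using KRV_cases[OF KRV_add_closed[OF assms]] iso_class_eq_addE[OF _ assms] by metis

text \<open>
  Commutativity, associativity and refinement of the sum are read off from definable subsets of a
  single representative, by complements, by nested subsets, and by common refinements of two
  decompositions.
\<close>
lemma KRV_add_commute:
  assumes "a \<in> KRV S k" "b \<in> KRV S k" shows "KRV_add S k a b = KRV_add S k b a"
proof -
  obtain Z A where Z: "Z \<in> RV_obj S k" "KRV_add S k a b = iso_class S k Z"
    "definable S (amb Z) A" "A \<subseteq> pts Z"
    "iso_class S k (part Z A) = a" "iso_class S k (part Z (pts Z - A)) = b"
    using assms by (rule KRV_addE)
  have "pts Z - (pts Z - A) = A" using Z(4) by auto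
  then show ?thesis
    using iso_class_split[OF Z(1), of "pts Z - A"] Z definable_Diff[OF RV_obj_pts[OF Z(1)] Z(3)] by auto
qed

lemma KRV_add_assoc:
  assumes a: "a \<in> KRV S k" and b: "b \<in> KRV S k" and c: "c \<in> KRV S k"
  shows "KRV_add S k (KRV_add S k a b) c = KRV_add S k a (KRV_add S k b c)"
proof -
  obtain Z A where Z: "Z \<in> RV_obj S k" "KRV_add S k (KRV_add S k a b) c = iso_class S k Z"
    and A: "definable S (amb Z) A" "A \<subseteq> pts Z"
    "iso_class S k (part Z A) = KRV_add S k a b" "iso_class S k (part Z (pts Z - A)) = c"
    using KRV_addE[OF KRV_add_closed[OF a b] c] by metis
  have ZA: "part Z A \<in> RV_obj S k" using Z(1) A by (intro RV_obj_part)
  obtain B where B: "definable S (amb Z) B" "B \<subseteq> A"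
    "iso_class S k (part Z B) = a" "iso_class S k (part Z (A - B)) = b"
    using iso_class_eq_addE[OF ZA a b A(3)] by auto
  have ZB: "definable S (amb Z) (pts Z - B)" using B Z by (intro definable_Diff RV_obj_pts)
  have "part Z (pts Z - B) \<in> RV_obj S k" using ZB Z by (intro RV_obj_part) auto
  from iso_class_split[OF this, of "A - B"]
  have "iso_class S k (part Z (pts Z - B)) =
    KRV_add S k (iso_class S k (part Z (A - B))) (iso_class S k (part Z (pts Z - B - (A - B))))"
    using A B by (auto intro: definable_Diff)
  moreover have "pts Z - B - (A - B) = pts Z - A" using B(2) by auto
  ultimately show ?thesis
    using iso_class_split[OF Z(1) B(1)] A B Z by auto
qed

lemma KRV_refinement:
  assumes abcd: "a \<in> KRV S k" "b \<in> KRV S k" "c \<in> KRV S k" "d \<in> KRV S k"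
    and eq: "KRV_add S k a b = KRV_add S k c d"
  shows "\<exists>p\<in>KRV S k. \<exists>q\<in>KRV S k. \<exists>r\<in>KRV S k. \<exists>t\<in>KRV S k.
    a = KRV_add S k p q \<and> b = KRV_add S k r t \<and> c = KRV_add S k p r \<and> d = KRV_add S k q t"
proof -
  obtain Z A where Z: "Z \<in> RV_obj S k" "KRV_add S k a b = iso_class S k Z"
    and A: "definable S (amb Z) A" "A \<subseteq> pts Z"
    "iso_class S k (part Z A) = a" "iso_class S k (part Z (pts Z - A)) = b"
    using abcd(1,2) by (rule KRV_addE)
  obtain C where C: "definable S (amb Z) C" "C \<subseteq> pts Z"
    "iso_class S k (part Z C) = c" "iso_class S k (part Z (pts Z - C)) = d"
    using iso_class_eq_addE[OF Z(1) abcd(3,4)] Z(2) eq by metis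
  note dZ = RV_obj_pts[OF Z(1)]
  let ?c = "\<lambda>B. iso_class S k (part Z B)"
  have KRV: "?c B \<in> KRV S k" if "definable S (amb Z) B" "B \<subseteq> pts Z" for B
    using that Z(1) by (intro iso_class_in_KRV RV_obj_part)
  have split: "?c B = KRV_add S k (?c (B \<inter> D)) (?c (B - D))"
    if "definable S (amb Z) B" "B \<subseteq> pts Z" "definable S (amb Z) D" for B D
  proof -
    have o: "part Z B \<in> RV_obj S k" using that Z(1) by (intro RV_obj_part)
    have "B - B \<inter> D = B - D" by auto
    then show ?thesis
      using iso_class_split[OF o, of "B \<inter> D"] definable_Int[OF that(1,3)] by simp
  qed
  have rest: "(pts Z - A) \<inter> C = C - A" "(pts Z - C) \<inter> A = A - C" "pts Z - C - A = pts Z - A - C"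
    using A(2) C(2) by auto
  have "a = KRV_add S k (?c (A \<inter> C)) (?c (A - C))" using split[of A C] A C by simp
  moreover have "b = KRV_add S k (?c (C - A)) (?c (pts Z - A - C))"
    using split[OF definable_Diff[OF dZ A(1)] _ C(1)] A(4) rest(1) by simp
  moreover have "c = KRV_add S k (?c (A \<inter> C)) (?c (C - A))"
    using split[of C A] A C by (simp add: Int_commute)
  moreover have "d = KRV_add S k (?c (A - C)) (?c (pts Z - A - C))"
    using split[OF definable_Diff[OF dZ C(1)] _ A(1)] C(4) rest(2,3) by simp
  moreover have "?c (A \<inter> C) \<in> KRV S k" "?c (A - C) \<in> KRV S k" "?c (C - A) \<in> KRV S k"
    "?c (pts Z - A - C) \<in> KRV S k"
    using A C dZ by (auto intro!: KRV definable_Int definable_Diff)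
  ultimately show ?thesis by blast
qed

section \<open>Elementary blowups\<close>

lemma definable_RV_gt1: "definable S 1 ((\<lambda>x. [x]) ` RV_gt1)"
proof (rule definableI[where P = "\<lambda>w. w ! 0 \<in> RV_gt1"])
  show "w \<in> (\<lambda>x. [x]) ` RV_gt1 \<longleftrightarrow> w ! 0 \<in> RV_gt1" if "length w = 1" for w :: "'a RV list"
    using that by (cases w) auto
  show "defpred S (\<lambda>s. map s [0..<1] ! 0 \<in> RV_gt1)"
    by (auto intro!: defpred_RV_gt1 definability)
qed auto

lemma amb_elem_blowup: "amb (elem_blowup j X) = amb X + 1"
  by (simp add: elem_blowup_def)

lemma pts_elem_blowup: "pts (elem_blowup j X) = {t @ v |t v. t \<in> pts X \<and> v \<in> (\<lambda>x. [x]) ` RV_gt1}"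
  by (auto simp: elem_blowup_def)

lemma lab_elem_blowup:
  "length t = amb X \<Longrightarrow> lab (elem_blowup j X) (t @ [x]) = (lab X t)[j := x * lab X t ! j]"
  by (simp add: elem_blowup_def Let_def nth_append)

lemma blowup_coord_iff:
  assumes "X \<in> RV_obj S k"
  shows "blowup_coord S k j X \<longleftrightarrow> j < k \<and> (\<forall>t\<in>pts X. dep_coord S j (lab X t))"
proof -
  have "length (lab X t) = k" if "t \<in> pts X" for t
    using assms that by (auto simp: RV_obj_def definable_fun_length)
  then show ?thesis by (auto simp: blowup_coord_def dep_coord_def)
qed

lemma RV_obj_elem_blowup:
  assumes X: "X \<in> RV_obj S k" and j: "j < k" shows "elem_blowup j X \<in> RV_obj S k"
proof -
  have l: "definable_fun S (amb X) k (pts X) (lab X)" using X by (simp add: RV_obj_def)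
  let ?E = "elem_blowup j X"
  let ?P = "\<lambda>w v. w ! amb X \<in> RV_gt1 \<and> (\<exists>z. length z = k \<and> graph_of (pts X) (lab X) (take (amb X) w) z \<and>
      v = z[j := w ! amb X * z ! j])"
  have "definable_fun S (amb X + 1) k (pts ?E) (lab ?E)"
  proof (rule definable_funI[where P = ?P])
    show "definable S (amb X + 1) (pts ?E)"
      unfolding pts_elem_blowup by (intro definable_append definable_RV_gt1 RV_obj_pts[OF X])
    show "length (lab ?E w) = k" if "w \<in> pts ?E" for w
      using that definable_fun_length[OF l] by (auto simp: pts_elem_blowup lab_elem_blowup)
    show "graph_of (pts ?E) (lab ?E) w v \<longleftrightarrow> ?P w v" if wl: "length w = amb X + 1" for w v
    proof -
      obtain t x where w: "w = t @ [x]" using wl by (cases w rule: rev_cases) auto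
      then have t: "length t = amb X" using wl by simp
      then have "w \<in> pts ?E \<longleftrightarrow> t \<in> pts X \<and> x \<in> RV_gt1" by (auto simp: w pts_elem_blowup)
      then show ?thesis
        using t definable_fun_length[OF l] by (auto simp: graph_of_def w lab_elem_blowup nth_append)
    qed
    show "defpred S (\<lambda>s. ?P (map s [0..<amb X + 1]) (map (\<lambda>i. s (i + (amb X + 1))) [0..<k]))"
      using j by (intro definability defpred_graph[OF l] defpred_RV_gt1 defterm_nth) auto
  qed
  then show ?thesis by (simp add: RV_obj_def amb_elem_blowup)
qed

text \<open>
  The isomorphism is extended by the identity on the new coordinate of the points; that the two
  coordinates \<open>j\<close> and \<open>l\<close> may differ is the content of \<open>lab_equiv_scale\<close>.
\<close>
lemma iso_rel_elem_blowup:
  assumes iso: "(X, Y) \<in> iso_rel S k" and j: "blowup_coord S k j X" and l: "blowup_coord S k l Y"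
  shows "(elem_blowup j X, elem_blowup l Y) \<in> iso_rel S k"
proof -
  note o = iso_rel_obj[OF iso]
  from iso obtain F where F: "definable_fun S (amb X) (amb Y) (pts X) F" "bij_betw F (pts X) (pts Y)"
    "\<forall>u\<in>pts X. lab_equiv S (lab X u) (lab Y (F u))"
    by (auto simp: iso_rel_def rv_iso_iff)
  let ?G = "\<lambda>w. F (take (amb X) w) @ drop (amb X) w"
  have len: "length t = amb X" "length (F t) = amb Y" if "t \<in> pts X" for t
    using definable_fun_length[OF F(1)] that by auto
  have "definable_fun S (amb (elem_blowup j X)) (amb (elem_blowup l Y)) (pts (elem_blowup j X)) ?G"
    unfolding amb_elem_blowup pts_elem_blowup
    by (intro definable_fun_append definable_fun_id definable_RV_gt1 F)
  moreover have "bij_betw ?G (pts (elem_blowup j X)) (pts (elem_blowup l Y))"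
    unfolding pts_elem_blowup using len by (intro bij_betw_append F bij_betw_identity) auto
  moreover have "lab_equiv S (lab (elem_blowup j X) w) (lab (elem_blowup l Y) (?G w))"
    if w: "w \<in> pts (elem_blowup j X)" for w
  proof -
    from w obtain t x where t: "w = t @ [x]" "t \<in> pts X" by (auto simp: pts_elem_blowup)
    have "F t \<in> pts Y" using F(2) t(2) by (auto simp: bij_betw_def)
    then show ?thesis
      using t len F(3) j l unfolding blowup_coord_iff[OF o(1)] blowup_coord_iff[OF o(2)]
      by (auto simp: lab_elem_blowup intro!: lab_equiv_scale)
  qed
  ultimately have "rv_iso S (elem_blowup j X) (elem_blowup l Y) ?G"
    by (simp add: rv_iso_iff)
  then show ?thesis
    using o j l by (intro iso_relI RV_obj_elem_blowup) (auto simp: blowup_coord_def)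
qed

lemma elem_blowup_part:
  "elem_blowup j (part X A) = part (elem_blowup j X) {t @ v |t v. t \<in> A \<and> v \<in> (\<lambda>x. [x]) ` RV_gt1}"
  by (auto simp: elem_blowup_def)

lemma append_singletons: "{t @ v |t v. t \<in> A \<and> v \<in> (\<lambda>x. [x]) ` R} = (\<lambda>(t, x). t @ [x]) ` (A \<times> R)"
  by (auto simp: image_iff)

text \<open>
  The elementary blowup as a partial function on isomorphism classes; it is defined for the classes
  that contain an object with a dependent coordinate.
\<close>
definition eb_class :: "('a + 'a RV) set \<Rightarrow> nat \<Rightarrow> 'a::acvf rv_obj set \<Rightarrow> 'a rv_obj set \<Rightarrow> bool" where
  "eb_class S k a b \<longleftrightarrow> (\<exists>X j. X \<in> RV_obj S k \<and> blowup_coord S k j X \<and>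
     a = iso_class S k X \<and> b = iso_class S k (elem_blowup j X))"

lemma eb_class_closed: "eb_class S k a b \<Longrightarrow> a \<in> KRV S k \<and> b \<in> KRV S k"
  by (auto simp: eb_class_def blowup_coord_def intro!: iso_class_in_KRV RV_obj_elem_blowup)

lemma eb_class_unique: "eb_class S k a b \<Longrightarrow> eb_class S k a b' \<Longrightarrow> b = b'"
  unfolding eb_class_def using iso_rel_elem_blowup iso_class_eq_iff iso_rel_obj by metis

lemma eb_class_add:
  assumes a: "a \<in> KRV S k" and b: "b \<in> KRV S k" and e: "eb_class S k (KRV_add S k a b) e"
  shows "\<exists>a' b'. eb_class S k a a' \<and> eb_class S k b b' \<and> e = KRV_add S k a' b'"
proof -
  from e obtain X j where X: "X \<in> RV_obj S k" "blowup_coord S k j X"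
    "iso_class S k X = KRV_add S k a b" "e = iso_class S k (elem_blowup j X)"
    by (auto simp: eb_class_def)
  obtain A where A: "definable S (amb X) A" "A \<subseteq> pts X"
    "iso_class S k (part X A) = a" "iso_class S k (part X (pts X - A)) = b"
    using iso_class_eq_addE[OF X(1) a b X(3)] by blast
  let ?E = "elem_blowup j X"
  let ?A = "{t @ v |t v. t \<in> A \<and> v \<in> (\<lambda>x. [x]) ` RV_gt1}"
  have "blowup_coord S k j (part X B)" if "B \<subseteq> pts X" for B
    using X(2) that by (auto simp: blowup_coord_def)
  then have "eb_class S k a (iso_class S k (elem_blowup j (part X A)))"
    "eb_class S k b (iso_class S k (elem_blowup j (part X (pts X - A))))"
    unfolding eb_class_def using A X(1) by (blast intro: RV_obj_part definable_Diff RV_obj_pts)+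
  moreover have "e = KRV_add S k (iso_class S k (elem_blowup j (part X A)))
     (iso_class S k (elem_blowup j (part X (pts X - A))))"
  proof -
    have "pts ?E - ?A = {t @ v |t v. t \<in> pts X - A \<and> v \<in> (\<lambda>x. [x]) ` RV_gt1}"
      unfolding pts_elem_blowup append_singletons by auto
    moreover have "definable S (amb ?E) ?A"
      unfolding amb_elem_blowup by (intro definable_append A definable_RV_gt1)
    moreover have "?A \<subseteq> pts ?E" using A(2) by (auto simp: pts_elem_blowup)
    moreover have "?E \<in> RV_obj S k" using X by (intro RV_obj_elem_blowup) (auto simp: blowup_coord_def)
    ultimately show ?thesis
      using iso_class_split[of ?E S k ?A] X(4) by (simp add: elem_blowup_part)
  qed
  ultimately show ?thesis by blast
qed

interpretation KRV: blowup_monoid "KRV S k" "KRV_add S k" "eb_class S k" for S k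
  using KRV_add_closed KRV_add_assoc KRV_add_commute KRV_refinement eb_class_closed eb_class_unique
    eb_class_add
  by unfold_locales

section \<open>Products\<close>

lemma amb_obj_prod: "amb (obj_prod X Y) = amb X + amb Y"
  by (simp add: obj_prod_def)

lemma pts_obj_prod: "pts (obj_prod X Y) = {u @ v |u v. u \<in> pts X \<and> v \<in> pts Y}"
  by (simp add: obj_prod_def)

lemma lab_obj_prod: "length u = amb X \<Longrightarrow> lab (obj_prod X Y) (u @ v) = lab X u @ lab Y v"
  by (simp add: obj_prod_def)

lemma length_pts: "X \<in> RV_obj S k \<Longrightarrow> u \<in> pts X \<Longrightarrow> length u = amb X"
  by (auto simp: RV_obj_def definable_fun_length)

lemma length_lab: "X \<in> RV_obj S k \<Longrightarrow> u \<in> pts X \<Longrightarrow> length (lab X u) = k"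
  by (auto simp: RV_obj_def definable_fun_length)

lemma RV_obj_prod:
  assumes "X \<in> RV_obj S i" "Y \<in> RV_obj S j" shows "obj_prod X Y \<in> RV_obj S (i + j)"
  using definable_fun_append[of S "amb X" i "pts X" "lab X" "amb Y" j "pts Y" "lab Y"] assms
  by (simp add: RV_obj_def obj_prod_def)

lemma iso_rel_obj_prod:
  assumes X: "(X, X') \<in> iso_rel S i" and Y: "(Y, Y') \<in> iso_rel S j"
  shows "(obj_prod X Y, obj_prod X' Y') \<in> iso_rel S (i + j)"
proof -
  note o = iso_rel_obj[OF X] iso_rel_obj[OF Y]
  from X obtain F where F: "definable_fun S (amb X) (amb X') (pts X) F" "bij_betw F (pts X) (pts X')"
    "\<forall>u\<in>pts X. lab_equiv S (lab X u) (lab X' (F u))"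
    by (auto simp: iso_rel_def rv_iso_iff)
  from Y obtain G where G: "definable_fun S (amb Y) (amb Y') (pts Y) G" "bij_betw G (pts Y) (pts Y')"
    "\<forall>u\<in>pts Y. lab_equiv S (lab Y u) (lab Y' (G u))"
    by (auto simp: iso_rel_def rv_iso_iff)
  let ?H = "\<lambda>w. F (take (amb X) w) @ G (drop (amb X) w)"
  have "definable_fun S (amb (obj_prod X Y)) (amb (obj_prod X' Y')) (pts (obj_prod X Y)) ?H"
    unfolding amb_obj_prod pts_obj_prod using F(1) G(1) by (rule definable_fun_append)
  moreover have "bij_betw ?H (pts (obj_prod X Y)) (pts (obj_prod X' Y'))"
    unfolding pts_obj_prod using definable_fun_length[OF F(1)] by (intro bij_betw_append F G)
  moreover have "lab_equiv S (lab (obj_prod X Y) w) (lab (obj_prod X' Y') (?H w))"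
    if "w \<in> pts (obj_prod X Y)" for w
    using that F(3) G(3) definable_fun_length[OF F(1)]
    by (auto simp: pts_obj_prod lab_obj_prod intro!: lab_equiv_append)
  ultimately have "rv_iso S (obj_prod X Y) (obj_prod X' Y') ?H" by (simp add: rv_iso_iff)
  then show ?thesis using o by (intro iso_relI RV_obj_prod)
qed

lemma iso_rel_obj_prod_commute:
  assumes X: "X \<in> RV_obj S i" and Y: "Y \<in> RV_obj S j"
  shows "(obj_prod X Y, obj_prod Y X) \<in> iso_rel S (i + j)"
proof -
  let ?F = "\<lambda>w. drop (amb X) w @ take (amb X) w"
  let ?U = "pts (obj_prod X Y)"
  have XY: "obj_prod X Y \<in> RV_obj S (i + j)" "obj_prod Y X \<in> RV_obj S (i + j)"
    using RV_obj_prod[OF X Y] RV_obj_prod[OF Y X] by (auto simp: add.commute)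
  note U = RV_obj_pts[OF XY(1)]
  have "definable_fun S (amb (obj_prod X Y)) (amb (obj_prod Y X)) ?U ?F"
  proof (rule definable_funI[where P = "\<lambda>w v. w \<in> ?U \<and> v = ?F w"])
    show "defpred S (\<lambda>s. map s [0..<amb (obj_prod X Y)] \<in> ?U \<and>
        map (\<lambda>i. s (i + amb (obj_prod X Y))) [0..<amb (obj_prod Y X)] = ?F (map s [0..<amb (obj_prod X Y)]))"
      by (intro definability defpred_mem[OF U])
    show "length (?F w) = amb (obj_prod Y X)" if "w \<in> ?U" for w
      using length_pts[OF XY(1) that] by (simp add: amb_obj_prod)
  qed (use U in \<open>auto simp: graph_of_def\<close>)
  moreover have "bij_betw ?F ?U (pts (obj_prod Y X))"
  proof (rule bij_betw_byWitness[where f' = "\<lambda>w. drop (amb Y) w @ take (amb Y) w"])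
    show "?F ` ?U \<subseteq> pts (obj_prod Y X)" "(\<lambda>w. drop (amb Y) w @ take (amb Y) w) ` pts (obj_prod Y X) \<subseteq> ?U"
      using length_pts[OF X] length_pts[OF Y] by (auto simp: pts_obj_prod) blast+
  qed (use length_pts[OF X] length_pts[OF Y] in \<open>auto simp: pts_obj_prod\<close>)
  moreover have "lab_equiv S (lab (obj_prod X Y) w) (lab (obj_prod Y X) (?F w))" if "w \<in> ?U" for w
    using that length_pts[OF X] length_pts[OF Y]
    by (auto simp: pts_obj_prod lab_obj_prod intro: lab_equiv_append_commute)
  ultimately have "rv_iso S (obj_prod X Y) (obj_prod Y X) ?F" by (simp add: rv_iso_iff)
  then show ?thesis using XY by (intro iso_relI)
qed

lemma obj_prod_part: "obj_prod (part X A) Y = part (obj_prod X Y) {u @ v |u v. u \<in> A \<and> v \<in> pts Y}"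
  by (simp add: obj_prod_def)

lemma KRV_mult_class:
  assumes "X \<in> RV_obj S i" "Y \<in> RV_obj S j"
  shows "KRV_mult S i j (iso_class S i X) (iso_class S j Y) = iso_class S (i + j) (obj_prod X Y)"
  unfolding KRV_mult_def using assms iso_rel_obj_prod by (intro UN_iso_class)

lemma KRV_mult_closed: "a \<in> KRV S i \<Longrightarrow> b \<in> KRV S j \<Longrightarrow> KRV_mult S i j a b \<in> KRV S (i + j)"
  by (metis KRV_cases KRV_mult_class RV_obj_prod iso_class_in_KRV)

lemma KRV_mult_commute:
  assumes "a \<in> KRV S i" "b \<in> KRV S j" shows "KRV_mult S i j a b = KRV_mult S j i b a"
proof -
  obtain X Y where X: "X \<in> RV_obj S i" "a = iso_class S i X" and Y: "Y \<in> RV_obj S j" "b = iso_class S j Y"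
    using assms by (metis KRV_cases)
  note XY = iso_rel_obj_prod_commute[OF X(1) Y(1)]
  have "iso_class S (i + j) (obj_prod X Y) = iso_class S (i + j) (obj_prod Y X)"
    using XY iso_rel_obj[OF XY] by (simp add: iso_class_eq_iff)
  then show ?thesis
    using X Y KRV_mult_class[OF X(1) Y(1)] KRV_mult_class[OF Y(1) X(1)] by (simp add: add.commute)
qed

lemma KRV_mult_add:
  assumes a: "a \<in> KRV S i" and a': "a' \<in> KRV S i" and b: "b \<in> KRV S j"
  shows "KRV_mult S i j (KRV_add S i a a') b = KRV_add S (i + j) (KRV_mult S i j a b) (KRV_mult S i j a' b)"
proof -
  obtain X A where X: "X \<in> RV_obj S i" "KRV_add S i a a' = iso_class S i X"
    and A: "definable S (amb X) A" "A \<subseteq> pts X"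
    "iso_class S i (part X A) = a" "iso_class S i (part X (pts X - A)) = a'"
    using a a' by (rule KRV_addE)
  obtain Y where Y: "Y \<in> RV_obj S j" "b = iso_class S j Y" using b by (rule KRV_cases)
  have o: "part X A \<in> RV_obj S i" "part X (pts X - A) \<in> RV_obj S i"
    using X A by (auto intro!: RV_obj_part definable_Diff RV_obj_pts)
  let ?A = "{u @ v |u v. u \<in> A \<and> v \<in> pts Y}"
  have "pts (obj_prod X Y) - ?A = {u @ v |u v. u \<in> pts X - A \<and> v \<in> pts Y}"
    using length_pts[OF X(1)] A(2) by (auto simp: pts_obj_prod) blast
  moreover have "definable S (amb (obj_prod X Y)) ?A"
    unfolding amb_obj_prod by (intro definable_append A RV_obj_pts[OF Y(1)])
  moreover have "?A \<subseteq> pts (obj_prod X Y)" using A(2) by (auto simp: pts_obj_prod)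
  ultimately have "iso_class S (i + j) (obj_prod X Y) = KRV_add S (i + j)
      (iso_class S (i + j) (obj_prod (part X A) Y)) (iso_class S (i + j) (obj_prod (part X (pts X - A)) Y))"
    using iso_class_split[OF RV_obj_prod[OF X(1) Y(1)], of ?A] by (simp add: obj_prod_part)
  then show ?thesis
    using KRV_mult_class[OF X(1) Y(1)] KRV_mult_class[OF o(1) Y(1)] KRV_mult_class[OF o(2) Y(1)] X A Y by simp
qed

text \<open>
  The two objects differ by moving the new coordinate of the points to the end; the labels of
  corresponding points are equal.
\<close>
lemma iso_elem_blowup_prod:
  assumes X: "X \<in> RV_obj S i" and Y: "Y \<in> RV_obj S k" and j: "j < i"
  shows "(obj_prod (elem_blowup j X) Y, elem_blowup j (obj_prod X Y)) \<in> iso_rel S (i + k)"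
proof -
  let ?m = "amb X"
  let ?V = "obj_prod (elem_blowup j X) Y" and ?W = "elem_blowup j (obj_prod X Y)"
  define F where "F w = take ?m w @ drop (Suc ?m) w @ [w ! ?m]" for w :: "'a RV list"
  define G where "G w = take ?m w @ last w # butlast (drop ?m w)" for w :: "'a RV list"
  note XY = RV_obj_prod[OF X Y]
  have V: "?V \<in> RV_obj S (i + k)" using X Y j by (intro RV_obj_prod RV_obj_elem_blowup)
  have W: "?W \<in> RV_obj S (i + k)" using XY j by (intro RV_obj_elem_blowup) auto
  have amb: "amb ?V = ?m + 1 + amb Y" "amb ?W = ?m + amb Y + 1"
    by (auto simp: amb_obj_prod amb_elem_blowup)
  have pV: "pts ?V = {t @ x # v |t x v. t \<in> pts X \<and> x \<in> RV_gt1 \<and> v \<in> pts Y}"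
  proof (intro equalityI subsetI)
    fix w assume "w \<in> pts ?V"
    then show "w \<in> {t @ x # v |t x v. t \<in> pts X \<and> x \<in> RV_gt1 \<and> v \<in> pts Y}"
      unfolding pts_obj_prod pts_elem_blowup by auto blast
  next
    fix w assume "w \<in> {t @ x # v |t x v. t \<in> pts X \<and> x \<in> RV_gt1 \<and> v \<in> pts Y}"
    then obtain t x v where "w = (t @ [x]) @ v" "t \<in> pts X" "x \<in> RV_gt1" "v \<in> pts Y" by auto
    then show "w \<in> pts ?V" unfolding pts_obj_prod pts_elem_blowup by blast
  qed
  have pW: "pts ?W = {t @ v @ [x] |t x v. t \<in> pts X \<and> x \<in> RV_gt1 \<and> v \<in> pts Y}"
  proof (intro equalityI subsetI)
    fix w assume "w \<in> pts ?W"
    then show "w \<in> {t @ v @ [x] |t x v. t \<in> pts X \<and> x \<in> RV_gt1 \<and> v \<in> pts Y}"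
      unfolding pts_obj_prod pts_elem_blowup by auto blast
  next
    fix w assume "w \<in> {t @ v @ [x] |t x v. t \<in> pts X \<and> x \<in> RV_gt1 \<and> v \<in> pts Y}"
    then obtain t x v where "w = (t @ v) @ [x]" "t \<in> pts X" "x \<in> RV_gt1" "v \<in> pts Y" by auto
    then show "w \<in> pts ?W" unfolding pts_obj_prod pts_elem_blowup by blast
  qed
  have F: "F (t @ x # v) = t @ v @ [x]" and G: "G (t @ v @ [x]) = t @ x # v" if "t \<in> pts X" for t x v
    using length_pts[OF X that] by (simp_all add: F_def G_def nth_append butlast_append)
  have "definable_fun S (amb ?V) (amb ?W) (pts ?V) F"
  proof (rule definable_funI[where P = "\<lambda>w v. w \<in> pts ?V \<and> v = F w"])
    show "defpred S (\<lambda>s. map s [0..<amb ?V] \<in> pts ?V \<and>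
        map (\<lambda>i. s (i + amb ?V)) [0..<amb ?W] = F (map s [0..<amb ?V]))"
      unfolding F_def by (intro definability defpred_mem[OF RV_obj_pts[OF V]] defterm_nth) (simp add: amb)
    show "length (F w) = amb ?W" if "w \<in> pts ?V" for w
      using length_pts[OF V that] by (simp add: amb F_def)
  qed (use RV_obj_pts[OF V] in \<open>auto simp: graph_of_def\<close>)
  moreover have "bij_betw F (pts ?V) (pts ?W)"
  proof (rule bij_betw_byWitness[where f' = G])
    show "F ` pts ?V \<subseteq> pts ?W"
    proof (rule image_subsetI)
      fix w assume "w \<in> pts ?V"
      then obtain t x v where "w = t @ x # v" "t \<in> pts X" "x \<in> RV_gt1" "v \<in> pts Y" unfolding pV by blast
      then show "F w \<in> pts ?W" unfolding pW using F[of t x v] by blast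
    qed
    show "G ` pts ?W \<subseteq> pts ?V"
    proof (rule image_subsetI)
      fix w assume "w \<in> pts ?W"
      then obtain t x v where "w = t @ v @ [x]" "t \<in> pts X" "x \<in> RV_gt1" "v \<in> pts Y" unfolding pW by blast
      then show "G w \<in> pts ?V" unfolding pV using G[of t v x] by blast
    qed
  qed (auto simp: F G pV pW)
  moreover have "lab_equiv S (lab ?V w) (lab ?W (F w))" if w: "w \<in> pts ?V" for w
  proof -
    from w obtain t x v where t: "w = t @ x # v" "t \<in> pts X" "v \<in> pts Y" unfolding pV by blast
    note len = length_pts[OF X t(2)] length_pts[OF Y t(3)] length_lab[OF X t(2)]
    have "lab ?V w = (lab X t)[j := x * lab X t ! j] @ lab Y v"
      using len lab_obj_prod[of "t @ [x]" "elem_blowup j X" Y v]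
      by (simp add: t(1) amb_elem_blowup lab_elem_blowup)
    moreover have "lab ?W (F w) = (lab X t @ lab Y v)[j := x * (lab X t @ lab Y v) ! j]"
      using len lab_elem_blowup[of "t @ v" "obj_prod X Y" j x] t(2)
      by (simp only: t(1) F) (simp add: amb_obj_prod lab_obj_prod)
    ultimately have "lab ?W (F w) = lab ?V w"
      using len j by (simp add: list_update_append nth_append)
    then show ?thesis by (simp add: lab_equiv_refl)
  qed
  ultimately have "rv_iso S ?V ?W F" by (simp add: rv_iso_iff)
  then show ?thesis using V W by (intro iso_relI)
qed

lemma eb_class_mult:
  assumes a: "eb_class S i a e" and b: "b \<in> KRV S k"
  shows "eb_class S (i + k) (KRV_mult S i k a b) (KRV_mult S i k e b)"
proof -
  from a obtain X j where X: "X \<in> RV_obj S i" "blowup_coord S i j X"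
    "a = iso_class S i X" "e = iso_class S i (elem_blowup j X)"
    by (auto simp: eb_class_def)
  obtain Y where Y: "Y \<in> RV_obj S k" "b = iso_class S k Y" using b by (rule KRV_cases)
  have j: "j < i" using X(2) by (simp add: blowup_coord_def)
  have E: "elem_blowup j X \<in> RV_obj S i" using X(1) j by (rule RV_obj_elem_blowup)
  note XY = RV_obj_prod[OF X(1) Y(1)]
  have "blowup_coord S (i + k) j (obj_prod X Y)"
    using X(2) length_pts[OF X(1)] unfolding blowup_coord_iff[OF X(1)] blowup_coord_iff[OF XY]
    by (auto simp: pts_obj_prod lab_obj_prod intro!: dep_coord_append)
  moreover have "KRV_mult S i k e b = iso_class S (i + k) (elem_blowup j (obj_prod X Y))"
    using KRV_mult_class[OF E Y(1)] iso_elem_blowup_prod[OF X(1) Y(1) j]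
      iso_rel_obj[OF iso_elem_blowup_prod[OF X(1) Y(1) j]] X(4) Y(2) iso_class_eq_iff by metis
  ultimately show ?thesis
    unfolding eb_class_def using XY KRV_mult_class[OF X(1) Y(1)] X(3) Y(2) by blast
qed

text \<open>
  Multiplication by a fixed class distributes over sums and turns elementary blowups into
  elementary blowups, as a dependent coordinate stays dependent when further coordinates are added.
\<close>
lemma step_mult:
  assumes "KRV.step S i y z" "b \<in> KRV S k"
  shows "KRV.step S (i + k) (KRV_mult S i k y b) (KRV_mult S i k z b)"
proof -
  from assms(1) obtain c d e where *: "d \<in> KRV S i" "eb_class S i c e" "y = KRV_add S i c d" "z = KRV_add S i e d"
    unfolding KRV.step_def by blast
  show ?thesis
    unfolding KRV.step_def using * assms(2) eb_class_closed[OF *(2)]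
    by (intro exI[of _ "KRV_mult S i k c b"] exI[of _ "KRV_mult S i k d b"] exI[of _ "KRV_mult S i k e b"])
      (simp add: KRV_mult_add KRV_mult_closed eb_class_mult)
qed

lemma steps_mult:
  "(KRV.step S i)\<^sup>*\<^sup>* y z \<Longrightarrow> b \<in> KRV S k \<Longrightarrow>
   (KRV.step S (i + k))\<^sup>*\<^sup>* (KRV_mult S i k y b) (KRV_mult S i k z b)"
  by (induction rule: rtranclp_induct) (auto dest: step_mult intro: rtranclp.rtrancl_into_rtrancl)

lemma joinable_mult_right:
  assumes "(a, a') \<in> KRV.joinable S i" "b \<in> KRV S k"
  shows "(KRV_mult S i k a b, KRV_mult S i k a' b) \<in> KRV.joinable S (i + k)"
proof -
  from assms(1) obtain w where w: "a \<in> KRV S i" "a' \<in> KRV S i" "(KRV.step S i)\<^sup>*\<^sup>* a w" "(KRV.step S i)\<^sup>*\<^sup>* a' w"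
    by (auto simp: KRV.joinable_def)
  show ?thesis
    using w assms(2) by (intro KRV.joinableI[OF _ _ steps_mult[OF w(3)] steps_mult[OF w(4)]] KRV_mult_closed)
qed

lemma joinable_mult:
  assumes "(a, a') \<in> KRV.joinable S i" "(b, b') \<in> KRV.joinable S k"
  shows "(KRV_mult S i k a b, KRV_mult S i k a' b') \<in> KRV.joinable S (i + k)"
proof -
  have M: "a \<in> KRV S i" "a' \<in> KRV S i" "b \<in> KRV S k" "b' \<in> KRV S k"
    using assms by (auto simp: KRV.joinable_def)
  have "(KRV_mult S i k a b, KRV_mult S i k a' b) \<in> KRV.joinable S (i + k)"
    using assms(1) M(3) by (rule joinable_mult_right)
  moreover have "(KRV_mult S i k a' b, KRV_mult S i k a' b') \<in> KRV.joinable S (i + k)"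
    using joinable_mult_right[OF assms(2) M(2)] M by (simp add: KRV_mult_commute add.commute)
  ultimately show ?thesis by (rule KRV.joinable_trans)
qed

section \<open>The congruence on each graded piece\<close>

lemma blowup_imp_step:
  assumes Y: "Y \<in> RV_obj S k" and "blowup S k Y Z"
  shows "Z \<in> RV_obj S k" "KRV.step S k (iso_class S k Y) (iso_class S k Z)"
proof -
  from assms(2) obtain C X j where C: "C \<subseteq> pts Y" "definable S (amb Y) C" and X: "blowup_coord S k j X"
    "(X, part Y C) \<in> iso_rel S k" and Z: "Z = disj_union (elem_blowup j X) (part Y (pts Y - C))"
    unfolding blowup_def by blast
  note o = iso_rel_obj[OF X(2)]
  have E: "elem_blowup j X \<in> RV_obj S k" using o X by (intro RV_obj_elem_blowup) (auto simp: blowup_coord_def)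
  have D: "part Y (pts Y - C) \<in> RV_obj S k" using Y C by (intro RV_obj_part definable_Diff RV_obj_pts) auto
  show "Z \<in> RV_obj S k" unfolding Z using E D by (rule RV_obj_disj_union)
  have "eb_class S k (iso_class S k (part Y C)) (iso_class S k (elem_blowup j X))"
    unfolding eb_class_def using o X iso_class_eq_iff[OF o] by blast
  then show "KRV.step S k (iso_class S k Y) (iso_class S k Z)"
    unfolding KRV.step_def Z using iso_class_split[OF Y C(2,1)] KRV_add_class[OF E D] iso_class_in_KRV[OF D]
    by metis
qed

lemma step_imp_blowup:
  assumes Y: "Y \<in> RV_obj S k" and "KRV.step S k (iso_class S k Y) z"
  obtains Z where "blowup S k Y Z" "z = iso_class S k Z"
proof -
  from assms(2) obtain c d e where *: "d \<in> KRV S k" "eb_class S k c e"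
    "iso_class S k Y = KRV_add S k c d" "z = KRV_add S k e d"
    unfolding KRV.step_def by blast
  from *(2) obtain X j where X: "X \<in> RV_obj S k" "blowup_coord S k j X"
    "c = iso_class S k X" "e = iso_class S k (elem_blowup j X)"
    by (auto simp: eb_class_def)
  have c: "c \<in> KRV S k" using X iso_class_in_KRV by blast
  obtain C where C: "definable S (amb Y) C" "C \<subseteq> pts Y" "iso_class S k (part Y C) = c"
    "iso_class S k (part Y (pts Y - C)) = d"
    using iso_class_eq_addE[OF Y c *(1,3)] by blast
  have E: "elem_blowup j X \<in> RV_obj S k" using X by (intro RV_obj_elem_blowup) (auto simp: blowup_coord_def)
  have D: "part Y (pts Y - C) \<in> RV_obj S k" using Y C by (intro RV_obj_part definable_Diff RV_obj_pts) auto
  have "(X, part Y C) \<in> iso_rel S k"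
    using iso_class_eq_iff[OF X(1) RV_obj_part[OF Y C(1,2)]] X(3) C(3) by simp
  then have "blowup S k Y (disj_union (elem_blowup j X) (part Y (pts Y - C)))"
    unfolding blowup_def using X(2) C(1,2) by blast
  moreover have "z = iso_class S k (disj_union (elem_blowup j X) (part Y (pts Y - C)))"
    using KRV_add_class[OF E D] *(4) X(4) C(4) by simp
  ultimately show thesis by (rule that)
qed

lemma blowups_imp_steps:
  assumes "(blowup S k)\<^sup>*\<^sup>* Y Z" "Y \<in> RV_obj S k"
  shows "Z \<in> RV_obj S k \<and> (KRV.step S k)\<^sup>*\<^sup>* (iso_class S k Y) (iso_class S k Z)"
  using assms by (induction rule: rtranclp_induct)
    (auto dest: blowup_imp_step intro: rtranclp.rtrancl_into_rtrancl)

lemma steps_imp_blowups: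
  assumes "(KRV.step S k)\<^sup>*\<^sup>* (iso_class S k Y) z" "Y \<in> RV_obj S k"
  shows "\<exists>Z. (blowup S k)\<^sup>*\<^sup>* Y Z \<and> Z \<in> RV_obj S k \<and> z = iso_class S k Z"
  using assms
proof (induction rule: rtranclp_induct)
  case (step z z')
  then obtain Z where Z: "(blowup S k)\<^sup>*\<^sup>* Y Z" "Z \<in> RV_obj S k" "z = iso_class S k Z" by blast
  from step(2) obtain Z' where "blowup S k Z Z'" "z' = iso_class S k Z'"
    unfolding Z(3) by (rule step_imp_blowup[OF Z(2)])
  then show ?case
    using rtranclp.rtrancl_into_rtrancl[OF Z(1)] blowup_imp_step(1)[OF Z(2)] by blast
qed auto

text \<open>
  Blowing up a representative and blowing up a class amount to the same, since blowups of the
  class can be lifted to every representative. The relation \<^const>\<open>Isp\<close> is thus the abstract one,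
  and all statements about it can be proved on classes.
\<close>
lemma Isp_eq_joinable: "Isp S k = KRV.joinable S k"
proof (intro equalityI subrelI)
  fix a b assume "(a, b) \<in> Isp S k"
  then obtain X Y X' Y' where o: "X \<in> RV_obj S k" "Y \<in> RV_obj S k" "a = iso_class S k X" "b = iso_class S k Y"
    and bl: "(blowup S k)\<^sup>*\<^sup>* X X'" "(blowup S k)\<^sup>*\<^sup>* Y Y'" and iso: "(X', Y') \<in> iso_rel S k"
    unfolding Isp_def isp_obj_def by blast
  have "iso_class S k X' = iso_class S k Y'" using iso iso_rel_obj[OF iso] by (simp add: iso_class_eq_iff)
  then show "(a, b) \<in> KRV.joinable S k"
    using blowups_imp_steps[OF bl(1) o(1)] blowups_imp_steps[OF bl(2) o(2)] o
    by (intro KRV.joinableI[of _ _ _ _ "iso_class S k X'"]) (auto intro: iso_class_in_KRV)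
next
  fix a b assume "(a, b) \<in> KRV.joinable S k"
  then obtain w where M: "a \<in> KRV S k" "b \<in> KRV S k" "(KRV.step S k)\<^sup>*\<^sup>* a w" "(KRV.step S k)\<^sup>*\<^sup>* b w"
    by (auto simp: KRV.joinable_def)
  obtain X Y where X: "X \<in> RV_obj S k" "a = iso_class S k X" and Y: "Y \<in> RV_obj S k" "b = iso_class S k Y"
    using M by (metis KRV_cases)
  obtain X' where X': "(blowup S k)\<^sup>*\<^sup>* X X'" "X' \<in> RV_obj S k" "w = iso_class S k X'"
    using steps_imp_blowups M(3) X by blast
  obtain Y' where Y': "(blowup S k)\<^sup>*\<^sup>* Y Y'" "Y' \<in> RV_obj S k" "w = iso_class S k Y'"
    using steps_imp_blowups M(4) Y by blast
  have "(X', Y') \<in> iso_rel S k" using iso_class_eq_iff[OF X'(2) Y'(2)] X'(3) Y'(3) by simp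
  then have "(X, Y) \<in> isp_obj S k" using X Y X' Y' by (auto simp: isp_obj_def)
  then show "(a, b) \<in> Isp S k" using X Y by (auto simp: Isp_def)
qed

lemma semigroup_congruence_Isp: "semigroup_congruence (KRV S k) (KRV_add S k) (Isp S k)"
  unfolding Isp_eq_joinable by (rule KRV.semigroup_congruence_joinable)

section \<open>The graded semiring\<close>

lemma RV_obj_empty: "pts X = {} \<Longrightarrow> X \<in> RV_obj S k"
  by (auto simp: RV_obj_def definable_fun_def definable_empty)

lemma iso_class_empty: "pts X = {} \<Longrightarrow> iso_class S k X = KRV_zero S k"
proof -
  assume X: "pts X = {}"
  have o: "pts (obj_empty :: 'a rv_obj) = {}" by (simp add: obj_empty_def)
  have "rv_iso S X obj_empty (\<lambda>_. [])"
    using X o by (auto simp: rv_iso_iff definable_fun_def definable_empty bij_betw_def)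
  then have "(X, obj_empty) \<in> iso_rel S k" using X o by (intro iso_relI RV_obj_empty)
  then show ?thesis
    unfolding KRV_zero_def using iso_class_eq_iff[of X S k obj_empty] RV_obj_empty X o by blast
qed

lemma KRV_zero_closed: "KRV_zero S k \<in> KRV S k"
  unfolding KRV_zero_def by (intro iso_class_in_KRV RV_obj_empty) (simp add: obj_empty_def)

lemma KRV_add_zero: "a \<in> KRV S k \<Longrightarrow> KRV_add S k a (KRV_zero S k) = a"
proof -
  assume "a \<in> KRV S k"
  then obtain X where X: "X \<in> RV_obj S k" "a = iso_class S k X" by (rule KRV_cases)
  have "iso_class S k (part X (pts X - pts X)) = KRV_zero S k" by (rule iso_class_empty) simp
  then show ?thesis using iso_class_split[OF X(1) RV_obj_pts[OF X(1)]] X(2) by simp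
qed

lemma KRV_mult_zero: "b \<in> KRV S j \<Longrightarrow> KRV_mult S i j (KRV_zero S i) b = KRV_zero S (i + j)"
proof -
  assume "b \<in> KRV S j"
  then obtain Y where Y: "Y \<in> RV_obj S j" "b = iso_class S j Y" by (rule KRV_cases)
  have "obj_empty \<in> RV_obj S i" by (intro RV_obj_empty) (simp add: obj_empty_def)
  then have "KRV_mult S i j (KRV_zero S i) b = iso_class S (i + j) (obj_prod obj_empty Y)"
    using Y by (simp add: KRV_zero_def KRV_mult_class)
  also have "\<dots> = KRV_zero S (i + j)" by (rule iso_class_empty) (simp add: obj_prod_def obj_empty_def)
  finally show ?thesis .
qed

lemma Isp_closed: "(a, b) \<in> Isp S k \<Longrightarrow> a \<in> KRV S k \<and> b \<in> KRV S k"
  by (auto simp: Isp_eq_joinable KRV.joinable_def)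

lemma Isp_refl: "a \<in> KRV S k \<Longrightarrow> (a, a) \<in> Isp S k"
  by (auto simp: Isp_eq_joinable intro: KRV.joinableI)

lemma Isp_sum:
  "(\<And>i. i \<in> set xs \<Longrightarrow> (f i, g i) \<in> Isp S k) \<Longrightarrow>
   (foldr (KRV_add S k) (map f xs) (KRV_zero S k), foldr (KRV_add S k) (map g xs) (KRV_zero S k)) \<in> Isp S k"
  using semigroup_congruence_Isp[of S k]
  by (induction xs) (auto simp: semigroup_congruence_def Isp_refl KRV_zero_closed)

lemma KRVs_mult_Isp:
  assumes "\<And>k. (a k, a' k) \<in> Isp S k" "\<And>k. (b k, b' k) \<in> Isp S k"
  shows "(KRVs_mult S a b k, KRVs_mult S a' b' k) \<in> Isp S k"
  unfolding KRVs_mult_def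
proof (rule Isp_sum)
  fix i assume "i \<in> set [0..<Suc k]"
  then have "i + (k - i) = k" by auto
  then show "(KRV_mult S i (k - i) (a i) (b (k - i)), KRV_mult S i (k - i) (a' i) (b' (k - i))) \<in> Isp S k"
    using joinable_mult[of "a i" "a' i" S i "b (k - i)" "b' (k - i)" "k - i"] assms
    by (simp add: Isp_eq_joinable)
qed

lemma KRVs_I:
  assumes "\<And>k. a k \<in> KRV S k" "\<And>k. N \<le> k \<Longrightarrow> a k = KRV_zero S k" shows "a \<in> KRVs S"
proof -
  have "{k. a k \<noteq> KRV_zero S k} \<subseteq> {..<N}" using assms(2) not_le_imp_less by auto
  then show ?thesis using assms(1) finite_subset[OF _ finite_lessThan] by (auto simp: KRVs_def)
qed

lemma KRVs_bound:
  assumes "a \<in> KRVs S" obtains N where "\<And>k. N \<le> k \<Longrightarrow> a k = KRV_zero S k"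
proof -
  from assms obtain N where "\<forall>k\<in>{k. a k \<noteq> KRV_zero S k}. k < N"
    using finite_nat_set_iff_bounded by (auto simp: KRVs_def)
  then show thesis using that[of N] by force
qed

lemma KRVs_add_closed:
  assumes a: "a \<in> KRVs S" and b: "b \<in> KRVs S" shows "KRVs_add S a b \<in> KRVs S"
proof -
  obtain N M where N: "\<And>k. N \<le> k \<Longrightarrow> a k = KRV_zero S k" "\<And>k. M \<le> k \<Longrightarrow> b k = KRV_zero S k"
    using KRVs_bound[OF a] KRVs_bound[OF b] by metis
  show ?thesis
    using a b N by (intro KRVs_I[of _ _ "max N M"])
      (auto simp: KRVs_add_def KRVs_def KRV_add_closed KRV_add_zero KRV_zero_closed)
qed

lemma KRVs_mult_closed:
  assumes a: "a \<in> KRVs S" and b: "b \<in> KRVs S" shows "KRVs_mult S a b \<in> KRVs S"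
proof -
  obtain N M where N: "\<And>k. N \<le> k \<Longrightarrow> a k = KRV_zero S k" and M: "\<And>k. M \<le> k \<Longrightarrow> b k = KRV_zero S k"
    using KRVs_bound[OF a] KRVs_bound[OF b] by metis
  have ab: "a k \<in> KRV S k" "b k \<in> KRV S k" for k using a b by (auto simp: KRVs_def)
  show ?thesis
  proof (rule KRVs_I[of _ _ "N + M"])
    show "KRVs_mult S a b k \<in> KRV S k" for k
      using KRVs_mult_Isp[of a a S b b k] ab Isp_refl Isp_closed by metis
    fix k assume k: "N + M \<le> k"
    (* if i + (k - i) is at least N + M, then i is at least N or k - i is at least M *)
    have zero: "KRV_mult S i (k - i) (a i) (b (k - i)) = KRV_zero S k" if "i \<in> set [0..<Suc k]" for i
    proof -
      have i: "i + (k - i) = k" using that by auto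
      show ?thesis
      proof (cases "N \<le> i")
        case True
        then show ?thesis using KRV_mult_zero[of "b (k - i)" S "k - i" i] ab N i by simp
      next
        case False
        then have "b (k - i) = KRV_zero S (k - i)" using k by (intro M) auto
        then show ?thesis
          using KRV_mult_zero[of "a i" S i "k - i"] KRV_mult_commute[of "a i" S i "b (k - i)" "k - i"] ab[of i] ab[of "k - i"] i
          by (simp add: add.commute)
      qed
    qed
    have sum_zero: "foldr (KRV_add S k) (map f xs) (KRV_zero S k) = KRV_zero S k"
      if "\<And>i. i \<in> set xs \<Longrightarrow> f i = KRV_zero S k" for f :: "nat \<Rightarrow> _" and xs
      using that by (induction xs) (auto simp: KRV_add_zero KRV_zero_closed)
    show "KRVs_mult S a b k = KRV_zero S k"
      unfolding KRVs_mult_def by (rule sum_zero) (rule zero)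
  qed
qed

lemma equiv_Isps: "equiv (KRVs S) (Isps S)"
proof -
  have eq: "equiv (KRV S k) (Isp S k)" for k
    using semigroup_congruence_Isp[of S k] by (simp add: semigroup_congruence_def)
  have sym: "(b, a) \<in> Isp S k" if "(a, b) \<in> Isp S k" for a b k
    using eq[of k] that by (metis equiv_def symD)
  have trans: "(a, c) \<in> Isp S k" if "(a, b) \<in> Isp S k" "(b, c) \<in> Isp S k" for a b c k
    using eq[of k] that by (metis equiv_def transD)
  show ?thesis
  proof (rule equivI)
    show "refl_on (KRVs S) (Isps S)" by (auto simp: refl_on_def Isps_def KRVs_def Isp_refl)
    show "Isps S \<subseteq> KRVs S \<times> KRVs S" by (auto simp: Isps_def)
    show "sym (Isps S)" by (auto simp: sym_def Isps_def intro: sym)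
    show "trans (Isps S)" unfolding trans_def Isps_def using trans by blast
  qed
qed

theorem lemma6p8:
  fixes S :: "('a::acvf0 + 'a RV) set" and \<kappa> :: "'c rel"
  assumes "Card_order \<kappa>" and "natLeq <o \<kappa>"
    and "saturated TYPE('a) \<kappa>"
    and "substructure S" and "|S| <o \<kappa>"
    and "nontrivial_value_group S"
  shows "(\<forall>k. semigroup_congruence (KRV S k) (KRV_add S k) (Isp S k)) \<and>
         semiring_congruence (KRVs S) (KRVs_add S) (KRVs_mult S) (Isps S)"
proof (intro conjI allI)
  show Isp: "semigroup_congruence (KRV S k) (KRV_add S k) (Isp S k)" for k
    by (rule semigroup_congruence_Isp)
  have "(KRVs_add S a b, KRVs_add S a' b') \<in> Isps S" if "(a, a') \<in> Isps S" "(b, b') \<in> Isps S" for a a' b b'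
    using that Isp KRVs_add_closed by (auto simp: Isps_def KRVs_add_def semigroup_congruence_def)
  moreover have "(KRVs_mult S a b, KRVs_mult S a' b') \<in> Isps S" if "(a, a') \<in> Isps S" "(b, b') \<in> Isps S" for a a' b b'
    using that by (auto simp: Isps_def intro!: KRVs_mult_closed KRVs_mult_Isp)
  ultimately show "semiring_congruence (KRVs S) (KRVs_add S) (KRVs_mult S) (Isps S)"
    using equiv_Isps by (auto simp: semiring_congruence_def semigroup_congruence_def)
qed

end
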